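(* Let $n\ge1$, let $P$ be the polynomial determined by $P(0)=0$ and $1+wP'(w)=(1-w)^n$, and let $f\colon\mathbb{C}\to\mathbb{C}$, $f(z)=z-P(e^{-z})$. Then the Baker domain of $f$ that contains the positive real axis is an expanding Baker domain.
   Context: The function $f$ is semiconjugate, via $w=e^{-z}$, to $F(w)=we^{P(w)}$, which has a parabolic fixed point at $0$; the parabolic basin of $0$ lifts to countably many Baker domains of $f$, one of which contains the positive real axis. Doubly parabolic Baker domains. A doubly parabolic Baker domain $U$ of a transcendental entire function $f$ is an invariant Fatou component (connected component of the Fatou set with $f(U)\subset U$; it is simply connected) on which the iterates $f^n$ converge locally uniformly to $\infty$ and such that for $z\in U$ the hyperbolic distance in $U$ between $f^n(z)$ and $f^{n+1}(z)$ tends to $0$. For a Riemann map $\varphi\colon\mathbb{D}\to U$, the inner function $g=\varphi^{-1}\circ f\circ\varphi$ is the associated inner function; its Denjoy-Wolff point is the point of $\partial\mathbb{D}$ to which all interior orbits of $g$ converge. A singularity of $g$ is a point of $\partial\mathbb{D}$ near which $g$ has no analytic extension. Finite targets. Let $\psi\colon\mathbb{H}\to U$ be a conformal map from the upper half-plane onto $U$ such that points of $\mathbb{H}$ converge to $\infty$ under iteration of $\psi^{-1}\circ f\circ\psi$, and $\psi^*$ its boundary extension by radial (non-tangential) limits. A finite target is a set $\psi^*(I)\subset\partial U$, where $I\subset\mathbb{R}$ is a closed bounded interval with endpoints $x_1\neq x_2$ such that $\psi^*(x_1)=\psi^*(x_2)=\infty$. Expanding Baker domains. $U$ is an expanding Baker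 domain if there exists $r>0$ such that: (a) $U$ is a doubly parabolic Baker domain and the Denjoy-Wolff point of the associated inner function is not a singularity; (b) for every $x,y\in\partial U$ with $f(y)=x$ there exists a branch $F_y$ of $f^{-1}$ with $F_y(x)=y$, well defined in $D(x,r)$, and $F_y(D(x,r)\cap U)\subset U$; (c) $|f'(z)|>1$ for $z\in D(x,r)$, for all $x\in\partial U$; and for every finite target $E$ there is $K_E>1$ with $|f'(z)|\ge K_E$ for $z\in D(x,r)$, for all $x\in E$. *)

theory Defs
  imports "HOL-Complex_Analysis.Complex_Analysis"
begin

definition locally_uniform_limit ::
  "complex set \<Rightarrow> (nat \<Rightarrow> complex \<Rightarrow> complex) \<Rightarrow> (complex \<Rightarrow> complex) \<Rightarrow> bool" where
  "locally_uniform_limit U g h \<longleftrightarrow>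
     (\<forall>K. compact K \<and> K \<subseteq> U \<longrightarrow> uniform_limit K g h sequentially)"

definition locally_uniform_to_infinity ::
  "complex set \<Rightarrow> (nat \<Rightarrow> complex \<Rightarrow> complex) \<Rightarrow> bool" where
  "locally_uniform_to_infinity U g \<longleftrightarrow>
     (\<forall>K. compact K \<and> K \<subseteq> U \<longrightarrow>
        (\<forall>M. \<forall>\<^sub>F k in sequentially. \<forall>z\<in>K. norm (g k z) > M))"

text \<open>
  Normality with values in the Riemann sphere. The limit of a sequence of holomorphic functions
  on a connected open set is either finite everywhere or identically infinity, so on connected
  sets (below: discs) the following dichotomy is locally uniform spherical convergence.
\<close>

definition normal_family_on :: "(complex \<Rightarrow> complex) set \<Rightarrow> complex set \<Rightarrow> bool" where
  "normal_family_on \<F> U \<longleftrightarrow>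
     (\<forall>g :: nat \<Rightarrow> complex \<Rightarrow> complex. range g \<subseteq> \<F> \<longrightarrow>
        (\<exists>s :: nat \<Rightarrow> nat. strict_mono s \<and>
           ((\<exists>h. locally_uniform_limit U (g \<circ> s) h) \<or> locally_uniform_to_infinity U (g \<circ> s))))"

definition fatou_set :: "(complex \<Rightarrow> complex) \<Rightarrow> complex set" where
  "fatou_set f = {z. \<exists>\<rho>>0. normal_family_on (range (\<lambda>k. f ^^ k)) (ball z \<rho>)}"

definition transcendental_entire :: "(complex \<Rightarrow> complex) \<Rightarrow> bool" where
  "transcendental_entire f \<longleftrightarrow> f holomorphic_on UNIV \<and> \<not> (\<exists>p. \<forall>z. f z = poly p z)"

definition baker_domain :: "(complex \<Rightarrow> complex) \<Rightarrow> complex set \<Rightarrow> bool" where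
  "baker_domain f U \<longleftrightarrow>
     transcendental_entire f \<and> U \<in> components (fatou_set f) \<and> f ` U \<subseteq> U \<and>
     locally_uniform_to_infinity U (\<lambda>k. f ^^ k)"

definition conformal_onto :: "(complex \<Rightarrow> complex) \<Rightarrow> complex set \<Rightarrow> complex set \<Rightarrow> bool" where
  "conformal_onto \<phi> S U \<longleftrightarrow> \<phi> holomorphic_on S \<and> bij_betw \<phi> S U"

abbreviation unit_disc :: "complex set" where
  "unit_disc \<equiv> ball 0 1"

abbreviation upper_half_plane :: "complex set" where
  "upper_half_plane \<equiv> {z. Im z > 0}"

definition disc_hyperbolic_dist :: "complex \<Rightarrow> complex \<Rightarrow> real" where
  "disc_hyperbolic_dist p q = 2 * artanh (norm ((p - q) / (1 - cnj q * p)))"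

text \<open>
  Meaningful for simply connected domains other than the plane; there the transported distance
  does not depend on the Riemann map, by the Schwarz--Pick lemma.
\<close>

definition hyperbolic_dist :: "complex set \<Rightarrow> complex \<Rightarrow> complex \<Rightarrow> real" where
  "hyperbolic_dist U z w =
     (THE d. \<exists>\<phi> p q. conformal_onto \<phi> unit_disc U \<and> p \<in> unit_disc \<and> q \<in> unit_disc \<and>
        \<phi> p = z \<and> \<phi> q = w \<and> d = disc_hyperbolic_dist p q)"

definition doubly_parabolic_baker_domain :: "(complex \<Rightarrow> complex) \<Rightarrow> complex set \<Rightarrow> bool" where
  "doubly_parabolic_baker_domain f U \<longleftrightarrow>
     baker_domain f U \<and> simply_connected U \<and>
     (\<forall>z\<in>U. (\<lambda>k. hyperbolic_dist U ((f ^^ k) z) ((f ^^ Suc k) z)) \<longlonglongrightarrow> 0)"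

definition conjugated_map ::
  "(complex \<Rightarrow> complex) \<Rightarrow> (complex \<Rightarrow> complex) \<Rightarrow> complex set \<Rightarrow> complex \<Rightarrow> complex" where
  "conjugated_map f \<phi> S = inv_into S \<phi> \<circ> f \<circ> \<phi>"

definition denjoy_wolff_point :: "(complex \<Rightarrow> complex) \<Rightarrow> complex \<Rightarrow> bool" where
  "denjoy_wolff_point g \<zeta> \<longleftrightarrow>
     \<zeta> \<in> sphere 0 1 \<and> (\<forall>z\<in>unit_disc. (\<lambda>k. (g ^^ k) z) \<longlonglongrightarrow> \<zeta>)"

definition inner_singularity :: "(complex \<Rightarrow> complex) \<Rightarrow> complex \<Rightarrow> bool" where
  "inner_singularity g \<zeta> \<longleftrightarrow>
     \<zeta> \<in> sphere 0 1 \<and>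
     \<not> (\<exists>\<rho>>0. \<exists>h. h holomorphic_on ball \<zeta> \<rho> \<and> (\<forall>z\<in>ball \<zeta> \<rho> \<inter> unit_disc. h z = g z))"

text \<open>
  Approach to a real point inside the Stolz angles of the upper half-plane. A non-tangential
  limit is one along \<open>at_stolz x c\<close> for every aperture \<open>c > 0\<close>.
\<close>

definition at_stolz :: "real \<Rightarrow> real \<Rightarrow> complex filter" where
  "at_stolz x c = at (of_real x) within {z. Im z > 0 \<and> \<bar>Re z - x\<bar> \<le> c * Im z}"

definition nontangential_limit :: "(complex \<Rightarrow> complex) \<Rightarrow> real \<Rightarrow> complex \<Rightarrow> bool" where
  "nontangential_limit \<psi> x w \<longleftrightarrow> (\<forall>c>0. (\<psi> \<longlongrightarrow> w) (at_stolz x c))"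

definition nontangential_limit_infinity :: "(complex \<Rightarrow> complex) \<Rightarrow> real \<Rightarrow> bool" where
  "nontangential_limit_infinity \<psi> x \<longleftrightarrow> (\<forall>c>0. filterlim \<psi> at_infinity (at_stolz x c))"

text \<open>
  \<open>E\<close> consists of the finite values of the boundary extension on the interval \<open>[x1, x2]\<close>;
  the value infinity, taken at least at \<open>x1\<close> and \<open>x2\<close>, is not recorded in \<open>E\<close>. Points of the
  interval at which the boundary extension is undefined contribute nothing.
\<close>

definition finite_target :: "(complex \<Rightarrow> complex) \<Rightarrow> complex set \<Rightarrow> complex set \<Rightarrow> bool" where
  "finite_target f U E \<longleftrightarrow>
     (\<exists>\<psi> x1 x2.
        conformal_onto \<psi> upper_half_plane U \<and>
        (\<forall>z\<in>upper_half_plane.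
           filterlim (\<lambda>k. (conjugated_map f \<psi> upper_half_plane ^^ k) z) at_infinity sequentially) \<and>
        x1 < x2 \<and>
        nontangential_limit_infinity \<psi> x1 \<and> nontangential_limit_infinity \<psi> x2 \<and>
        E = {w. \<exists>x\<in>{x1..x2}. nontangential_limit \<psi> x w})"

definition expanding_baker_domain :: "(complex \<Rightarrow> complex) \<Rightarrow> complex set \<Rightarrow> bool" where
  "expanding_baker_domain f U \<longleftrightarrow>
     (\<exists>r>0.
        (doubly_parabolic_baker_domain f U \<and>
         (\<forall>\<phi>. conformal_onto \<phi> unit_disc U \<longrightarrow>
            (\<exists>\<zeta>. denjoy_wolff_point (conjugated_map f \<phi> unit_disc) \<zeta> \<and>
                 \<not> inner_singularity (conjugated_map f \<phi> unit_disc) \<zeta>))) \<and>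
        (\<forall>x\<in>frontier U. \<forall>y\<in>frontier U. f y = x \<longrightarrow>
            (\<exists>F. F holomorphic_on ball x r \<and> (\<forall>z\<in>ball x r. f (F z) = z) \<and> F x = y \<and>
                 F ` (ball x r \<inter> U) \<subseteq> U)) \<and>
        (\<forall>x\<in>frontier U. \<forall>z\<in>ball x r. norm (deriv f z) > 1) \<and>
        (\<forall>E. finite_target f U E \<longrightarrow>
            (\<exists>K>1. \<forall>x\<in>E. \<forall>z\<in>ball x r. norm (deriv f z) \<ge> K)))"

end

theory Submission
  imports Defs
begin

text \<open>
  In the coordinate \<open>u = 1 - e\<^sup>-\<^sup>z\<close> one has \<open>f' = u\<^sup>n\<close> and \<open>f(z) = z + H\<^sub>n - (u + u\<^sup>2/2 + \<dots> + u\<^sup>n/n)\<close>. The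
  lines \<open>\<bar>Im z\<bar> = \<pi>\<close> are invariant and their points escape to the left at least exponentially, while
  \<open>{\<bar>u\<bar> < 1}\<close> is an invariant petal whose points drift to the right. The basin is the increasing union
  of the preimages of the petal inside the strip \<open>\<bar>Im z\<bar> < \<pi>\<close>. In the strip \<open>H\<^sub>n\<close> is the only critical
  value and 0 its only preimage, so \<open>f - H\<^sub>n\<close> has an \<open>(n+1)\<close>-st root \<open>\<zeta>\<close>, and \<open>\<zeta>\<close> is injective where
  \<open>f\<close> takes values in the strip. Hence the preimages of the petal are simply connected, and a Riemann
  map of the basin lifts through \<open>f\<close> to another one, which makes the inner function the Blaschke
  product \<open>(v\<^sup>n\<^sup>+\<^sup>1 + c) / (1 + c v\<^sup>n\<^sup>+\<^sup>1)\<close>. Different escape rates and Harnack's inequality show that no boundary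
  point of the basin is in the Fatou set. A boundary point far to the right in a finite target would
  correspond to a point of the circle, at a definite distance from the Denjoy--Wolff point 1, that stays
  for a long time in the sector adjacent to 1, on which the Blaschke product expands away from 1.
\<close>

section \<open>Conformal maps of the disc\<close>

text \<open>The hypothesis on \<open>P\<close> says \<open>f' = (1 - w) ^ n\<close> at
  \<open>w = exp (- z)\<close>, which makes \<open>1 - w\<close> the natural coordinate:
  \<open>f\<close> fails to expand exactly where \<open>|u| <= 1\<close>. Along the frontier of the
  basin \<open>|f'|\<close> can come close to 1 only as \<open>Re z\<close> tends to infinity, so
  the constants for finite targets come down to an upper bound for \<open>Re\<close> on each target.
  The frontier itself is never parametrised: a point of a target is a limit of points of the basin
  along which the model coordinate converges as well, and only the model map, being rational, is
  evaluated on the circle. The uniform radius \<open>r\<close> meets its difficulty at the same end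
  of the strip, because the closed petal is unbounded. In the coordinate \<open>exp z\<close>, where
  \<open>f\<close> is nearly the translation by \<open>n\<close>, the petal is a half-plane, while
  the basin contains everything outside a right-angled sector around the negative axis; so the
  margin of the petal inside the basin does not shrink to the right.\<close>

lemma conformal_onto_inv_into:
  assumes "open S" and "conformal_onto \<phi> S U"
  shows "conformal_onto (inv_into S \<phi>) U S"
proof -
  have hol: "\<phi> holomorphic_on S" and bij: "bij_betw \<phi> S U"
    using assms by (auto simp: conformal_onto_def)
  have inj: "inj_on \<phi> S" and im: "\<phi> ` S = U"
    using bij by (auto simp: bij_betw_def)
  obtain g where g: "g holomorphic_on \<phi> ` S" "\<And>z. z \<in> S \<Longrightarrow> g (\<phi> z) = z"
    using holomorphic_has_inverse[OF hol \<open>open S\<close> inj] by metis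
  have "inv_into S \<phi> w = g w" if "w \<in> U" for w
    using that im g(2) inj by (auto simp: inv_into_f_f)
  then have "inv_into S \<phi> holomorphic_on U"
    using g(1) im by (metis holomorphic_cong)
  then show ?thesis
    using bij by (simp add: conformal_onto_def bij_betw_inv_into)
qed

lemma conformal_onto_comp:
  assumes "conformal_onto \<phi> S U" and "conformal_onto \<theta> U V"
  shows "conformal_onto (\<theta> \<circ> \<phi>) S V"
  using assms unfolding conformal_onto_def
  by (auto simp: bij_betw_def intro: holomorphic_on_compose_gen comp_inj_on)

lemma Moebius_function_conformal_onto:
  assumes "norm a < 1"
  shows "conformal_onto (Moebius_function 0 a) unit_disc unit_disc"
proof -
  have "bij_betw (Moebius_function 0 a) unit_disc unit_disc"
    by (rule bij_betw_byWitness[where f' = "Moebius_function 0 (- a)"])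
      (use assms in \<open>auto simp: Moebius_function_compose Moebius_function_norm_lt_1\<close>)
  then show ?thesis
    using assms by (simp add: conformal_onto_def Moebius_function_holomorphic)
qed

text \<open>Disc automorphisms move \<open>b\<close> and \<open>h b\<close> to 0, where the Schwarz
  lemma applies.\<close>

lemma Schwarz_Pick:
  assumes hol: "h holomorphic_on unit_disc" and im: "h ` unit_disc \<subseteq> unit_disc"
    and a: "a \<in> unit_disc" and b: "b \<in> unit_disc"
  shows "norm (Moebius_function 0 (h b) (h a)) \<le> norm (Moebius_function 0 b a)"
proof -
  define k where "k = Moebius_function 0 (h b) \<circ> (h \<circ> Moebius_function 0 (- b))"
  have hb: "norm (h b) < 1" and nb: "norm (- b) < 1"
    using im b by (auto simp: image_subset_iff)
  have M: "Moebius_function 0 (- b) ` unit_disc \<subseteq> unit_disc"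
    using Moebius_function_norm_lt_1[OF nb] by auto
  have "h \<circ> Moebius_function 0 (- b) holomorphic_on unit_disc"
    using Moebius_function_holomorphic[OF nb] hol M by (rule holomorphic_on_compose_gen)
  then have "k holomorphic_on unit_disc"
    unfolding k_def
    by (rule holomorphic_on_compose_gen[OF _ Moebius_function_holomorphic[OF hb]]) (use M im in auto)
  moreover have "k 0 = 0"
    by (simp add: k_def Moebius_function_of_zero Moebius_function_eq_zero)
  moreover have "norm (k z) < 1" if "norm z < 1" for z
  proof -
    have "h (Moebius_function 0 (- b) z) \<in> unit_disc"
      using M im that by (metis image_subset_iff mem_ball_0)
    then show ?thesis
      using hb by (auto simp: k_def intro: Moebius_function_norm_lt_1)
  qed
  moreover have "norm (Moebius_function 0 b a) < 1"
    using a b by (simp add: Moebius_function_norm_lt_1)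
  ultimately have "norm (k (Moebius_function 0 b a)) \<le> norm (Moebius_function 0 b a)"
    by (rule Schwarz_Lemma(1))
  moreover have "Moebius_function 0 (- b) (Moebius_function 0 b a) = a"
    using a b by (intro Moebius_function_compose) auto
  ultimately show ?thesis
    by (simp add: k_def)
qed

text \<open>Once the zero \<open>a\<close> is moved to 0, the Schwarz lemma for the map and for its
  inverse gives equality at the point 1/2, hence a rotation. This is the tool by which any two
  Riemann maps of the same domain are compared.\<close>

lemma conformal_onto_unit_disc_eq_Moebius:
  assumes "conformal_onto \<kappa> unit_disc unit_disc"
  obtains \<alpha> a where "norm \<alpha> = 1" "norm a < 1"
    "\<And>p. p \<in> unit_disc \<Longrightarrow> \<kappa> p = \<alpha> * Moebius_function 0 a p"
proof -
  have \<kappa>: "\<kappa> holomorphic_on unit_disc" "bij_betw \<kappa> unit_disc unit_disc"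
    using assms by (auto simp: conformal_onto_def)
  then have im: "\<kappa> ` unit_disc = unit_disc"
    by (simp add: bij_betw_def)
  then obtain a where a: "a \<in> unit_disc" "\<kappa> a = 0"
    by (metis centre_in_ball imageE zero_less_one)
  define F where "F = \<kappa> \<circ> Moebius_function 0 (- a)"
  have F: "conformal_onto F unit_disc unit_disc"
    unfolding F_def using a by (intro conformal_onto_comp[OF Moebius_function_conformal_onto assms]) auto
  define G where "G = inv_into unit_disc F"
  have G: "conformal_onto G unit_disc unit_disc"
    unfolding G_def using F by (intro conformal_onto_inv_into) auto
  have GF: "G (F z) = z" if "z \<in> unit_disc" for z
    using F that by (auto simp: G_def conformal_onto_def bij_betw_def inv_into_f_f)
  have F0: "F 0 = 0"
    using a by (simp add: F_def Moebius_function_of_zero)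
  then have G0: "G 0 = 0"
    using GF[of 0] by simp
  have Fn: "norm (F z) < 1" if "norm z < 1" for z
    using F that by (auto simp: conformal_onto_def bij_betw_def)
  have Gn: "norm (G z) < 1" if "norm z < 1" for z
    using G that by (auto simp: conformal_onto_def bij_betw_def)
  have half: "norm (1/2 :: complex) < 1" by simp
  have "norm (F (1/2)) \<le> norm (1/2 :: complex)"
    using F by (intro Schwarz_Lemma(1) F0 Fn) (auto simp: conformal_onto_def)
  moreover have "norm (G (F (1/2))) \<le> norm (F (1/2))"
    using G by (intro Schwarz_Lemma(1) G0 Gn Fn) (auto simp: conformal_onto_def)
  ultimately have "norm (F (1/2)) = norm (1/2 :: complex)"
    using GF[of "1/2"] by simp
  then have "\<exists>\<alpha>. (\<forall>z. norm z < 1 \<longrightarrow> F z = \<alpha> * z) \<and> norm \<alpha> = 1"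
    using F by (intro Schwarz_Lemma(3)[of F, OF _ F0 _ half] Fn)
      (auto simp: conformal_onto_def intro!: exI[of _ "1/2"])
  then obtain \<alpha> where \<alpha>: "norm \<alpha> = 1" "\<And>z. norm z < 1 \<Longrightarrow> F z = \<alpha> * z"
    by blast
  show thesis
  proof (rule that[OF \<alpha>(1)])
    show "norm a < 1" using a by simp
    fix p :: complex assume p: "p \<in> unit_disc"
    have "Moebius_function 0 (- a) (Moebius_function 0 a p) = p"
      using a p by (intro Moebius_function_compose) auto
    then have "\<kappa> p = F (Moebius_function 0 a p)"
      by (simp add: F_def)
    also have "\<dots> = \<alpha> * Moebius_function 0 a p"
      using a p by (intro \<alpha>(2) Moebius_function_norm_lt_1) auto
    finally show "\<kappa> p = \<alpha> * Moebius_function 0 a p" .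
  qed
qed

section \<open>Hyperbolic distance, convergence to the circle, and a Harnack inequality\<close>

lemma disc_hyperbolic_dist_Moebius:
  "disc_hyperbolic_dist p q = 2 * artanh (norm (Moebius_function 0 q p))"
  by (simp add: disc_hyperbolic_dist_def Moebius_function_simple)

text \<open>The definite description in \<open>hyperbolic_dist\<close> is resolved here: two Riemann
  maps differ by a self-map of the disc, and Schwarz-Pick in both directions gives the same
  distance.\<close>

lemma hyperbolic_dist_conformal:
  assumes \<phi>: "conformal_onto \<phi> unit_disc U" and p: "p \<in> unit_disc" and q: "q \<in> unit_disc"
  shows "hyperbolic_dist U (\<phi> p) (\<phi> q) = disc_hyperbolic_dist p q"
  unfolding hyperbolic_dist_def
proof (rule the_equality)
  show "\<exists>\<phi>' p' q'. conformal_onto \<phi>' unit_disc U \<and> p' \<in> unit_disc \<and> q' \<in> unit_disc \<and>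
      \<phi>' p' = \<phi> p \<and> \<phi>' q' = \<phi> q \<and> disc_hyperbolic_dist p q = disc_hyperbolic_dist p' q'"
    using assms by blast
next
  have le: "norm (Moebius_function 0 q p) \<le> norm (Moebius_function 0 q' p')"
    if \<phi>: "conformal_onto \<phi> unit_disc U" "p \<in> unit_disc" "q \<in> unit_disc"
    and \<phi>': "conformal_onto \<phi>' unit_disc U" "p' \<in> unit_disc" "q' \<in> unit_disc" 
    and eq: "\<phi>' p' = \<phi> p" "\<phi>' q' = \<phi> q" for p q p' q' \<phi> \<phi>'
  proof -
    define h where "h = inv_into unit_disc \<phi> \<circ> \<phi>'"
    have "conformal_onto h unit_disc unit_disc"
      unfolding h_def using \<phi> \<phi>' by (intro conformal_onto_comp conformal_onto_inv_into) auto
    then have h: "h holomorphic_on unit_disc" "h ` unit_disc \<subseteq> unit_disc"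
      by (auto simp: conformal_onto_def bij_betw_def)
    have inj: "inj_on \<phi> unit_disc"
      using \<phi> by (simp add: conformal_onto_def bij_betw_def)
    have "h p' = p" "h q' = q"
      using eq inj \<phi> by (auto simp: h_def inv_into_f_f)
    with Schwarz_Pick[OF h, of p' q'] \<phi>' show ?thesis by simp
  qed
  fix e
  assume "\<exists>\<phi>' p' q'. conformal_onto \<phi>' unit_disc U \<and> p' \<in> unit_disc \<and> q' \<in> unit_disc \<and>
      \<phi>' p' = \<phi> p \<and> \<phi>' q' = \<phi> q \<and> e = disc_hyperbolic_dist p' q'"
  then obtain \<phi>' p' q' where *: "conformal_onto \<phi>' unit_disc U" "p' \<in> unit_disc" "q' \<in> unit_disc" 
      "\<phi>' p' = \<phi> p" "\<phi>' q' = \<phi> q" "e = disc_hyperbolic_dist p' q'"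
    by blast
  have "norm (Moebius_function 0 q p) = norm (Moebius_function 0 q' p')"
    using le[OF \<phi> p q *(1-5)] le[OF *(1-3) \<phi> p q] * by simp
  then show "e = disc_hyperbolic_dist p q"
    by (simp add: * disc_hyperbolic_dist_Moebius)
qed

lemma tendsto_disc_automorphism:
  assumes "norm a < 1" and "norm \<zeta> = 1" and "(X \<longlongrightarrow> \<zeta>) F"
  shows "((\<lambda>k. Moebius_function 0 a (X k)) \<longlongrightarrow> Moebius_function 0 a \<zeta>) F"
proof -
  have "1 - cnj a * \<zeta> \<noteq> 0"
    using assms by (metis complex_mod_cnj mult.right_neutral norm_mult norm_one order_less_irrefl right_minus_eq)
  then show ?thesis
    unfolding Moebius_function_simple by (intro tendsto_intros assms(3))
qed

lemma norm_Moebius_function_unit: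
  assumes "norm a < 1" and "norm \<zeta> = 1"
  shows "norm (Moebius_function 0 a \<zeta>) = 1"
proof -
  have "\<zeta> * cnj \<zeta> = 1"
    using assms(2) by (simp add: complex_norm_square[symmetric])
  then have "1 - cnj a * \<zeta> = \<zeta> * cnj (\<zeta> - a)"
    by (simp add: algebra_simps)
  then have "norm (1 - cnj a * \<zeta>) = norm (\<zeta> - a)"
    using assms(2) by (metis complex_mod_cnj mult_1 norm_mult)
  moreover have "\<zeta> \<noteq> a" using assms by auto
  ultimately show ?thesis
    by (simp add: Moebius_function_simple norm_divide)
qed

text \<open>A pseudohyperbolic disc of fixed radius \<open>s\<close> around \<open>Y k\<close> has
  Euclidean size at most a constant times the square root of \<open>1 - |Y k|^2\<close>, so it
  shrinks as its centre approaches the circle.\<close>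

lemma tendsto_unit_circle_bounded_hyperbolic:
  assumes X: "\<And>k::nat. X k \<in> unit_disc" and Y: "\<And>k. Y k \<in> unit_disc"
    and s: "s < 1" "\<And>k. norm (Moebius_function 0 (Y k) (X k)) \<le> s"
    and lim: "Y \<longlonglongrightarrow> \<zeta>" "norm \<zeta> = 1"
  shows "X \<longlonglongrightarrow> \<zeta>"
proof -
  have s0: "0 \<le> s"
    using s(2)[of 0] by (meson norm_ge_zero order_trans)
  have key: "norm (X k - Y k) ^ 2 * (1 - s\<^sup>2) \<le> (1 - norm (Y k) ^ 2)" for k
  proof -
    let ?x = "X k" and ?y = "Y k"
    have x: "norm ?x < 1" and y: "norm ?y < 1" using X Y by auto
    let ?D = "norm (1 - cnj ?y * ?x)"
    have D0: "1 - cnj ?y * ?x \<noteq> 0"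
      using x y by (metis complex_mod_cnj norm_mult_less mult_1 norm_one less_irrefl right_minus_eq)
    have id: "?D\<^sup>2 - (norm (?x - ?y))\<^sup>2 = (1 - norm ?x ^ 2) * (1 - norm ?y ^ 2)"
      by (cases ?x; cases ?y) (simp add: cmod_power2, simp add: algebra_simps power2_eq_square)
    have le: "norm (?x - ?y) \<le> s * ?D"
      using s(2)[of k] D0 by (simp add: Moebius_function_simple norm_divide divide_simps)
    then have le2: "(norm (?x - ?y))\<^sup>2 \<le> s\<^sup>2 * ?D\<^sup>2"
      by (metis norm_ge_zero power_mono power_mult_distrib)
    have "?D\<^sup>2 * (1 - s\<^sup>2) \<le> (1 - norm ?x ^ 2) * (1 - norm ?y ^ 2)"
      using id le2 by (simp add: algebra_simps)
    also have "\<dots> \<le> 1 * (1 - norm ?y ^ 2)"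
      using y by (intro mult_right_mono) (auto simp: power_le_one)
    finally have 1: "?D\<^sup>2 * (1 - s\<^sup>2) \<le> 1 - norm ?y ^ 2" by simp
    have "s\<^sup>2 \<le> 1" using s0 s(1) by (simp add: power_le_one)
    then have "s\<^sup>2 * ?D\<^sup>2 \<le> ?D\<^sup>2"
      by (intro mult_left_le_one_le) auto
    then have "(norm (?x - ?y))\<^sup>2 * (1 - s\<^sup>2) \<le> (?D\<^sup>2) * (1 - s\<^sup>2)"
      using le2 \<open>s\<^sup>2 \<le> 1\<close> by (intro mult_right_mono) linarith+
    from order_trans[OF this 1] show ?thesis .
  qed
  have s2: "1 - s\<^sup>2 > 0"
    using power_strict_mono[of s 1 2] s0 s(1) by simp
  have "(\<lambda>k. norm (X k - Y k) ^ 2) \<longlonglongrightarrow> 0"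
  proof (rule tendsto_sandwich[OF _ _ tendsto_const])
    have "(\<lambda>k. (1 - norm (Y k) ^ 2) / (1 - s\<^sup>2)) \<longlonglongrightarrow> (1 - norm \<zeta> ^ 2) / (1 - s\<^sup>2)"
      by (rule tendsto_divide[OF tendsto_diff[OF tendsto_const tendsto_power[OF tendsto_norm[OF lim(1)]]] tendsto_const]) (use s2 in linarith)
    then show "(\<lambda>k. (1 - norm (Y k) ^ 2) / (1 - s\<^sup>2)) \<longlonglongrightarrow> 0"
      by (simp add: lim(2))
    show "\<forall>\<^sub>F k in sequentially. norm (X k - Y k) ^ 2 \<le> (1 - norm (Y k) ^ 2) / (1 - s\<^sup>2)"
      by (intro always_eventually allI) (simp only: pos_le_divide_eq[OF s2] key)
  qed auto
  then have "(\<lambda>k. X k - Y k) \<longlonglongrightarrow> 0"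
    by (simp add: power_tendsto_0_iff tendsto_norm_zero_iff)
  from tendsto_add[OF this lim(1)] show ?thesis by simp
qed

text \<open>\<open>ln |g|\<close> is the real part of a holomorphic logarithm \<open>L\<close> with
  values in the right half-plane. The map \<open>k\<close> is the Cayley transform of
  \<open>L\<close> that sends the centre to 0, so the Schwarz lemma bounds it by 1/2 on the half
  disc. This costs a factor 3 between the centre and any other point, and 9 between two
  points.\<close>

lemma ln_norm_Harnack:
  assumes \<rho>: "\<rho> > 0" and hol: "g holomorphic_on ball b \<rho>"
    and gt: "\<And>z. z \<in> ball b \<rho> \<Longrightarrow> norm (g z) > 1"
    and z: "z \<in> ball b (\<rho>/2)" and w: "w \<in> ball b (\<rho>/2)"
  shows "ln (norm (g z)) \<le> 9 * ln (norm (g w))"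
proof -
  have "\<exists>L. L holomorphic_on ball b \<rho> \<and> (\<forall>z\<in>ball b \<rho>. g z = exp (L z))"
  proof -
    have "simply_connected (ball b \<rho>)" by (simp add: convex_imp_simply_connected)
    moreover have "\<forall>z\<in>ball b \<rho>. g z \<noteq> 0" using gt by fastforce
    ultimately show ?thesis
      using hol simply_connected_eq_holomorphic_log[of "ball b \<rho>"] by auto
  qed
  then obtain L where L: "L holomorphic_on ball b \<rho>" "\<And>z. z \<in> ball b \<rho> \<Longrightarrow> g z = exp (L z)"
    by blast
  have lnL: "ln (norm (g z)) = Re (L z)" if "z \<in> ball b \<rho>" for z
    using L(2)[OF that] by simp
  have pos: "Re (L z) > 0" if "z \<in> ball b \<rho>" for z
    using gt[OF that] lnL[OF that] by (metis ln_gt_zero)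
  have bb: "b \<in> ball b \<rho>" using \<rho> by simp
  define m where "m \<xi> = b + of_real \<rho> * \<xi>" for \<xi>
  have m: "m \<xi> \<in> ball b \<rho>" if "norm \<xi> < 1" for \<xi>
    using that \<rho> by (auto simp: m_def dist_norm norm_mult)
  define k where "k \<xi> = (L (m \<xi>) - L b) / (L (m \<xi>) + cnj (L b))" for \<xi>
  have den: "L z + cnj (L b) \<noteq> 0" if "z \<in> ball b \<rho>" for z
  proof -
    have "Re (L z + cnj (L b)) > 0" using pos[OF that] pos[OF bb] by simp
    then show ?thesis by (metis order_less_irrefl zero_complex.sel(1))
  qed
  have "(L \<circ> m) holomorphic_on ball 0 1"
    by (rule holomorphic_on_compose_gen[OF _ L(1)]) (use m in \<open>auto simp: m_def[abs_def] intro!: holomorphic_intros\<close>)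
  then have Lm: "(\<lambda>\<xi>. L (m \<xi>)) holomorphic_on ball 0 1" by (simp add: o_def)
  have khol: "k holomorphic_on ball 0 1"
    unfolding k_def[abs_def] by (intro holomorphic_intros Lm) (use den m in auto)
  have k0: "k 0 = 0" by (simp add: k_def m_def)
  have kn: "norm (k \<xi>) < 1" if "norm \<xi> < 1" for \<xi>
  proof -
    have "norm (L (m \<xi>) - L b) ^ 2 < norm (L (m \<xi>) + cnj (L b)) ^ 2"
    proof -
      have "norm (L (m \<xi>) + cnj (L b)) ^ 2 - norm (L (m \<xi>) - L b) ^ 2 = 4 * Re (L (m \<xi>)) * Re (L b)"
        by (simp only: cmod_power2) (simp add: algebra_simps power2_eq_square)
      moreover have "\<dots> > 0" using pos[OF bb] pos[OF m[OF that]] by simp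
      ultimately show ?thesis by linarith
    qed
    then have "norm (L (m \<xi>) - L b) < norm (L (m \<xi>) + cnj (L b))"
      by (metis norm_ge_zero power_less_imp_less_base)
    then show ?thesis
      using den[OF m[OF that]] by (simp add: k_def norm_divide divide_simps)
  qed
  have main: "Re (L z) \<le> 3 * Re (L b) \<and> Re (L b) \<le> 3 * Re (L z)" if z: "z \<in> ball b (\<rho>/2)" for z
  proof -
    define \<xi> where "\<xi> = (z - b) / of_real \<rho>"
    have m\<xi>: "m \<xi> = z" using \<rho> by (simp add: m_def \<xi>_def)
    have n\<xi>: "norm \<xi> \<le> 1/2"
      using z \<rho> by (auto simp: \<xi>_def norm_divide dist_norm norm_minus_commute divide_simps)
    then have "norm (k \<xi>) \<le> norm \<xi>"
      by (intro Schwarz_Lemma(1)[OF khol k0 kn]) auto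
    then have "norm (k \<xi>) \<le> 1/2" using n\<xi> by linarith
    moreover have zb: "z \<in> ball b \<rho>" using z \<rho> by auto
    ultimately have "2 * norm (L z - L b) \<le> norm (L z + cnj (L b))"
      using den[OF zb] by (simp add: k_def m\<xi> norm_divide divide_simps)
    then have "(2 * norm (L z - L b))\<^sup>2 \<le> (norm (L z + cnj (L b)))\<^sup>2"
      by (intro power_mono) auto
    then have "4 * ((Re (L z) - Re (L b))\<^sup>2 + (Im (L z) - Im (L b))\<^sup>2)
        \<le> (Re (L z) + Re (L b))\<^sup>2 + (Im (L z) - Im (L b))\<^sup>2"
      by (simp add: power_mult_distrib cmod_power2)
    moreover have "4 * r + 4 * i \<le> t + i \<Longrightarrow> 0 \<le> i \<Longrightarrow> 4 * r \<le> t" for r i t :: real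
      by linarith
    ultimately have "4 * (Re (L z) - Re (L b))\<^sup>2 \<le> (Re (L z) + Re (L b))\<^sup>2"
      by (metis distrib_left zero_le_power2)
    moreover have "(2 * (Re (L z) - Re (L b)))\<^sup>2 = 4 * (Re (L z) - Re (L b))\<^sup>2"
      by (simp only: power_mult_distrib) simp
    ultimately have "(2 * (Re (L z) - Re (L b)))\<^sup>2 \<le> (Re (L z) + Re (L b))\<^sup>2"
      by metis
    then have "\<bar>2 * (Re (L z) - Re (L b))\<bar> \<le> \<bar>Re (L z) + Re (L b)\<bar>"
      by (simp add: abs_le_square_iff)
    then show ?thesis using pos[OF zb] pos[OF bb] by (auto simp: abs_if split: if_splits)
  qed
  have "z \<in> ball b \<rho>" "w \<in> ball b \<rho>" using z w \<rho> by auto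
  with main[OF z] main[OF w] show ?thesis by (simp add: lnL)
qed

section \<open>Riemann maps of branched covers and of increasing unions\<close>

lemma Riemann_map_centered:
  assumes "open V" "simply_connected V" "V \<noteq> UNIV" "a \<in> V"
  obtains A where "conformal_onto A V unit_disc" "A a = 0"
proof -
  obtain f g where fg: "f holomorphic_on V" "g holomorphic_on ball 0 1"
      "\<And>z. z \<in> V \<Longrightarrow> f z \<in> ball 0 1 \<and> g (f z) = z" "\<And>z. z \<in> ball 0 1 \<Longrightarrow> g z \<in> V \<and> f (g z) = z"
    using assms Riemann_mapping_theorem[of V] by (metis empty_iff)
  have "bij_betw f V unit_disc"
    by (rule bij_betw_byWitness[where f' = g]) (use fg in auto)
  then have f: "conformal_onto f V unit_disc" using fg(1) by (simp add: conformal_onto_def)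
  have "f a \<in> unit_disc" using fg(3) assms(4) by blast
  then have "conformal_onto (Moebius_function 0 (f a) \<circ> f) V unit_disc"
    by (intro conformal_onto_comp[OF f] Moebius_function_conformal_onto) auto
  then show thesis
    by (rule that) (simp add: Moebius_function_eq_zero)
qed

text \<open>The zero of \<open>A\<close> at \<open>a\<close> is simple, so the quotient by
  \<open>v - a\<close> has no zeros and, on a simply connected domain, has a \<open>d\<close>-th
  root. After the substitution \<open>v = a + \<zeta> ^ d\<close> the whole of \<open>A\<close>
  becomes a \<open>d\<close>-th power.\<close>

lemma conformal_onto_zero_factor:
  assumes V: "open V" "simply_connected V" and A: "conformal_onto A V unit_disc"
    and a: "a \<in> V" "A a = 0" and d: "d > 0"
  obtains \<sigma> where "\<sigma> holomorphic_on V"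
    "\<And>v. v \<in> V \<Longrightarrow> \<sigma> v \<noteq> 0" "\<And>v. v \<in> V \<Longrightarrow> A v = (v - a) * \<sigma> v ^ d"
proof -
  define R where "R v = (if v = a then deriv A a else (A v - A a) / (v - a))" for v
  have hol: "A holomorphic_on V" and inj: "inj_on A V"
    using A by (auto simp: conformal_onto_def bij_betw_def)
  have R: "R holomorphic_on V"
    unfolding R_def[abs_def] by (rule pole_lemma_open[OF hol V(1)])
  have "deriv A a \<noteq> 0"
    using holomorphic_injective_imp_regular[OF hol V(1) inj a(1)] .
  moreover have "A v \<noteq> A a" if "v \<in> V" "v \<noteq> a" for v
    using inj a that by (auto simp: inj_on_def)
  ultimately have "\<forall>v\<in>V. R v \<noteq> 0"
    by (auto simp: R_def)
  then obtain \<rho> where \<rho>: "\<rho> holomorphic_on V" "\<And>v. v \<in> V \<Longrightarrow> R v = exp (\<rho> v)"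
    using R V simply_connected_eq_holomorphic_log[OF V(1)] by metis
  show thesis
  proof (rule that[of "\<lambda>v. exp (\<rho> v / of_nat d)"])
    show "(\<lambda>v. exp (\<rho> v / of_nat d)) holomorphic_on V"
      using d by (intro holomorphic_intros \<rho>) auto
    fix v assume v: "v \<in> V"
    have "exp (\<rho> v / of_nat d) ^ d = R v"
      using d \<rho>(2)[OF v] by (simp add: exp_of_nat_mult[symmetric])
    then show "A v = (v - a) * exp (\<rho> v / of_nat d) ^ d"
      using a by (auto simp: R_def)
  qed auto
qed

text \<open>The \<open>d\<close>-th root of a Riemann map is a Riemann map of the \<open>d\<close>-fold branched cover.\<close>

lemma conformal_onto_power_preimage:
  assumes A: "conformal_onto A V unit_disc" and V: "open V" and d: "d > 0"
    and \<sigma>: "\<sigma> holomorphic_on V" "\<And>v. v \<in> V \<Longrightarrow> \<sigma> v \<noteq> 0"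
      "\<And>v. v \<in> V \<Longrightarrow> A v = (v - a) * \<sigma> v ^ d"
  shows "conformal_onto (\<lambda>\<zeta>. \<zeta> * \<sigma> (a + \<zeta> ^ d)) {\<zeta>. a + \<zeta> ^ d \<in> V} unit_disc"
  unfolding conformal_onto_def
proof
  define B where "B = inv_into V A"
  have AB: "A (B p) = p" "B p \<in> V" if "p \<in> unit_disc" for p
    using A that by (auto simp: B_def conformal_onto_def bij_betw_def f_inv_into_f inv_into_into)
  have BA: "B (A v) = v" "A v \<in> unit_disc" if "v \<in> V" for v
    using A that by (auto simp: B_def conformal_onto_def bij_betw_def)
  have pow: "(\<zeta> * \<sigma> (a + \<zeta> ^ d)) ^ d = A (a + \<zeta> ^ d)" if "a + \<zeta> ^ d \<in> V" for \<zeta>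
    using \<sigma>(3)[OF that] by (simp add: power_mult_distrib)
  have pd: "p ^ d \<in> unit_disc" if "p \<in> unit_disc" for p :: complex
    using that d by (simp add: norm_power power_less_one_iff)
  have inD: "\<zeta> * \<sigma> (a + \<zeta> ^ d) \<in> unit_disc" if "a + \<zeta> ^ d \<in> V" for \<zeta>
  proof -
    have "norm (\<zeta> * \<sigma> (a + \<zeta> ^ d)) ^ d < 1"
      using pow[OF that] BA(2)[OF that] by (metis mem_ball_0 norm_power)
    then show ?thesis
      using d by (simp add: power_less_one_iff)
  qed
  have "(\<sigma> \<circ> (\<lambda>\<zeta>. a + \<zeta> ^ d)) holomorphic_on {\<zeta>. a + \<zeta> ^ d \<in> V}"
    by (rule holomorphic_on_compose_gen[OF _ \<sigma>(1)]) (auto intro!: holomorphic_intros)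
  then show "(\<lambda>\<zeta>. \<zeta> * \<sigma> (a + \<zeta> ^ d)) holomorphic_on {\<zeta>. a + \<zeta> ^ d \<in> V}"
    by (auto simp: o_def intro!: holomorphic_intros)
  show "bij_betw (\<lambda>\<zeta>. \<zeta> * \<sigma> (a + \<zeta> ^ d)) {\<zeta>. a + \<zeta> ^ d \<in> V} unit_disc"
  \<comment> \<open>The base point is recovered from \<open>p\<close> as \<open>B (p ^ d)\<close>;
    dividing by the value of \<open>\<sigma>\<close> there returns the root coordinate.\<close>
  proof (rule bij_betw_byWitness[where f' = "\<lambda>p. p / \<sigma> (B (p ^ d))"])
    show "\<forall>\<zeta>\<in>{\<zeta>. a + \<zeta> ^ d \<in> V}. \<zeta> * \<sigma> (a + \<zeta> ^ d) / \<sigma> (B ((\<zeta> * \<sigma> (a + \<zeta> ^ d)) ^ d)) = \<zeta>"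
      using pow BA \<sigma>(2) by auto
    have "a + (p / \<sigma> (B (p ^ d))) ^ d = B (p ^ d)" if "p \<in> unit_disc" for p
      using \<sigma>(2,3)[OF AB(2)[OF pd[OF that]]] AB(1)[OF pd[OF that]]
      by (simp add: power_divide field_simps)
    then show "\<forall>p\<in>unit_disc. p / \<sigma> (B (p ^ d)) * \<sigma> (a + (p / \<sigma> (B (p ^ d))) ^ d) = p"
      and "(\<lambda>p. p / \<sigma> (B (p ^ d))) ` unit_disc \<subseteq> {\<zeta>. a + \<zeta> ^ d \<in> V}"
      using AB(2) pd \<sigma>(2) by auto
    show "(\<lambda>\<zeta>. \<zeta> * \<sigma> (a + \<zeta> ^ d)) ` {\<zeta>. a + \<zeta> ^ d \<in> V} \<subseteq> unit_disc"
      using inD by blast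
  qed
qed

lemma conformal_onto_simply_connected:
  assumes "conformal_onto \<phi> S U" "open S" "simply_connected S"
  shows "simply_connected U"
proof -
  have inv: "conformal_onto (inv_into S \<phi>) U S"
    using assms by (intro conformal_onto_inv_into) auto
  have "homeomorphism S U \<phi> (inv_into S \<phi>)"
    using assms(1) inv
    by (auto simp: homeomorphism_def conformal_onto_def bij_betw_def f_inv_into_f
        intro: holomorphic_on_imp_continuous_on)
  then have "S homeomorphic U"
    by (auto simp: homeomorphic_def)
  then show ?thesis
    using assms(3) homeomorphic_simply_connected by blast
qed

text \<open>Two loops have compact images, so they lie in a single member of the sequence and are
  homotopic there.\<close>

lemma simply_connected_incseq_UN:
  fixes U :: "nat \<Rightarrow> complex set"
  assumes op: "\<And>k. open (U k)" and sc: "\<And>k. simply_connected (U k)" and inc: "incseq U"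
  shows "simply_connected (\<Union>k. U k)"
  unfolding simply_connected_def
proof (intro allI impI)
  have cpt: "\<exists>k. K \<subseteq> U k" if K: "compact K" "K \<subseteq> (\<Union>k. U k)" for K
  proof -
    obtain F where F: "finite F" "K \<subseteq> (\<Union>k\<in>F. U k)"
      using compactE_image[OF K(1) op K(2)] by metis
    obtain m where "\<And>k. k \<in> F \<Longrightarrow> k \<le> m"
      using F(1) by (meson finite_nat_set_iff_bounded_le)
    then have "(\<Union>k\<in>F. U k) \<subseteq> U m"
      using inc by (auto simp: incseq_def)
    with F show ?thesis by blast
  qed
  fix p q :: "real \<Rightarrow> complex"
  assume *: "path p \<and> pathfinish p = pathstart p \<and> path_image p \<subseteq> (\<Union>k. U k) \<and>
      path q \<and> pathfinish q = pathstart q \<and> path_image q \<subseteq> (\<Union>k. U k)"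
  then obtain k where "path_image p \<union> path_image q \<subseteq> U k"
    using cpt[of "path_image p \<union> path_image q"] by (auto simp: compact_path_image compact_Un)
  then have "homotopic_loops (U k) p q"
    using sc[of k] * by (simp add: simply_connected_def)
  then show "homotopic_loops (\<Union>k. U k) p q"
    by (rule homotopic_loops_subset) blast
qed

text \<open>Applied to quotients: two continuous \<open>d\<close>-th roots of one function on a
  connected set differ by a constant root of unity, which a single value determines.\<close>

lemma power_eq_1_constant:
  fixes g :: "complex \<Rightarrow> complex"
  assumes "connected X" "continuous_on X g" "d > 0" "\<And>x. x \<in> X \<Longrightarrow> g x ^ d = 1"
  obtains \<omega> where "\<And>x. x \<in> X \<Longrightarrow> g x = \<omega>"
proof -
  have "finite {z::complex. z ^ d = 1}"
    using assms(3) by (intro finite_roots_unity) auto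
  then have "finite (g ` X)"
    by (rule finite_subset[rotated]) (use assms(4) in auto)
  then have "g constant_on X"
    using continuous_finite_range_constant assms by blast
  then show thesis
    using that by (auto simp: constant_on_def)
qed

section \<open>The map in the strip\<close>

lemma integral_pos_continuous:
  fixes g :: "real \<Rightarrow> real"
  assumes "continuous_on {0..1} g" and "\<And>s. s \<in> {0..1} \<Longrightarrow> 0 \<le> g s" and "g 1 > 0"
  shows "integral {0..1} g > 0"
proof -
  have I: "(g has_integral integral {0..1} g) (cbox 0 1)"
    using assms(1) by (simp add: integrable_continuous_interval integrable_integral)
  have "integral {0..1} g \<noteq> 0"
  proof
    assume "integral {0..1} g = 0"
    then have "g 1 = 0"
      using has_integral_0_cbox_imp_0[of 0 1 g 1] I assms by auto
    with assms(3) show False by simp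
  qed
  moreover have "integral {0..1} g \<ge> 0"
    using assms by (intro integral_nonneg integrable_continuous_interval) auto
  ultimately show ?thesis by simp
qed

definition strip :: "complex set" where
  "strip = {z. \<bar>Im z\<bar> < pi}"

lemma open_strip: "open strip"
  unfolding strip_def by (intro open_Collect_less continuous_intros)

lemma convex_strip: "convex strip"
proof -
  have eq: "strip = {z. Im z < pi} \<inter> {z. Im z > - pi}"
    by (auto simp: strip_def)
  show ?thesis
    unfolding eq by (intro convex_Int convex_halfspace_Im_lt convex_halfspace_Im_gt)
qed

lemma of_real_in_strip [simp]: "of_real x \<in> strip"
  by (simp add: strip_def)

lemma closure_strip: "z \<in> closure strip \<Longrightarrow> \<bar>Im z\<bar> \<le> pi"
proof -
  have "closed {z. \<bar>Im z\<bar> \<le> pi}" by (intro closed_Collect_le continuous_intros)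
  then have "closure strip \<subseteq> {z. \<bar>Im z\<bar> \<le> pi}" by (intro closure_minimal) (auto simp: strip_def)
  then show "z \<in> closure strip \<Longrightarrow> \<bar>Im z\<bar> \<le> pi" by auto
qed

text \<open>The sum is \<open>- P (exp (- z))\<close> in explicit form: the equation for
  \<open>P\<close> amounts to \<open>P' w = - (\<Sum>k<n. (1 - w) ^ k)\<close>, integrated from
  0.\<close>

locale strip_map =
  fixes n :: nat and f :: "complex \<Rightarrow> complex"
  assumes n_pos: "n \<ge> 1"
    and f_eq: "\<And>z. f z = z + (\<Sum>k=1..n. (1 - (1 - exp (- z)) ^ k) / of_nat k)"
begin

section \<open>Derivative, real axis and boundary lines\<close>

definition crit_val :: real where
  "crit_val = (\<Sum>k=1..n. 1 / real k)"

definition u :: "complex \<Rightarrow> complex" where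
  "u z = 1 - exp (- z)"

lemma crit_val_pos: "crit_val > 0"
  unfolding crit_val_def using n_pos by (intro sum_pos) auto

lemma f_eq_crit_val: "f z = z + of_real crit_val - (\<Sum>k=1..n. u z ^ k / of_nat k)"
  by (simp add: f_eq u_def crit_val_def diff_divide_distrib sum_subtractf)

lemma u_has_field_derivative [derivative_intros]:
  assumes "(g has_field_derivative g') (at z within X)"
  shows "((\<lambda>z. u (g z)) has_field_derivative exp (- g z) * g') (at z within X)"
  unfolding u_def by (auto intro!: derivative_eq_intros assms)

lemma u_holomorphic [holomorphic_intros]: "g holomorphic_on X \<Longrightarrow> (\<lambda>z. u (g z)) holomorphic_on X"
  unfolding u_def by (intro holomorphic_intros)

lemma u_continuous [continuous_intros]: "continuous_on X g \<Longrightarrow> continuous_on X (\<lambda>z. u (g z))"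
  unfolding u_def by (intro continuous_intros)

lemma f_has_field_derivative: "(f has_field_derivative u z ^ n) (at z within X)"
proof -
  have "((\<lambda>z. z + of_real crit_val - (\<Sum>k=1..n. u z ^ k / of_nat k)) has_field_derivative
      1 + 0 - (\<Sum>k=1..n. of_nat k * (exp (- z) * 1 * u z ^ (k - 1)) / of_nat k)) (at z within X)"
    by (intro derivative_intros)
      (auto intro!: derivative_eq_intros simp: mult.commute)
  moreover have "(\<Sum>k=1..n. of_nat k * (exp (- z) * 1 * u z ^ (k - 1)) / of_nat k)
      = (\<Sum>k=1..n. exp (- z) * u z ^ (k - 1))"
    by (intro sum.cong) auto
  moreover have "\<dots> = (1 - u z) * (\<Sum>k<n. u z ^ k)"
  proof -
    have "(\<Sum>k=1..n. exp (- z) * u z ^ (k - 1)) = (\<Sum>k<n. exp (- z) * u z ^ k)"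
      by (rule sum.reindex_bij_witness[of _ Suc "\<lambda>k. k - 1"]) auto
    then show ?thesis by (simp add: sum_distrib_left u_def)
  qed
  moreover have "\<dots> = 1 - u z ^ n"
    by (simp add: one_diff_power_eq)
  moreover have "f = (\<lambda>z. z + of_real crit_val - (\<Sum>k=1..n. u z ^ k / of_nat k))"
    by (auto simp: f_eq_crit_val)
  ultimately show ?thesis by simp
qed

lemma deriv_f: "deriv f z = u z ^ n"
  using f_has_field_derivative by (rule DERIV_imp_deriv)

lemma f_holomorphic: "f holomorphic_on X"
  using f_has_field_derivative holomorphic_on_def field_differentiable_def by metis

lemma f_continuous: "continuous_on X f"
  by (intro holomorphic_on_imp_continuous_on f_holomorphic)

lemma f_continuous_gen [continuous_intros]: "continuous_on X g \<Longrightarrow> continuous_on X (\<lambda>z. f (g z))"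
  using continuous_on_compose[of X g f] f_continuous by (simp add: o_def)

lemma iter_holomorphic: "(f ^^ k) holomorphic_on X"
proof (induction k)
  case (Suc k)
  then show ?case
    using holomorphic_on_compose[OF Suc f_holomorphic] by (simp add: o_def)
qed (simp add: holomorphic_on_id[unfolded id_def] id_def)

lemma iter_continuous: "continuous_on X (f ^^ k)"
  by (intro holomorphic_on_imp_continuous_on iter_holomorphic)

lemma f_cnj: "f (cnj z) = cnj (f z)"
  by (simp add: f_eq exp_cnj flip: complex_cnj_minus)

lemma u_of_real: "u (of_real x) = of_real (1 - exp (- x))"
  by (simp add: u_def exp_of_real[symmetric] del: exp_of_real)

lemma f_of_real: "f (of_real x) = of_real (x + (\<Sum>k=1..n. (1 - (1 - exp (- x)) ^ k) / real k))"
  by (simp add: f_eq exp_of_real[symmetric] del: exp_of_real)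

lemma f_of_real_gt:
  assumes "x \<ge> 0"
  obtains y where "f (of_real x) = of_real y" "y > x"
proof
  show "f (of_real x) = of_real (x + (\<Sum>k=1..n. (1 - (1 - exp (- x)) ^ k) / real k))"
    by (rule f_of_real)
  have "(1 - exp (- x)) ^ k < 1" if "k \<ge> 1" for k
    using assms that by (simp add: power_less_one_iff)
  then have "(\<Sum>k=1..n. (1 - (1 - exp (- x)) ^ k) / real k) > 0"
    using n_pos by (intro sum_pos) (auto simp: field_simps)
  then show "x + (\<Sum>k=1..n. (1 - (1 - exp (- x)) ^ k) / real k) > x" by simp
qed

lemma exp_boundary_line:
  assumes "\<bar>Im z\<bar> = pi"
  shows "exp (- z) = - of_real (exp (- Re z))"
proof -
  have "Im z = pi \<or> Im z = - pi" using assms by linarith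
  then show ?thesis by (auto simp: complex_eq_iff Re_exp Im_exp)
qed

lemma iter_one_of_real: "\<exists>x>0. (f ^^ k) 1 = of_real x"
proof (induction k)
  case 0
  show ?case by (rule exI[of _ 1]) simp
next
  case (Suc k)
  then obtain x where x: "x > 0" "(f ^^ k) 1 = of_real x" by blast
  obtain y where "f (of_real x) = of_real y" "y > x" using f_of_real_gt[of x] x(1) by auto
  then show ?case using x by auto
qed

text \<open>On these lines \<open>exp (- z)\<close> is a negative real, so \<open>f\<close> adds a
  real number. Its summands are all nonpositive, and the one for \<open>k = 1\<close> equals
  \<open>- exp (- Re z)\<close>.\<close>

lemma f_boundary_line:
  assumes "\<bar>Im z\<bar> = pi"
  shows "Im (f z) = Im z" and "Re (f z) \<le> Re z - exp (- Re z)"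
proof -
  define s where "s = (\<Sum>k=1..n. (1 - (1 + exp (- Re z)) ^ k) / real k)"
  have f: "f z = z + of_real s"
    by (simp add: f_eq exp_boundary_line[OF assms] s_def)
  show "Im (f z) = Im z" by (simp add: f)
  have "s \<le> (1 - (1 + exp (- Re z)) ^ 1) / real 1 + (\<Sum>k\<in>{1..n}-{1}. 0)"
    unfolding s_def using n_pos
    by (subst sum.remove[of _ 1]) (auto intro!: add_left_mono sum_nonpos divide_nonpos_nonneg)
  then show "Re (f z) \<le> Re z - exp (- Re z)" by (simp add: f)
qed

section \<open>A root of \<open>f - crit_val\<close> on the whole strip\<close>

lemma exp_strip_not_nonpos:
  assumes "z \<in> strip"
  shows "exp (- z) \<notin> \<real>\<^sub>\<le>\<^sub>0" and "Ln (exp (- z)) = - z"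
proof -
  show L: "Ln (exp (- z)) = - z"
    using assms by (intro Ln_exp) (auto simp: strip_def)
  show "exp (- z) \<notin> \<real>\<^sub>\<le>\<^sub>0"
  proof
    assume "exp (- z) \<in> \<real>\<^sub>\<le>\<^sub>0"
    then obtain r where r: "r \<le> 0" "exp (- z) = of_real r" by (auto elim!: nonpos_Reals_cases)
    then have "r < 0" by (metis exp_not_eq_zero less_eq_real_def of_real_0)
    then have "Im (Ln (exp (- z))) = pi" using r(2) by (simp add: Im_Ln_eq_pi)
    then show False using assms by (simp add: L strip_def)
  qed
qed

text \<open>\<open>1 - s * u z\<close> equals \<open>(1 - s) + s * exp (- z)\<close>, a point of the
  segment from 1 to \<open>exp (- z)\<close>; the plane slit along the nonpositive reals is starlike
  about 1.\<close>

lemma one_minus_su_not_nonpos: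
  assumes z: "z \<in> strip" and s: "s \<in> {0..1}"
  shows "1 - of_real s * u z \<notin> \<real>\<^sub>\<le>\<^sub>0"
proof
  assume "1 - of_real s * u z \<in> \<real>\<^sub>\<le>\<^sub>0"
  then obtain r where r: "r \<le> 0" "1 - of_real s * u z = of_real r" by (auto elim!: nonpos_Reals_cases)
  have e: "of_real s * exp (- z) = of_real (r - (1 - s))"
    using r(2) by (simp add: u_def algebra_simps)
  have s0: "s \<noteq> 0"
    using r by (auto simp: complex_eq_iff)
  then have "exp (- z) = of_real ((r - (1 - s)) / s)"
    using e by (simp add: field_simps)
  moreover have "(r - (1 - s)) / s \<le> 0"
    using s r by (auto simp: divide_nonpos_nonneg)
  ultimately have "exp (- z) \<in> \<real>\<^sub>\<le>\<^sub>0" by (metis nonpos_Reals_of_real_iff)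
  then show False using exp_strip_not_nonpos[OF z] by simp
qed

text \<open>The factor left over when the zero \<open>u z ^ Suc n\<close> is split off from
  \<open>f z - crit_val\<close>. Its values avoid the slit, so the principal logarithm provides a
  root of it on all of the strip at once.\<close>

definition K :: "complex \<Rightarrow> complex" where
  "K z = integral {0..1} (\<lambda>s. of_real s ^ n / (1 - of_real s * u z))"

lemma K_integrand_continuous:
  assumes "z \<in> strip"
  shows "continuous_on {0..1} (\<lambda>s. of_real s ^ n / (1 - of_real s * u z))"
proof -
  have "1 - of_real s * u z \<noteq> 0" if "s \<in> {0..1}" for s
    using one_minus_su_not_nonpos[OF assms that] by auto
  then show ?thesis by (intro continuous_intros) auto
qed

lemma f_minus_crit_val:
  assumes z: "z \<in> strip"
  shows "f z - of_real crit_val = u z ^ Suc n * K z"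
proof -
  \<comment> \<open>\<open>\<Phi>\<close> is the remainder of the series of
    \<open>- Ln (1 - t)\<close> after \<open>n\<close> terms, followed along the segment
    \<open>t = s * u z\<close>. At \<open>s = 1\<close> the logarithm becomes \<open>z\<close>,
    because \<open>z\<close> lies in the strip.\<close>
  define \<Phi> where "\<Phi> s = - Ln (1 - of_real s * u z) - (\<Sum>k=1..n. (of_real s * u z) ^ k / of_nat k)" for s :: real
  have nz: "1 - of_real s * u z \<noteq> 0" if "s \<in> {0..1}" for s
    using one_minus_su_not_nonpos[OF z that] by auto
  have der: "(\<Phi> has_vector_derivative u z ^ Suc n * (of_real s ^ n / (1 - of_real s * u z))) (at s within {0..1})"
    if s: "s \<in> {0..1}" for s
  proof -
    let ?t = "of_real s * u z"
    have "((\<lambda>w. - Ln (1 - w * u z)) has_field_derivative u z / (1 - ?t)) (at (of_real s))"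
      using one_minus_su_not_nonpos[OF z s] by (auto intro!: derivative_eq_intros simp: field_simps)
    moreover have "((\<lambda>w. (w * u z) ^ k / of_nat k) has_field_derivative u z * ?t ^ (k - 1)) (at (of_real s))"
      if "k \<in> {1..n}" for k
    proof -
      have "((\<lambda>w. (w * u z) ^ k / of_nat k) has_field_derivative
          of_nat k * (u z * ?t ^ (k - 1)) / of_nat k) (at (of_real s))"
        by (auto intro!: derivative_eq_intros)
      then show ?thesis using that by simp
    qed
    ultimately have "((\<lambda>w. - Ln (1 - w * u z) - (\<Sum>k=1..n. (w * u z) ^ k / of_nat k)) has_field_derivative
        u z / (1 - ?t) - (\<Sum>k=1..n. u z * ?t ^ (k - 1))) (at (of_real s))"
      by (intro DERIV_diff DERIV_sum)
    moreover have "(\<Sum>k=1..n. u z * ?t ^ (k - 1)) = u z * (\<Sum>k<n. ?t ^ k)"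
      unfolding sum_distrib_left
      by (rule sum.reindex_bij_witness[of _ Suc "\<lambda>k. k - 1"]) auto
    moreover have "u z / (1 - ?t) - u z * (\<Sum>k<n. ?t ^ k) = u z ^ Suc n * (of_real s ^ n / (1 - ?t))"
    proof -
      have "(\<Sum>k<n. ?t ^ k) = (1 - ?t ^ n) / (1 - ?t)"
        using nz[OF s] one_diff_power_eq[of ?t n] by (simp add: field_simps)
      then have "u z / (1 - ?t) - u z * (\<Sum>k<n. ?t ^ k) = u z / (1 - ?t) - u z * ((1 - ?t ^ n) / (1 - ?t))"
        by simp
      also have "\<dots> = (u z - u z * (1 - ?t ^ n)) / (1 - ?t)"
        unfolding times_divide_eq_right by (rule diff_divide_distrib[symmetric])
      also have "\<dots> = u z ^ Suc n * (of_real s ^ n / (1 - ?t))"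
        by (simp add: power_mult_distrib right_diff_distrib)
      finally show ?thesis .
    qed
    ultimately have "((\<lambda>w. - Ln (1 - w * u z) - (\<Sum>k=1..n. (w * u z) ^ k / of_nat k)) has_field_derivative
        u z ^ Suc n * (of_real s ^ n / (1 - ?t))) (at (of_real s))"
      by simp
    from has_vector_derivative_real_field[OF this] show ?thesis
      unfolding \<Phi>_def .
  qed
  have "((\<lambda>s. u z ^ Suc n * (of_real s ^ n / (1 - of_real s * u z))) has_integral (\<Phi> 1 - \<Phi> 0)) {0..1}"
    by (rule fundamental_theorem_of_calculus[OF _ der]) auto
  moreover have "\<Phi> 1 - \<Phi> 0 = f z - of_real crit_val"
  proof -
    have "(\<Sum>k=1..n. (0::complex) ^ k / of_nat k) = 0" by (intro sum.neutral) auto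
    then have "\<Phi> 0 = 0" by (simp add: \<Phi>_def)
    moreover have "Ln (1 - u z) = - z" using exp_strip_not_nonpos[OF z] by (simp add: u_def)
    ultimately show ?thesis by (simp add: \<Phi>_def f_eq_crit_val)
  qed
  moreover have "((\<lambda>s. u z ^ Suc n * (of_real s ^ n / (1 - of_real s * u z))) has_integral u z ^ Suc n * K z) {0..1}"
    unfolding K_def
    by (intro has_integral_mult_right integrable_integral integrable_continuous_interval K_integrand_continuous z)
  ultimately show ?thesis
    by (metis has_integral_unique)
qed

text \<open>
  The imaginary part of the integrand has the sign of the imaginary part of \<open>u z\<close>.
\<close>

lemma K_not_nonpos:
  assumes z: "z \<in> strip"
  shows "K z \<notin> \<real>\<^sub>\<le>\<^sub>0"
proof
  assume "K z \<in> \<real>\<^sub>\<le>\<^sub>0"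
  then have KI: "Im (K z) = 0" and KR: "Re (K z) \<le> 0"
    by (auto elim!: nonpos_Reals_cases)
  let ?g = "\<lambda>s. of_real s ^ n / (1 - of_real s * u z)"
  have I: "(?g has_integral K z) {0..1}"
    unfolding K_def by (intro integrable_integral integrable_continuous_interval K_integrand_continuous z)
  have cont: "continuous_on {0..1} ?g" by (rule K_integrand_continuous[OF z])
  have nz: "1 - of_real s * u z \<noteq> 0" if "s \<in> {0..1}" for s
    using one_minus_su_not_nonpos[OF z that] by auto
  have g: "?g s = of_real (s ^ n / (norm (1 - of_real s * u z))\<^sup>2) * cnj (1 - of_real s * u z)" for s
    by (subst complex_div_cnj) simp
  have Img: "Im (?g s) = s ^ n / (norm (1 - of_real s * u z))\<^sup>2 * (s * Im (u z))" for s
    by (subst g) (simp only: times_complex.sel Re_complex_of_real Im_complex_of_real, simp)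
  have Reg: "Re (?g s) = s ^ n / (norm (1 - of_real s * u z))\<^sup>2 * (1 - s * Re (u z))" for s
    by (subst g) (simp only: times_complex.sel Re_complex_of_real Im_complex_of_real, simp)
  show False
  proof (cases "Im (u z) = 0")
    case False
    have "((\<lambda>s. Im (?g s) * sgn (Im (u z))) has_integral Im (K z) * sgn (Im (u z))) {0..1}"
      by (intro has_integral_mult_left has_integral_Im I)
    then have "integral {0..1} (\<lambda>s. Im (?g s) * sgn (Im (u z))) = 0"
      unfolding KI mult_zero_left by (rule integral_unique)
    moreover have "integral {0..1} (\<lambda>s. Im (?g s) * sgn (Im (u z))) > 0"
    proof (rule integral_pos_continuous)
      show "continuous_on {0..1} (\<lambda>s. Im (?g s) * sgn (Im (u z)))"
        by (intro continuous_intros cont)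
      have eq: "Im (?g s) * sgn (Im (u z)) = s ^ n / (norm (1 - of_real s * u z))\<^sup>2 * (s * \<bar>Im (u z)\<bar>)" for s
        by (subst Img) (simp add: abs_sgn)
      show "0 \<le> Im (?g s) * sgn (Im (u z))" if "s \<in> {0..1}" for s
        unfolding eq using that by simp
      show "0 < Im (?g 1) * sgn (Im (u z))"
        unfolding eq using False nz[of 1] by simp
    qed
    ultimately show False by (metis less_irrefl)
  next
    \<comment> \<open>For real \<open>u z\<close> the imaginary part carries no information. The
      integrand is then real, nonnegative, and positive at \<open>s = 1\<close>, since
      \<open>1 - s * u z\<close> stays off the slit.\<close>
    case True
    have pos: "1 - s * Re (u z) > 0" if "s \<in> {0..1}" for s
    proof (rule ccontr)
      assume "\<not> ?thesis"
      then have "1 - of_real s * u z \<in> \<real>\<^sub>\<le>\<^sub>0"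
        using True by (auto simp: complex_nonpos_Reals_iff)
      then show False using one_minus_su_not_nonpos[OF z that] by simp
    qed
    have "((\<lambda>s. Re (?g s)) has_integral Re (K z)) {0..1}"
      by (intro has_integral_Re I)
    then have "integral {0..1} (\<lambda>s. Re (?g s)) \<le> 0"
      using KR by (simp add: integral_unique)
    moreover have "integral {0..1} (\<lambda>s. Re (?g s)) > 0"
    proof (rule integral_pos_continuous)
      show "continuous_on {0..1} (\<lambda>s. Re (?g s))"
        by (intro continuous_intros cont)
      show "0 \<le> Re (?g s)" if "s \<in> {0..1}" for s
        unfolding Reg using that pos[OF that] by simp
      show "0 < Re (?g 1)"
        unfolding Reg using pos[of 1] nz[of 1] by simp
    qed
    ultimately show False by simp
  qed
qed

lemma K_holomorphic: "K holomorphic_on strip"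
proof -
  have nz: "1 - of_real s * u z \<noteq> 0" if "z \<in> strip" "s \<in> {0..1}" for s z
    using one_minus_su_not_nonpos[OF that] by auto
  have "(\<lambda>z. integral (cbox 0 1) (\<lambda>s. of_real s ^ n / (1 - of_real s * u z))) holomorphic_on strip"
  proof (rule leibniz_rule_holomorphic[where fx = "\<lambda>z s. of_real s ^ n * (of_real s * exp (- z)) / (1 - of_real s * u z)\<^sup>2"])
    show "((\<lambda>z. of_real s ^ n / (1 - of_real s * u z)) has_field_derivative
        of_real s ^ n * (of_real s * exp (- z)) / (1 - of_real s * u z)\<^sup>2) (at z within strip)"
      if "z \<in> strip" "s \<in> cbox 0 1" for z s
      using nz[of z s] that by (auto intro!: derivative_eq_intros simp: power2_eq_square)
    show "(\<lambda>s. of_real s ^ n / (1 - of_real s * u z)) integrable_on cbox 0 1" if "z \<in> strip" for z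
      using integrable_continuous_interval[OF K_integrand_continuous[OF that]] by simp
    show "continuous_on (strip \<times> cbox 0 1)
        (\<lambda>(z, s). of_real s ^ n * (of_real s * exp (- z)) / (1 - of_real s * u z)\<^sup>2)"
      unfolding split_beta by (intro continuous_intros) (use nz in auto)
  qed (rule convex_strip)
  then show ?thesis by (simp add: K_def[abs_def])
qed

text \<open>
  Integrating \<open>t\<^sup>n / (1 - t)\<close>, which is \<open>f'\<close> in the coordinate \<open>u\<close>, along the segment from 0 to \<open>u z\<close>
  gives \<open>f z - crit_val = u z\<^sup>n\<^sup>+\<^sup>1 * K z\<close>, so \<open>\<zeta>\<close> is an \<open>(n+1)\<close>-st root of \<open>f - crit_val\<close>.
\<close>

definition \<zeta> :: "complex \<Rightarrow> complex" where
  "\<zeta> z = u z * exp (Ln (K z) / of_nat (Suc n))"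

lemma \<zeta>_holomorphic: "\<zeta> holomorphic_on strip"
  unfolding \<zeta>_def[abs_def]
  by (intro holomorphic_intros K_holomorphic) (use K_not_nonpos in auto)

lemma \<zeta>_continuous: "continuous_on strip \<zeta>"
  by (intro holomorphic_on_imp_continuous_on \<zeta>_holomorphic)

lemma \<zeta>_power:
  assumes "z \<in> strip"
  shows "\<zeta> z ^ Suc n = f z - of_real crit_val"
proof -
  have "K z \<noteq> 0" using K_not_nonpos[OF assms] by auto
  then have "exp (Ln (K z) / of_nat (Suc n)) ^ Suc n = K z"
    by (simp only: exp_of_nat_mult[symmetric]) (simp del: of_nat_Suc)
  then show ?thesis
    using f_minus_crit_val[OF assms] unfolding \<zeta>_def power_mult_distrib by simp
qed

lemma u_eq_0_iff:
  assumes "z \<in> strip"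
  shows "u z = 0 \<longleftrightarrow> z = 0"
proof
  assume "u z = 0"
  then have "exp (- z) = 1" by (simp add: u_def)
  then show "z = 0" using exp_strip_not_nonpos(2)[OF assms] by simp
qed (simp add: u_def)

lemma \<zeta>_eq_0_iff:
  assumes "z \<in> strip"
  shows "\<zeta> z = 0 \<longleftrightarrow> z = 0"
  using u_eq_0_iff[OF assms] by (simp add: \<zeta>_def)

text \<open>At 0 the factor \<open>u\<close> has a simple zero and its cofactor does not vanish.
  Elsewhere differentiation of the power relation gives
  \<open>(n + 1) * \<zeta> ^ n * \<zeta>' = u ^ n\<close>, which is not 0.\<close>

lemma deriv_\<zeta>_nonzero:
  assumes z: "z \<in> strip"
  shows "deriv \<zeta> z \<noteq> 0"
proof (cases "z = 0")
  case True
  define k where "k z = exp (Ln (K z) / of_nat (Suc n))" for z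
  have "k holomorphic_on strip"
    unfolding k_def[abs_def] by (intro holomorphic_intros K_holomorphic) (use K_not_nonpos in auto)
  then have "(k has_field_derivative deriv k z) (at z)"
    using z open_strip by (intro holomorphic_derivI)
  then have "((\<lambda>z. u z * k z) has_field_derivative exp (- z) * k z + u z * deriv k z) (at z)"
    by (auto intro!: derivative_eq_intros simp: algebra_simps)
  then have "deriv \<zeta> z = exp (- z) * k z + u z * deriv k z"
    by (simp add: \<zeta>_def[abs_def] k_def[abs_def] DERIV_imp_deriv)
  then show ?thesis using True by (simp add: u_def k_def)
next
  case False
  have d: "(\<zeta> has_field_derivative deriv \<zeta> z) (at z)"
    using z open_strip \<zeta>_holomorphic by (intro holomorphic_derivI)
  have "((\<lambda>z. \<zeta> z ^ Suc n) has_field_derivative of_nat (Suc n) * \<zeta> z ^ n * deriv \<zeta> z) (at z)"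
    using DERIV_power_Suc[OF d, of n] by (simp add: algebra_simps)
  moreover have "((\<lambda>z. \<zeta> z ^ Suc n) has_field_derivative u z ^ n) (at z)"
  proof (rule has_field_derivative_transform_within_open[OF _ open_strip z])
    show "((\<lambda>z. f z - of_real crit_val) has_field_derivative u z ^ n) (at z)"
      by (auto intro!: derivative_eq_intros f_has_field_derivative)
  qed (use \<zeta>_power in auto)
  ultimately have "of_nat (Suc n) * \<zeta> z ^ n * deriv \<zeta> z = u z ^ n"
    by (rule DERIV_unique)
  then show ?thesis
    using False u_eq_0_iff[OF z] by auto
qed

text \<open>This fixes the branch of the root; later \<open>\<zeta>\<close> is identified with the
  principal root by continuation from the positive axis.\<close>

lemma \<zeta>_of_real_pos:
  assumes "x > 0"
  obtains y where "y > 0" "\<zeta> (of_real x) = of_real y"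
proof -
  have "K (of_real x) = integral {0..1} (\<lambda>s. of_real (s ^ n / (1 - s * (1 - exp (- x)))))"
    by (simp add: K_def u_of_real)
  also have "\<dots> = of_real (integral {0..1} (\<lambda>s. s ^ n / (1 - s * (1 - exp (- x)))))"
    
  proof (rule integral_unique, rule has_integral_of_real, rule integrable_integral,
        rule integrable_continuous_interval)
    have "1 - s * (1 - exp (- x)) > 0" if "s \<in> {0..1}" for s
    proof -
      have "s * (1 - exp (- x)) \<le> 1 - exp (- x)" using that assms by (intro mult_left_le_one_le) auto
      also have "\<dots> < 1" by simp
      finally show ?thesis by simp
    qed
    then show "continuous_on {0..1} (\<lambda>s. s ^ n / (1 - s * (1 - exp (- x))))"
      by (intro continuous_intros) fastforce
  qed
  finally obtain k where k: "K (of_real x) = of_real k" by blast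
  with K_not_nonpos[of "of_real x"] have "k > 0"
    by (metis linorder_not_less nonpos_Reals_of_real_iff of_real_in_strip)
  then have "\<zeta> (of_real x) = of_real ((1 - exp (- x)) * exp (ln k / real (Suc n)))"
    by (simp add: \<zeta>_def u_of_real k Ln_of_real exp_of_real[symmetric] del: exp_of_real)
  moreover have "(1 - exp (- x)) * exp (ln k / real (Suc n)) > 0"
    using assms by simp
  ultimately show thesis using that by blast
qed

text \<open>Properness of \<open>f\<close> on the closed strip. Where \<open>Re z\<close> is bounded
  below, \<open>f z - z\<close> is bounded; far to the left the leading term
  \<open>u ^ n / n\<close> grows exponentially and dominates both the lower powers and
  \<open>z\<close>.\<close>

lemma norm_f_lower_bound:
  "\<exists>R. \<forall>z. \<bar>Im z\<bar> \<le> pi \<and> norm (f z) \<le> B \<longrightarrow> norm z \<le> R"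
proof -
  \<comment> \<open>From \<open>X >= 4 * n\<close> and the quadratic Taylor bound for
    \<open>exp\<close> one gets \<open>(exp X - 1) / n >= 2 * X\<close>; the second entry absorbs
    the remaining terms and \<open>B\<close>.\<close>
  define X1 where "X1 = max (4 * real n) (B + real n + pi + crit_val + 1)"
  have X1: "B < (exp X - 1) / real n - real n - X - pi - crit_val" if "X \<ge> X1" for X
  proof -
    have X: "X \<ge> 4 * real n" "X \<ge> B + real n + pi + crit_val + 1" "X \<ge> 0"
      using that by (auto simp: X1_def)
    have "4 * real n * X \<le> X * X" using X by (intro mult_right_mono) auto
    then have "4 * (X * real n) \<le> X * X" by (simp add: mult_ac)
    moreover have "1 + X + X * X / 2 \<le> exp X"
      using exp_lower_Taylor_quadratic[OF X(3)] by (simp add: power2_eq_square)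
    ultimately have "2 * (X * real n) \<le> exp X - 1"
      using X(3) by linarith
    then have "2 * X \<le> (exp X - 1) / real n" using n_pos by (simp add: pos_le_divide_eq)
    with X(2) show ?thesis by linarith
  qed
  \<comment> \<open>The logarithm forces \<open>|u z| > n ^ 2\<close>, so that
    \<open>m ^ n / n\<close> outweighs the lower terms, whose sum is at most
    \<open>n * m ^ (n - 1)\<close>.\<close>
  define X0 where "X0 = max (max X1 0) (ln (1 + real n * real n + 1))"
  define C where "C = (\<Sum>k=1..n. (1 + (1 + exp X0) ^ k) / real k)"
  have "norm z \<le> B + C" if "\<bar>Im z\<bar> \<le> pi" "norm (f z) \<le> B" for z
  proof (cases "Re z \<ge> - X0")
    case True
    have "norm (u z) \<le> 1 + norm (exp (- z))"
      unfolding u_def by (metis norm_one norm_triangle_ineq4)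
    also have "\<dots> \<le> 1 + exp X0" using True by simp
    finally have un: "norm (u z) \<le> 1 + exp X0" .
    have "norm (f z - z) \<le> (\<Sum>k=1..n. norm ((1 - u z ^ k) / of_nat k))"
      by (simp add: f_eq u_def sum_norm_le norm_sum)
    also have "\<dots> \<le> C"
      unfolding C_def
    proof (rule sum_mono)
      fix k assume "k \<in> {1..n}"
      have "norm (1 - u z ^ k) \<le> 1 + norm (u z) ^ k"
        by (metis norm_one norm_power norm_triangle_ineq4)
      also have "\<dots> \<le> 1 + (1 + exp X0) ^ k"
        using un by (intro add_left_mono power_mono) auto
      finally show "norm ((1 - u z ^ k) / of_nat k) \<le> (1 + (1 + exp X0) ^ k) / real k"
        by (simp add: norm_divide divide_right_mono)
    qed
    finally show ?thesis using that norm_triangle_ineq2[of z "f z"] by (simp add: norm_minus_commute)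
  next
    case False
    define X where "X = - Re z"
    have X: "X > X0" using False by (simp add: X_def)
    have X0: "X > 0" "X \<ge> X1" "X > ln (1 + real n * real n + 1)" using X by (auto simp: X_def X0_def)
    define m where "m = norm (u z)"
    have "exp X = norm (exp (- z))" by (simp add: X_def)
    also have "\<dots> \<le> 1 + m" unfolding u_def m_def
      by (metis norm_minus_commute norm_one norm_triangle_sub)
    finally have m1: "m \<ge> exp X - 1" by simp
    have "exp X > 1 + real n * real n + 1"
      using X0(3) by (metis add_pos_nonneg exp_less_cancel_iff exp_ln mult_nonneg_nonneg of_nat_0_le_iff zero_le_one zero_less_one add_nonneg_pos add_nonneg_nonneg)
    moreover have "real n * real n \<ge> 0" by simp
    ultimately have m2: "m > real n * real n" "m \<ge> 1" using m1 by linarith+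
    have split: "(\<Sum>k=1..n. u z ^ k / of_nat k) = u z ^ n / of_nat n + (\<Sum>k\<in>{1..n}-{n}. u z ^ k / of_nat k)"
      using n_pos by (subst sum.remove[of _ n]) auto
    have "norm (\<Sum>k\<in>{1..n}-{n}. u z ^ k / of_nat k) \<le> (\<Sum>k\<in>{1..n}-{n}. m ^ (n - 1))"
    proof (rule sum_norm_le)
      fix k assume k: "k \<in> {1..n}-{n}"
      have "norm (u z ^ k / of_nat k) = m ^ k / real k" by (simp add: m_def norm_power norm_divide)
      also have "\<dots> \<le> m ^ k / 1" using k m2 by (intro divide_left_mono) auto
      also have "\<dots> \<le> m ^ (n - 1)" using k m2 by (auto intro!: power_increasing)
      finally show "norm (u z ^ k / of_nat k) \<le> m ^ (n - 1)" .
    qed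
    also have "\<dots> \<le> real n * m ^ (n - 1)"
      using n_pos m2 by (auto simp: of_nat_diff intro!: mult_right_mono)
    finally have rest: "norm (\<Sum>k\<in>{1..n}-{n}. u z ^ k / of_nat k) \<le> real n * m ^ (n - 1)" .
    have top: "norm (u z ^ n / of_nat n) = m ^ (n - 1) * (m / real n)"
      using n_pos by (cases n) (simp_all add: m_def norm_power norm_divide norm_mult del: of_nat_Suc)
    have "m / real n - real n \<ge> 0" using m2 n_pos by (simp add: field_simps)
    then have "m / real n - real n \<le> m ^ (n - 1) * (m / real n - real n)"
      using m2 by (intro mult_le_cancel_right1[THEN iffD2]) (auto simp: one_le_power)
    also have "\<dots> \<le> norm (\<Sum>k=1..n. u z ^ k / of_nat k)"
      using norm_diff_ineq[of "u z ^ n / of_nat n" "\<Sum>k\<in>{1..n}-{n}. u z ^ k / of_nat k"] rest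
      unfolding split top by (simp add: algebra_simps)
    also have "\<dots> \<le> norm (f z) + norm z + crit_val"
    proof -
      have "(\<Sum>k=1..n. u z ^ k / of_nat k) = z + of_real crit_val - f z"
        by (simp add: f_eq_crit_val)
      also have "norm \<dots> \<le> norm z + norm (of_real crit_val :: complex) + norm (f z)"
        by (meson add_right_mono norm_triangle_ineq norm_triangle_ineq4 order_trans)
      finally show ?thesis using crit_val_pos by simp
    qed
    finally have "m / real n - real n \<le> norm (f z) + norm z + crit_val" .
    moreover have "norm z \<le> X + pi"
      using cmod_le[of z] that(1) X0(1) by (simp add: X_def)
    moreover have "(exp X - 1) / real n \<le> m / real n" using m1 by (intro divide_right_mono) auto
    ultimately have "(exp X - 1) / real n - real n - X - pi - crit_val \<le> norm (f z)" by linarith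
    with X1[OF X0(2)] that(2) show ?thesis by linarith
  qed
  then show ?thesis by blast
qed

section \<open>Properness and bijectivity of the root\<close>

definition T :: "complex set" where
  "T = {v. of_real crit_val + v ^ Suc n \<in> strip}"

definition strip1 :: "complex set" where
  "strip1 = strip \<inter> f -` strip"

lemma open_T: "open T"
  unfolding T_def by (rule open_vimage[OF open_strip, unfolded vimage_def]) (intro continuous_intros)

lemma open_strip1: "open strip1"
  unfolding strip1_def
  by (intro open_Int open_strip open_vimage f_continuous)

lemma \<zeta>_in_T: "z \<in> strip1 \<Longrightarrow> \<zeta> z \<in> T"
  using \<zeta>_power[of z] by (auto simp: strip1_def T_def)

text \<open>\<open>T\<close> is starlike about 0: as \<open>v\<close> is scaled down to 0,
  \<open>crit_val + v ^ Suc n\<close> moves on a segment towards \<open>crit_val\<close> inside the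
  convex strip.\<close>

lemma connected_T: "connected T"
proof (rule starlike_imp_connected)
  have "closed_segment 0 v \<subseteq> T" if v: "v \<in> T" for v
  proof
    fix w assume "w \<in> closed_segment 0 v"
    then obtain s where s: "0 \<le> s" "s \<le> 1" "w = of_real s * v"
      by (auto simp: closed_segment_def scaleR_conv_of_real)
    have "s ^ Suc n \<in> {0..1}" using s by (simp add: power_le_one mult_le_one)
    moreover have "of_real crit_val + w ^ Suc n = (1 - s ^ Suc n) *\<^sub>R of_real crit_val
        + (s ^ Suc n) *\<^sub>R (of_real crit_val + v ^ Suc n)"
      by (simp only: s(3) power_mult_distrib) (simp add: scaleR_conv_of_real algebra_simps)
    ultimately have "of_real crit_val + w ^ Suc n \<in> strip"
      using convexD_alt[OF convex_strip of_real_in_strip[of crit_val], of "of_real crit_val + v ^ Suc n" "s ^ Suc n"] v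
      by (simp add: T_def)
    then show "w \<in> T" by (simp add: T_def)
  qed
  moreover have "0 \<in> T" by (simp add: T_def)
  ultimately show "starlike T" by (auto simp: starlike_def)
qed

text \<open>The values \<open>f (X k)\<close> converge, so \<open>X\<close> is bounded and
  accumulates at a point of the closed strip. That point is not on a boundary line, since these
  lines are mapped into themselves while its image lies in the open strip.\<close>

lemma \<zeta>_proper:
  assumes X: "\<And>k::nat. X k \<in> strip1" and lim: "(\<lambda>k. \<zeta> (X k)) \<longlonglongrightarrow> v" and v: "v \<in> T"
  obtains z r where "z \<in> strip1" "strict_mono r" "(X \<circ> r) \<longlonglongrightarrow> z" "\<zeta> z = v"
proof -
  have fX: "(\<lambda>k. f (X k)) \<longlonglongrightarrow> of_real crit_val + v ^ Suc n"
  proof -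
    have "(\<lambda>k. of_real crit_val + \<zeta> (X k) ^ Suc n) \<longlonglongrightarrow> of_real crit_val + v ^ Suc n"
      by (intro tendsto_intros lim)
    moreover have "of_real crit_val + \<zeta> (X k) ^ Suc n = f (X k)" for k
      using \<zeta>_power[of "X k"] X[of k] by (auto simp: strip1_def)
    ultimately show ?thesis by simp
  qed
  then have "bounded (range (\<lambda>k. f (X k)))" by (rule convergent_imp_bounded)
  then obtain B where B: "\<And>k. norm (f (X k)) \<le> B" by (auto simp: bounded_iff)
  obtain R where R: "\<And>z. \<bar>Im z\<bar> \<le> pi \<Longrightarrow> norm (f z) \<le> B \<Longrightarrow> norm z \<le> R"
    using norm_f_lower_bound by blast
  have "\<bar>Im (X k)\<bar> \<le> pi" for k using X[of k] by (auto simp: strip1_def strip_def)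
  then have inC: "X k \<in> cball 0 R \<inter> {z. \<bar>Im z\<bar> \<le> pi}" for k using R B by simp
  have "closed {z. \<bar>Im z\<bar> \<le> pi}" by (intro closed_Collect_le continuous_intros)
  then have "compact (cball (0::complex) R \<inter> {z. \<bar>Im z\<bar> \<le> pi})"
    by (intro compact_Int_closed compact_cball)
  then have "\<exists>l\<in>cball (0::complex) R \<inter> {z. \<bar>Im z\<bar> \<le> pi}. \<exists>r. strict_mono r \<and> (X \<circ> r) \<longlonglongrightarrow> l"
    using inC by (simp only: compact_def) blast
  then obtain z r where z: "\<bar>Im z\<bar> \<le> pi" and r: "strict_mono r" "(X \<circ> r) \<longlonglongrightarrow> z" by auto
  have "(\<lambda>k. f ((X \<circ> r) k)) \<longlonglongrightarrow> f z"
    using continuous_on_tendsto_compose[OF f_continuous[of UNIV] r(2)] by simp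
  moreover have "(\<lambda>k. f ((X \<circ> r) k)) \<longlonglongrightarrow> of_real crit_val + v ^ Suc n"
    using LIMSEQ_subseq_LIMSEQ[OF fX r(1)] by (simp add: o_def)
  ultimately have fz: "f z = of_real crit_val + v ^ Suc n" by (rule LIMSEQ_unique)
  then have fzS: "f z \<in> strip" using v by (simp add: T_def)
  have "\<bar>Im z\<bar> \<noteq> pi" using f_boundary_line(1)[of z] fzS by (auto simp: strip_def)
  then have zS: "z \<in> strip" using z by (simp add: strip_def)
  have "(\<lambda>k. \<zeta> ((X \<circ> r) k)) \<longlonglongrightarrow> \<zeta> z"
    using X by (intro continuous_on_tendsto_compose[OF \<zeta>_continuous r(2) zS]) (auto simp: strip1_def)
  moreover have "(\<lambda>k. \<zeta> ((X \<circ> r) k)) \<longlonglongrightarrow> v"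
    using LIMSEQ_subseq_LIMSEQ[OF lim r(1)] by (simp add: o_def)
  ultimately have "\<zeta> z = v" by (rule LIMSEQ_unique)
  then show thesis using that[of z r] zS fzS r by (simp add: strip1_def)
qed

lemma \<zeta>_holomorphic_strip1: "\<zeta> holomorphic_on strip1"
  by (rule holomorphic_on_subset[OF \<zeta>_holomorphic]) (auto simp: strip1_def)

lemma \<zeta>_open_image:
  assumes "open X" "X \<subseteq> strip1"
  shows "open (\<zeta> ` X)"
proof -
  have "\<exists>r>0. ball y r \<subseteq> \<zeta> ` X" if "y \<in> \<zeta> ` X" for y
  proof -
    obtain z where z: "z \<in> X" "y = \<zeta> z" using \<open>y \<in> \<zeta> ` X\<close> by auto
    then have "z \<in> strip" using assms by (auto simp: strip1_def)
    then obtain r where r: "r > 0" "ball z r \<subseteq> X" "inj_on \<zeta> (ball z r)"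
      using has_complex_derivative_locally_injective[OF holomorphic_on_subset[OF \<zeta>_holomorphic_strip1 assms(2)] z(1) assms(1) deriv_\<zeta>_nonzero]
      by blast
    have "open (\<zeta> ` ball z r)"
      using open_mapping_thm3[of \<zeta> "ball z r"] r(2,3) assms \<zeta>_holomorphic_strip1
      by (auto intro: holomorphic_on_subset)
    moreover have "y \<in> \<zeta> ` ball z r" using z r by auto
    ultimately obtain e where "e > 0" "ball y e \<subseteq> \<zeta> ` ball z r" by (meson openE)
    then show ?thesis using r(2) by blast
  qed
  then show ?thesis by (meson open_contains_ball)
qed

lemma zero_in_strip1: "0 \<in> strip1"
proof -
  have "f 0 = of_real crit_val" by (simp add: f_eq crit_val_def power_0_left) 
  moreover have "(0::complex) \<in> strip" by (simp add: strip_def)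
  ultimately show ?thesis by (simp add: strip1_def)
qed

text \<open>
  A proper local homeomorphism of connected domains that takes the value 0 only once is injective:
  the set of values taken at least twice is open and closed.
\<close>

lemma \<zeta>_conformal: "conformal_onto \<zeta> strip1 T"
proof -
  \<comment> \<open>The image is open in the connected set \<open>T\<close>, and relatively closed
    by properness.\<close>
  have surj: "\<zeta> ` strip1 = T"
  proof (rule ccontr)
    assume neq: "\<zeta> ` strip1 \<noteq> T"
    have sub: "\<zeta> ` strip1 \<subseteq> T" using \<zeta>_in_T by auto
    have cl: "T \<inter> closure (\<zeta> ` strip1) \<subseteq> \<zeta> ` strip1"
    proof
      fix v assume v: "v \<in> T \<inter> closure (\<zeta> ` strip1)"
      then obtain Y where Y: "\<And>k. Y k \<in> \<zeta> ` strip1" "Y \<longlonglongrightarrow> v"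
        by (auto simp: closure_sequential)
      have "\<exists>x. x \<in> strip1 \<and> \<zeta> x = Y k" for k using Y(1)[of k] by auto
      then obtain X where X: "\<And>k. X k \<in> strip1" "\<And>k. \<zeta> (X k) = Y k" by metis
      obtain z where "z \<in> strip1" "\<zeta> z = v"
        using \<zeta>_proper[of X v] X Y v by auto
      then show "v \<in> \<zeta> ` strip1" by auto
    qed
    have "T \<subseteq> \<zeta> ` strip1 \<union> (T - closure (\<zeta> ` strip1))" using cl by auto
    moreover have "\<zeta> ` strip1 \<inter> (T - closure (\<zeta> ` strip1)) \<inter> T = {}" using closure_subset[of "\<zeta> ` strip1"] by blast
    moreover have "open (\<zeta> ` strip1)" by (rule \<zeta>_open_image[OF open_strip1]) simp
    moreover have "open (T - closure (\<zeta> ` strip1))" by (intro open_Diff open_T closed_closure)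
    moreover have "\<zeta> ` strip1 \<inter> T \<noteq> {}" using sub zero_in_strip1 by auto
    moreover have "(T - closure (\<zeta> ` strip1)) \<inter> T \<noteq> {}" using cl neq sub by auto
    ultimately show False using connectedD[OF connected_T] by blast
  qed
  define G where "G = {v. \<exists>z1\<in>strip1. \<exists>z2\<in>strip1. z1 \<noteq> z2 \<and> \<zeta> z1 = v \<and> \<zeta> z2 = v}"
  have GT: "G \<subseteq> T" using \<zeta>_in_T by (auto simp: G_def)
  have "open G"
    unfolding open_contains_ball
  proof
    fix v assume "v \<in> G"
    then obtain z1 z2 where z: "z1 \<in> strip1" "z2 \<in> strip1" "z1 \<noteq> z2" "\<zeta> z1 = v" "\<zeta> z2 = v"
      by (auto simp: G_def)
    obtain A B where AB: "open A" "open B" "z1 \<in> A" "z2 \<in> B" "A \<inter> B = {}"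
      using z(3) by (meson separation_t2)
    have "open (\<zeta> ` (A \<inter> strip1) \<inter> \<zeta> ` (B \<inter> strip1))"
      using AB open_strip1 by (intro open_Int \<zeta>_open_image) auto
    moreover have "v \<in> \<zeta> ` (A \<inter> strip1) \<inter> \<zeta> ` (B \<inter> strip1)"
      using z AB by (metis IntI image_eqI)
    ultimately obtain e where e: "e > 0" "ball v e \<subseteq> \<zeta> ` (A \<inter> strip1) \<inter> \<zeta> ` (B \<inter> strip1)"
      by (meson openE)
    have "\<zeta> ` (A \<inter> strip1) \<inter> \<zeta> ` (B \<inter> strip1) \<subseteq> G"
    proof
      fix w assume w: "w \<in> \<zeta> ` (A \<inter> strip1) \<inter> \<zeta> ` (B \<inter> strip1)"
      then obtain x y where xy: "x \<in> A" "x \<in> strip1" "w = \<zeta> x" "y \<in> B" "y \<in> strip1" "w = \<zeta> y"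
        by (elim IntE imageE) simp
      moreover have "x \<noteq> y" using xy AB(5) by blast
      ultimately show "w \<in> G" by (auto simp: G_def)
    qed
    with e show "\<exists>e>0. ball v e \<subseteq> G" by blast
  qed
  have cl: "T \<inter> closure G \<subseteq> G"
  proof
    fix v assume v: "v \<in> T \<inter> closure G"
    then obtain Y where Y: "\<And>k. Y k \<in> G" "Y \<longlonglongrightarrow> v" by (auto simp: closure_sequential)
    then have "\<forall>k. \<exists>x y. x \<in> strip1 \<and> y \<in> strip1 \<and> x \<noteq> y \<and> \<zeta> x = Y k \<and> \<zeta> y = Y k"
      unfolding G_def by blast
    then obtain X1 X2 where X: "\<And>k. X1 k \<in> strip1" "\<And>k. X2 k \<in> strip1" "\<And>k. X1 k \<noteq> X2 k"
        "\<And>k. \<zeta> (X1 k) = Y k" "\<And>k. \<zeta> (X2 k) = Y k" by metis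
    obtain z1 r1 where z1: "z1 \<in> strip1" "strict_mono r1" "(X1 \<circ> r1) \<longlonglongrightarrow> z1" "\<zeta> z1 = v"
      using \<zeta>_proper[of X1 v] X Y v by auto
    have "(\<lambda>k. \<zeta> ((X2 \<circ> r1) k)) \<longlonglongrightarrow> v"
      using LIMSEQ_subseq_LIMSEQ[OF Y(2) z1(2)] by (simp add: o_def X(5))
    then obtain z2 r2 where z2: "z2 \<in> strip1" "strict_mono r2" "(X2 \<circ> r1 \<circ> r2) \<longlonglongrightarrow> z2" "\<zeta> z2 = v"
      using \<zeta>_proper[of "X2 \<circ> r1" v] X v by auto
    have l1: "(X1 \<circ> r1 \<circ> r2) \<longlonglongrightarrow> z1"
      by (rule LIMSEQ_subseq_LIMSEQ[OF z1(3) z2(2)])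
    \<comment> \<open>If the two sequences of preimages merged in the limit, local injectivity would
      fail there.\<close>
    have "z1 \<noteq> z2"
    proof
      assume eq: "z1 = z2"
      have "z1 \<in> strip" using z1(1) by (simp add: strip1_def)
      then obtain r where r: "r > 0" "inj_on \<zeta> (ball z1 r)"
        using has_complex_derivative_locally_injective[OF \<zeta>_holomorphic_strip1 z1(1) open_strip1 deriv_\<zeta>_nonzero]
        by blast
      have "\<forall>\<^sub>F k in sequentially. (X1 \<circ> r1 \<circ> r2) k \<in> ball z1 r \<and> (X2 \<circ> r1 \<circ> r2) k \<in> ball z1 r"
        using topological_tendstoD[OF l1 open_ball] topological_tendstoD[OF z2(3) open_ball] r(1) eq
        by (intro eventually_conj) auto
      then obtain k where "(X1 \<circ> r1 \<circ> r2) k \<in> ball z1 r" "(X2 \<circ> r1 \<circ> r2) k \<in> ball z1 r"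
        using eventually_happens'[OF sequentially_bot] by blast
      then have "X1 (r1 (r2 k)) = X2 (r1 (r2 k))"
        using r(2) X(4,5) by (auto simp: inj_on_def)
      then show False using X(3) by blast
    qed
    then show "v \<in> G" using z1 z2 by (auto simp: G_def)
  qed
  have "0 \<notin> G"
    using \<zeta>_eq_0_iff by (auto simp: G_def strip1_def)
  moreover have "0 \<in> T" by (simp add: T_def)
  ultimately have "(T - closure G) \<inter> T \<noteq> {}" using cl by auto
  moreover have "T \<subseteq> G \<union> (T - closure G)" using cl by auto
  moreover have "G \<inter> (T - closure G) \<inter> T = {}" using closure_subset[of G] by blast
  moreover have "open (T - closure G)" by (intro open_Diff open_T closed_closure)
  ultimately have "G \<inter> T = {}" using connectedD[OF connected_T \<open>open G\<close>] by blast
  then have "G = {}" using GT by blast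
  then have "inj_on \<zeta> strip1" unfolding inj_on_def G_def by blast
  with surj show ?thesis
    by (simp add: conformal_onto_def bij_betw_def \<zeta>_holomorphic_strip1)
qed

end

section \<open>Petal and basin\<close>

text \<open>
  One minus the Weierstrass factor is an integral whose integrand is dominated by its value at
  real arguments, so it is bounded by its value at 1, where the factor vanishes.
\<close>

lemma norm_one_minus_Weierstrass_factor_le:
  fixes v :: complex
  assumes v: "norm v \<le> 1"
  shows "norm (1 - (1 - v) * exp (\<Sum>k=1..n. v ^ k / of_nat k)) \<le> 1"
proof -
  define S where "S = (\<lambda>w::complex. \<Sum>k=1..n. w ^ k / of_nat k)"
  define E where "E = (\<lambda>w. (1 - w) * exp (S w))"
  have dS: "(S has_field_derivative (\<Sum>k<n. w ^ k)) (at w)" for w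
  proof -
    have "((\<lambda>w. w ^ k / of_nat k) has_field_derivative w ^ (k - 1)) (at w)" if "k \<in> {1..n}" for k
    proof -
      have "((\<lambda>w. w ^ k / of_nat k) has_field_derivative of_nat k * w ^ (k - 1) / of_nat k) (at w)"
        by (auto intro!: derivative_eq_intros)
      then show ?thesis using that by simp
    qed
    then have "(S has_field_derivative (\<Sum>k=1..n. w ^ (k - 1))) (at w)"
      unfolding S_def by (intro DERIV_sum)
    moreover have "(\<Sum>k=1..n. w ^ (k - 1)) = (\<Sum>k<n. w ^ k)"
      by (rule sum.reindex_bij_witness[of _ Suc "\<lambda>k. k - 1"]) auto
    ultimately show ?thesis by simp
  qed
  have dE: "(E has_field_derivative - (w ^ n * exp (S w))) (at w)" for w
  proof -
    have "(E has_field_derivative (1 - w) * (exp (S w) * (\<Sum>k<n. w ^ k)) + (0 - 1) * exp (S w)) (at w)"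
      unfolding E_def by (rule DERIV_mult'[OF _ DERIV_fun_exp[OF dS]]) (auto intro!: derivative_eq_intros)
    moreover have "(1 - w) * (exp (S w) * (\<Sum>k<n. w ^ k)) + (0 - 1) * exp (S w) = - (w ^ n * exp (S w))"
    proof -
      have "(1 - w) * (exp (S w) * (\<Sum>k<n. w ^ k)) = exp (S w) * ((1 - w) * (\<Sum>k<n. w ^ k))"
        by (simp only: mult_ac)
      also have "\<dots> = exp (S w) * (1 - w ^ n)"
        by (simp only: one_diff_power_eq)
      finally show ?thesis by (simp add: algebra_simps)
    qed
    ultimately show ?thesis by simp
  qed
  have int: "((\<lambda>s. - (v * ((of_real s * v) ^ n * exp (S (of_real s * v))))) has_integral (E v - E 0)) {0..1}" for v
  proof -
    have "((\<lambda>s. E (of_real s * v)) has_vector_derivative - (v * ((of_real s * v) ^ n * exp (S (of_real s * v))))) (at s within {0..1})" for s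
    proof -
      have "((\<lambda>w. E (w * v)) has_field_derivative - ((of_real s * v) ^ n * exp (S (of_real s * v))) * v) (at (of_real s))"
        by (rule DERIV_chain2[OF dE]) (auto intro!: derivative_eq_intros)
      from has_vector_derivative_real_field[OF this] show ?thesis
        by (simp add: mult_ac)
    qed
    from fundamental_theorem_of_calculus[OF _ this] show ?thesis by fastforce
  qed
  have E0: "E 0 = 1" and E1: "E 1 = 0"
    by (simp_all add: E_def S_def power_0_left)
  define g where "g = (\<lambda>s::real. s ^ n * exp (\<Sum>k=1..n. s ^ k / real k))"
  have gS: "of_real (g s) = (of_real s * 1) ^ n * exp (S (of_real s * 1))" for s
    by (simp add: g_def S_def exp_of_real[symmetric] del: exp_of_real)
  have "((\<lambda>s. complex_of_real (g s)) has_integral 1) {0..1}"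
    using has_integral_neg[OF int[of 1]] by (simp add: gS E0 E1)
  from has_integral_Re[OF this] have g1: "(g has_integral 1) {0..1}"
    by simp
  have bound: "norm (- (v * ((of_real s * v) ^ n * exp (S (of_real s * v))))) \<le> g s" if s: "s \<in> {0..1}" for s
  proof -
    have sv: "norm (of_real s * v) \<le> s" using v s by (simp add: norm_mult mult_left_le)
    have "Re (S (of_real s * v)) \<le> (\<Sum>k=1..n. s ^ k / real k)"
      unfolding S_def Re_sum
    proof (rule sum_mono)
      fix k assume "k \<in> {1..n}"
      have "Re ((of_real s * v) ^ k / of_nat k) \<le> norm ((of_real s * v) ^ k / of_nat k)"
        by (rule complex_Re_le_cmod)
      also have "\<dots> = norm (of_real s * v) ^ k / real k" by (simp add: norm_divide norm_power)
      also have "\<dots> \<le> s ^ k / real k" using sv by (intro divide_right_mono power_mono) auto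
      finally show "Re ((of_real s * v) ^ k / of_nat k) \<le> s ^ k / real k" .
    qed
    then have "norm (exp (S (of_real s * v))) \<le> exp (\<Sum>k=1..n. s ^ k / real k)" by simp
    moreover have "norm ((of_real s * v) ^ n) \<le> s ^ n"
      using sv by (simp only: norm_power) (intro power_mono, auto)
    ultimately have "norm ((of_real s * v) ^ n * exp (S (of_real s * v))) \<le> g s"
      unfolding g_def norm_mult[of "(of_real s * v) ^ n"] by (intro mult_mono) (use s in auto)
    moreover have "norm v * norm ((of_real s * v) ^ n * exp (S (of_real s * v))) \<le> 1 * norm ((of_real s * v) ^ n * exp (S (of_real s * v)))"
      using v by (intro mult_right_mono) auto
    ultimately show ?thesis unfolding norm_minus_cancel norm_mult[of v] by linarith
  qed
  have "norm (E v - E 0) \<le> 1"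
    using integral_norm_bound_integral[OF has_integral_integrable[OF int[of v]] has_integral_integrable[OF g1] bound]
    unfolding integral_unique[OF int] integral_unique[OF g1] .
  then show ?thesis unfolding E0 by (simp add: E_def S_def norm_minus_commute)
qed

lemma cos_plus_abs_sin_pos:
  assumes "\<bar>y\<bar> < pi" and "cos y + \<bar>sin y\<bar> > 0"
  shows "\<bar>y\<bar> < 3 * pi / 4"
proof (rule ccontr)
  assume "\<not> ?thesis"
  then have y: "\<bar>y\<bar> \<ge> 3 * pi / 4" by simp
  define t where "t = pi - \<bar>y\<bar>"
  have t: "0 \<le> t" "t \<le> pi / 4" using assms(1) y by (auto simp: t_def)
  have c: "cos y = - cos t" 
    by (simp add: t_def cos_diff)
  have s: "\<bar>sin y\<bar> = sin t"
  proof -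
    have "sin t = sin \<bar>y\<bar>" by (simp add: t_def)
    moreover have "sin t \<ge> 0" using t by (intro sin_ge_zero) auto
    ultimately show ?thesis by (auto simp: abs_if split: if_splits)
  qed
  have "sin t \<le> sin (pi / 4)" using t by (intro sin_monotone_2pi_le) auto
  moreover have "cos (pi / 4) \<le> cos t" using t by (intro cos_monotone_0_pi_le) auto
  ultimately have "sin t \<le> cos t" by (simp add: sin_45 cos_45)
  then show False using assms(2) c s by simp
qed

lemma abs_less_half_pi_if_cos_pos:
  assumes "\<bar>y\<bar> < pi" "cos y > 0"
  shows "\<bar>y\<bar> < pi / 2"
proof (rule ccontr)
  assume "\<not> ?thesis"
  then have "cos \<bar>y\<bar> \<le> cos (pi / 2)" using assms(1) by (intro cos_monotone_0_pi_le) auto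
  then show False using assms(2) by (simp add: abs_if split: if_splits)
qed

context strip_map
begin

section \<open>Invariance and drift of the petal\<close>

definition petal :: "complex set" where
  "petal = {z \<in> strip. norm (u z) < 1}"

text \<open>Since \<open>f' = u ^ n\<close>, this is exactly the part of the strip where
  \<open>|f'| <= 1\<close>.\<close>

definition cpetal :: "complex set" where
  "cpetal = {z \<in> strip. norm (u z) \<le> 1}"

lemma petal_subset_cpetal: "petal \<subseteq> cpetal"
  by (auto simp: petal_def cpetal_def)

text \<open>In the variable \<open>w = exp (- z)\<close> this is the parabolic map \<open>F\<close>;
  it turns out to be a Weierstrass primary factor in \<open>u = 1 - w\<close>, scaled by
  \<open>exp (- crit_val)\<close>.\<close>

lemma exp_f: "exp (- f z) = of_real (exp (- crit_val)) * ((1 - u z) * exp (\<Sum>k=1..n. u z ^ k / of_nat k))"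
proof -
  have "- f z = - of_real crit_val + (- z + (\<Sum>k=1..n. u z ^ k / of_nat k))"
    by (simp add: f_eq_crit_val)
  then have "exp (- f z) = exp (- of_real crit_val) * (exp (- z) * exp (\<Sum>k=1..n. u z ^ k / of_nat k))"
    by (simp only: exp_add)
  then show ?thesis
    by (simp add: u_def exp_of_real[symmetric] del: exp_of_real)
qed

text \<open>\<open>u (f z)\<close> is a proper convex combination of 1 and the point
  \<open>X\<close> of the closed disc. As \<open>1 - u z = exp (- z)\<close> is not 0,
  \<open>X\<close> differs from 1, and strict convexity of the disc puts the combination
  inside.\<close>

lemma norm_u_f_less:
  assumes "norm (u z) \<le> 1"
  shows "norm (u (f z)) < 1"
proof -
  define a where "a = exp (- crit_val)"
  define X where "X = 1 - (1 - u z) * exp (\<Sum>k=1..n. u z ^ k / of_nat k)"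
  have a: "0 < a" "a < 1" using crit_val_pos by (auto simp: a_def)
  have X1: "norm X \<le> 1" unfolding X_def by (rule norm_one_minus_Weierstrass_factor_le[OF assms])
  have "1 - u z = exp (- z)" by (simp add: u_def)
  then have X2: "X \<noteq> 1" by (simp add: X_def)
  have ReX: "Re X < 1"
  proof (rule ccontr)
    assume "\<not> ?thesis"
    then have re: "Re X = 1" using X1 complex_Re_le_cmod[of X] by linarith
    then have "1 + (Im X)\<^sup>2 \<le> 1"
      using X1 power_mono[OF X1 norm_ge_zero, of 2] by (simp add: cmod_power2)
    then have "Im X = 0" by simp
    with re X2 show False by (simp add: complex_eq_iff)
  qed
  have uf: "u (f z) = of_real (1 - a) + of_real a * X"
    unfolding u_def[of "f z"] exp_f X_def a_def by (simp add: algebra_simps)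
  have "(norm (u (f z)))\<^sup>2 = (1 - a)\<^sup>2 + 2 * a * (1 - a) * Re X + a\<^sup>2 * (norm X)\<^sup>2"
    unfolding uf cmod_power2 by (simp add: algebra_simps power2_eq_square)
  also have "\<dots> < (1 - a)\<^sup>2 + 2 * a * (1 - a) * 1 + a\<^sup>2 * 1"
  proof -
    have "2 * a * (1 - a) * Re X < 2 * a * (1 - a) * 1" using a ReX by (intro mult_strict_left_mono) auto
    moreover have "a\<^sup>2 * (norm X)\<^sup>2 \<le> a\<^sup>2 * 1" using X1 by (intro mult_left_mono) (auto simp: power_le_one)
    ultimately show ?thesis by linarith
  qed
  also have "\<dots> = 1" by (simp add: algebra_simps power2_eq_square)
  finally have "(norm (u (f z)))\<^sup>2 < 1" .
  then show ?thesis by (simp add: abs_square_less_1)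
qed

lemma norm_u_le_1_iff: "norm (u z) \<le> 1 \<longleftrightarrow> exp (- Re z) \<le> 2 * cos (Im z)"
proof -
  have "(norm (u z))\<^sup>2 = (1 - exp (- Re z) * cos (Im z))\<^sup>2 + (exp (- Re z))\<^sup>2 * (1 - (cos (Im z))\<^sup>2)"
    unfolding u_def cmod_power2 by (simp add: Re_exp Im_exp power_mult_distrib flip: sin_squared_eq)
  then have eq: "(norm (u z))\<^sup>2 = 1 + exp (- Re z) * (exp (- Re z) - 2 * cos (Im z))"
    by (simp add: algebra_simps power2_eq_square)
  have "norm (u z) \<le> 1 \<longleftrightarrow> (norm (u z))\<^sup>2 \<le> 1" by (simp add: abs_square_le_1)
  also have "\<dots> \<longleftrightarrow> exp (- Re z) * (exp (- Re z) - 2 * cos (Im z)) \<le> 0" unfolding eq by simp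
  also have "\<dots> \<longleftrightarrow> exp (- Re z) \<le> 2 * cos (Im z)" by (simp add: mult_le_0_iff)
  finally show ?thesis .
qed

lemma cpetal_cos_pos:
  assumes "z \<in> cpetal"
  shows "cos (Im z) > 0" and "\<bar>Im z\<bar> < pi / 2" and "Re z \<ge> - ln 2"
proof -
  have e: "exp (- Re z) \<le> 2 * cos (Im z)"
    using assms by (simp add: cpetal_def norm_u_le_1_iff)
  then show c: "cos (Im z) > 0" using exp_gt_zero[of "- Re z"] by linarith
  then show "\<bar>Im z\<bar> < pi / 2"
    using assms by (intro abs_less_half_pi_if_cos_pos) (auto simp: cpetal_def strip_def)
  have "exp (- Re z) \<le> 2" using e cos_le_one[of "Im z"] by linarith
  then have "- Re z \<le> ln 2" by (subst ln_ge_iff) auto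
  then show "Re z \<ge> - ln 2" by simp
qed

text \<open>The bound \<open>|u (f z)| < 1\<close> determines \<open>f z\<close> only up to
  translation by multiples of \<open>2 * pi * \<i>\<close>. The right translate is found by moving
  vertically from the real axis to \<open>z\<close>: along this segment
  \<open>cos (Im (f z))\<close> stays positive, so \<open>Im (f z)\<close> cannot leave the interval
  around 0.\<close>

lemma f_cpetal:
  assumes z: "z \<in> cpetal"
  shows "f z \<in> petal"
proof -
  define zt where "zt t = Complex (Re z) (t * Im z)" for t
  have u_le: "norm (u (zt t)) \<le> 1" if t: "t \<in> {0..1}" for t
  proof -
    have "\<bar>t * Im z\<bar> \<le> \<bar>Im z\<bar>" using t by (simp add: abs_mult mult_left_le_one_le)
    then have "cos \<bar>Im z\<bar> \<le> cos \<bar>t * Im z\<bar>"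
      using cpetal_cos_pos(2)[OF z] pi_gt_zero by (intro cos_monotone_0_pi_le) linarith+
    then have "cos (Im z) \<le> cos (t * Im z)" by (simp add: abs_if split: if_splits)
    moreover have "exp (- Re z) \<le> 2 * cos (Im z)" using z by (simp add: cpetal_def norm_u_le_1_iff)
    ultimately show ?thesis by (simp add: norm_u_le_1_iff zt_def)
  qed
  have c: "cos (Im (f (zt t))) > 0" if t: "t \<in> {0..1}" for t
  proof -
    have "norm (u (f (zt t))) \<le> 1" using norm_u_f_less[OF u_le[OF t]] by simp
    then have "exp (- Re (f (zt t))) \<le> 2 * cos (Im (f (zt t)))" by (simp add: norm_u_le_1_iff)
    then show ?thesis using exp_gt_zero[of "- Re (f (zt t))"] by linarith
  qed
  have "continuous_on {0..1} (\<lambda>t. Im (f (zt t)))"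
    unfolding zt_def Complex_eq by (intro continuous_intros)
  then have conn: "connected ((\<lambda>t. Im (f (zt t))) ` {0..1})"
    by (intro connected_continuous_image) auto
  have "zt 0 = of_real (Re z)" by (simp add: zt_def complex_eq_iff)
  then have "Im (f (zt 0)) = 0" by (simp add: f_of_real)
  then have zero: "0 \<in> (\<lambda>t. Im (f (zt t))) ` {0..1}" by force
  have "zt 1 = z" by (simp add: zt_def)
  then have fz: "Im (f z) \<in> (\<lambda>t. Im (f (zt t))) ` {0..1}" by force
  have "\<bar>Im (f z)\<bar> < pi / 2"
  proof (rule ccontr)
    assume "\<not> ?thesis"
    then have "Im (f z) \<ge> pi / 2 \<or> Im (f z) \<le> - (pi / 2)" by linarith
    moreover have "pi / 2 \<in> (\<lambda>t. Im (f (zt t))) ` {0..1}" if "Im (f z) \<ge> pi / 2"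
      using that by (intro connectedD_interval[OF conn zero fz]) auto
    moreover have "- (pi / 2) \<in> (\<lambda>t. Im (f (zt t))) ` {0..1}" if "Im (f z) \<le> - (pi / 2)"
      using that by (intro connectedD_interval[OF conn fz zero]) auto
    ultimately have "pi / 2 \<in> (\<lambda>t. Im (f (zt t))) ` {0..1} \<or> - (pi / 2) \<in> (\<lambda>t. Im (f (zt t))) ` {0..1}"
      by blast
    then obtain t where "t \<in> {0..1}" "Im (f (zt t)) = pi / 2 \<or> Im (f (zt t)) = - (pi / 2)" by auto
    then have "cos (Im (f (zt t))) = 0" by (elim disjE) (simp_all only: cos_minus cos_pi_half)
    with c[OF \<open>t \<in> {0..1}\<close>] show False by simp
  qed
  then have "f z \<in> strip" using pi_gt_zero by (auto simp: strip_def)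
  moreover have "norm (u (f z)) < 1" using z by (intro norm_u_f_less) (auto simp: cpetal_def)
  ultimately show ?thesis by (simp add: petal_def)
qed

lemma f_petal: "z \<in> petal \<Longrightarrow> f z \<in> petal"
  using f_cpetal petal_subset_cpetal by blast

lemma iter_petal: "z \<in> petal \<Longrightarrow> (f ^^ k) z \<in> petal"
  by (induction k) (auto intro: f_petal)

text \<open>All summands of \<open>f z - z\<close> have nonnegative real part; the first is
  \<open>exp (- z)\<close>, and membership in the closed petal means
  \<open>cos (Im z) >= exp (- Re z) / 2\<close>.\<close>

lemma Re_f_cpetal:
  assumes z: "z \<in> cpetal"
  shows "Re (f z) \<ge> Re z + exp (- 2 * Re z) / 2"
proof -
  have u1: "norm (u z) \<le> 1" using z by (simp add: cpetal_def)
  have nonneg: "Re ((1 - u z ^ k) / of_nat k) \<ge> 0" for k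
  proof -
    have "Re (u z ^ k) \<le> norm (u z ^ k)" by (rule complex_Re_le_cmod)
    also have "\<dots> \<le> 1" using u1 by (simp add: norm_power power_le_one)
    finally show ?thesis by (simp add: Re_divide_of_nat)
  qed
  have "Re (f z) = Re z + (\<Sum>k=1..n. Re ((1 - u z ^ k) / of_nat k))"
    by (simp add: f_eq u_def)
  also have "(\<Sum>k=1..n. Re ((1 - u z ^ k) / of_nat k)) = Re ((1 - u z ^ 1) / of_nat 1) + (\<Sum>k\<in>{1..n}-{1}. Re ((1 - u z ^ k) / of_nat k))"
    using n_pos by (subst sum.remove[of _ 1]) auto
  also have "Re ((1 - u z ^ 1) / of_nat 1) = exp (- Re z) * cos (Im z)"
    by (simp add: u_def Re_exp)
  finally have "Re (f z) \<ge> Re z + exp (- Re z) * cos (Im z)"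
    using nonneg by (simp add: sum_nonneg)
  moreover have "exp (- Re z) * cos (Im z) \<ge> exp (- Re z) * (exp (- Re z) / 2)"
    using z by (intro mult_left_mono) (auto simp: cpetal_def norm_u_le_1_iff)
  moreover have "exp (- Re z) * exp (- Re z) = exp (- 2 * Re z)" by (simp flip: exp_add)
  ultimately show ?thesis by simp
qed

lemma norm_f_minus_id_cpetal:
  assumes z: "z \<in> cpetal"
  shows "norm (f z - z) \<le> 2 * crit_val"
proof -
  have u1: "norm (u z) \<le> 1" using z by (simp add: cpetal_def)
  have "norm (f z - z) \<le> (\<Sum>k=1..n. 2 / real k)"
    unfolding f_eq u_def[symmetric] add_diff_cancel_left'
  proof (rule sum_norm_le)
    fix k
    have "norm (1 - u z ^ k) \<le> 1 + norm (u z) ^ k" by (metis norm_one norm_power norm_triangle_ineq4)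
    also have "\<dots> \<le> 2" using u1 by (simp add: power_le_one)
    finally show "norm ((1 - u z ^ k) / of_nat k) \<le> 2 / real k"
      by (simp add: norm_divide divide_right_mono)
  qed
  then show ?thesis by (simp add: crit_val_def sum_distrib_left)
qed

lemma uniform_escape_petal:
  "\<exists>N. \<forall>k\<ge>N. \<forall>z\<in>petal. Re ((f ^^ k) z) > M"
proof -
  \<comment> \<open>The petal lies to the right of \<open>- ln 2\<close>, every step below
    \<open>M + 1\<close> gains at least \<open>\<delta>\<close>, and no step moves to the
    left.\<close>
  define \<delta> where "\<delta> = exp (- 2 * (M + 1)) / 2"
  have \<delta>: "\<delta> > 0" by (simp add: \<delta>_def)
  have step: "Re ((f ^^ k) z) \<ge> min (M + 1) (- ln 2 + real k * \<delta>)" if z: "z \<in> petal" for z k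
  proof (induction k)
    case 0
    then show ?case using cpetal_cos_pos(3)[of z] z petal_subset_cpetal by auto
  next
    case (Suc k)
    let ?z = "(f ^^ k) z"
    have "?z \<in> cpetal" using iter_petal[OF z] petal_subset_cpetal by blast
    then have *: "Re (f ?z) \<ge> Re ?z + exp (- 2 * Re ?z) / 2" by (rule Re_f_cpetal)
    show ?case
    proof (cases "Re ?z \<ge> M + 1")
      case True
      then have "Re (f ?z) \<ge> M + 1" using * exp_gt_zero[of "- 2 * Re ?z"] by linarith
      then show ?thesis by simp
    next
      case False
      then have "exp (- 2 * Re ?z) / 2 \<ge> \<delta>" by (simp add: \<delta>_def)
      then have "Re (f ?z) \<ge> - ln 2 + real k * \<delta> + \<delta>" using * Suc False by linarith
      then show ?thesis by (simp add: algebra_simps)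
    qed
  qed
  obtain N :: nat where "real N * \<delta> > M + 1 + ln 2"
    using reals_Archimedean3[OF \<delta>] by blast
  then have "Re ((f ^^ k) z) > M" if "k \<ge> N" "z \<in> petal" for k z
  proof -
    have "real N * \<delta> \<le> real k * \<delta>" using that(1) \<delta> by (intro mult_right_mono) auto
    then show ?thesis using step[OF that(2), of k] \<open>real N * \<delta> > M + 1 + ln 2\<close> by linarith
  qed
  then show ?thesis by blast
qed

lemma u_conformal_petal: "conformal_onto u petal unit_disc"
  unfolding conformal_onto_def
proof
  show "u holomorphic_on petal" by (rule u_holomorphic[OF holomorphic_on_id, unfolded id_def])
  have one: "1 - p \<notin> \<real>\<^sub>\<le>\<^sub>0" if "p \<in> unit_disc" for p
    using that complex_Re_le_cmod[of p] by (auto simp: complex_nonpos_Reals_iff)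
  show "bij_betw u petal unit_disc"
  proof (rule bij_betw_byWitness[where f' = "\<lambda>p. - Ln (1 - p)"])
    show "\<forall>z\<in>petal. - Ln (1 - u z) = z"
      using exp_strip_not_nonpos(2) by (auto simp: petal_def u_def)
    have up: "u (- Ln (1 - p)) = p" if "p \<in> unit_disc" for p
    proof -
      have "1 - p \<noteq> 0" using one[OF that] by auto
      then show ?thesis by (simp add: u_def)
    qed
    then show "\<forall>p\<in>unit_disc. u (- Ln (1 - p)) = p" by blast
    show "(\<lambda>p. - Ln (1 - p)) ` unit_disc \<subseteq> petal"
    proof clarify
      fix p :: complex assume p: "p \<in> unit_disc"
      have "Im (Ln (1 - p)) < pi" "- pi < Im (Ln (1 - p))"
      proof -
        have "1 - p \<noteq> 0" using one[OF p] by auto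
        then show "- pi < Im (Ln (1 - p))" by (simp add: mpi_less_Im_Ln)
        have "Im (Ln (1 - p)) \<noteq> pi"
          using one[OF p] \<open>1 - p \<noteq> 0\<close> by (auto simp: Im_Ln_eq_pi complex_nonpos_Reals_iff)
        then show "Im (Ln (1 - p)) < pi" using Im_Ln_le_pi[OF \<open>1 - p \<noteq> 0\<close>] by simp
      qed
      then have "- Ln (1 - p) \<in> strip" by (auto simp: strip_def)
      then show "- Ln (1 - p) \<in> petal" using p up[OF p] by (simp add: petal_def)
    qed
  qed (auto simp: petal_def)
qed

lemma open_petal: "open petal" and simply_connected_petal: "simply_connected petal"
proof -
  have eq: "petal = strip \<inter> {z. norm (u z) < 1}" by (auto simp: petal_def)
  show op: "open petal"
    unfolding eq by (intro open_Int open_strip open_Collect_less continuous_intros)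
  have "conformal_onto (inv_into petal u) unit_disc petal"
    by (rule conformal_onto_inv_into[OF op u_conformal_petal])
  then show "simply_connected petal"
    by (rule conformal_onto_simply_connected) (auto simp: convex_imp_simply_connected)
qed

lemma of_real_in_petal: "x \<ge> 0 \<Longrightarrow> of_real x \<in> petal"
proof -
  assume "x \<ge> 0"
  then have "\<bar>1 - exp (- x)\<bar> < 1" by (auto simp: abs_less_iff)
  then show ?thesis unfolding petal_def by (simp only: mem_Collect_eq u_of_real norm_of_real of_real_in_strip)
qed

text \<open>
  The critical value is the only branch value of \<open>f\<close> in the strip, so \<open>\<zeta>\<close> lifts a Riemann map
  of a domain containing it to a Riemann map of the preimage.
\<close>

lemma pullback_conformal:
  assumes W: "W \<subseteq> strip" "open W" and A: "conformal_onto A W unit_disc"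
    and \<sigma>: "\<sigma> holomorphic_on W" "\<And>v. v \<in> W \<Longrightarrow> \<sigma> v \<noteq> 0"
      "\<And>v. v \<in> W \<Longrightarrow> A v = (v - of_real crit_val) * \<sigma> v ^ Suc n"
  shows "conformal_onto (\<lambda>z. \<zeta> z * \<sigma> (f z)) (strip \<inter> f -` W) unit_disc"
    and "conformal_onto \<zeta> (strip \<inter> f -` W) {v. of_real crit_val + v ^ Suc n \<in> W}"
proof -
  have sub: "strip \<inter> f -` W \<subseteq> strip1" using W by (auto simp: strip1_def)
  have \<zeta>f: "of_real crit_val + \<zeta> z ^ Suc n = f z" if "z \<in> strip" for z
    using \<zeta>_power[OF that] by simp
  have "\<zeta> ` (strip \<inter> f -` W) = {v. of_real crit_val + v ^ Suc n \<in> W}"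
  proof
    show "\<zeta> ` (strip \<inter> f -` W) \<subseteq> {v. of_real crit_val + v ^ Suc n \<in> W}"
      using \<zeta>f by auto
    show "{v. of_real crit_val + v ^ Suc n \<in> W} \<subseteq> \<zeta> ` (strip \<inter> f -` W)"
    proof
      fix v assume v: "v \<in> {v. of_real crit_val + v ^ Suc n \<in> W}"
      then have "v \<in> T" using W by (auto simp: T_def)
      then obtain z where z: "z \<in> strip1" "v = \<zeta> z"
        using \<zeta>_conformal by (auto simp: conformal_onto_def bij_betw_def)
      then have "z \<in> strip" by (simp add: strip1_def)
      moreover have "f z \<in> W" using v \<zeta>f[OF \<open>z \<in> strip\<close>] z(2) by simp
      ultimately show "v \<in> \<zeta> ` (strip \<inter> f -` W)" using z(2) by blast
    qed
  qed
  moreover have "inj_on \<zeta> (strip \<inter> f -` W)"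
    using \<zeta>_conformal sub by (auto simp: conformal_onto_def bij_betw_def intro: inj_on_subset)
  ultimately show c: "conformal_onto \<zeta> (strip \<inter> f -` W) {v. of_real crit_val + v ^ Suc n \<in> W}"
    using holomorphic_on_subset[OF \<zeta>_holomorphic_strip1 sub]
    by (simp add: conformal_onto_def bij_betw_def)
  have "conformal_onto ((\<lambda>v. v * \<sigma> (of_real crit_val + v ^ Suc n)) \<circ> \<zeta>) (strip \<inter> f -` W) unit_disc"
    using conformal_onto_comp[OF c conformal_onto_power_preimage[OF A W(2) _ \<sigma>]] by simp
  moreover have "((\<lambda>v. v * \<sigma> (of_real crit_val + v ^ Suc n)) \<circ> \<zeta>) z = \<zeta> z * \<sigma> (f z)"
    if "z \<in> strip \<inter> f -` W" for z
    using \<zeta>f that by simp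
  ultimately show "conformal_onto (\<lambda>z. \<zeta> z * \<sigma> (f z)) (strip \<inter> f -` W) unit_disc"
    unfolding conformal_onto_def
    by (metis (no_types, lifting) bij_betw_cong holomorphic_transform)
qed

lemma pullback_simply_connected:
  assumes W: "W \<subseteq> strip" "open W" "simply_connected W" "of_real crit_val \<in> W"
  shows "open (strip \<inter> f -` W)" and "simply_connected (strip \<inter> f -` W)"
proof -
  show op: "open (strip \<inter> f -` W)"
    by (intro open_Int open_strip open_vimage W f_continuous)
  have "W \<noteq> UNIV"
  proof
    assume "W = UNIV"
    then have "\<i> * of_real pi \<in> strip" using W by auto
    then show False by (simp add: strip_def)
  qed
  then obtain A where A: "conformal_onto A W unit_disc" "A (of_real crit_val) = 0"
    using Riemann_map_centered[OF W(2,3) _ W(4)] by blast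
  obtain \<sigma> where "\<sigma> holomorphic_on W" "\<And>v. v \<in> W \<Longrightarrow> \<sigma> v \<noteq> 0"
      "\<And>v. v \<in> W \<Longrightarrow> A v = (v - of_real crit_val) * \<sigma> v ^ Suc n"
    using conformal_onto_zero_factor[OF W(2,3) A(1) W(4) A(2), of "Suc n"] by blast
  then have "conformal_onto (\<lambda>z. \<zeta> z * \<sigma> (f z)) (strip \<inter> f -` W) unit_disc"
    by (rule pullback_conformal(1)[OF W(1,2) A(1)])
  then have "conformal_onto (inv_into (strip \<inter> f -` W) (\<lambda>z. \<zeta> z * \<sigma> (f z))) unit_disc (strip \<inter> f -` W)"
    by (rule conformal_onto_inv_into[OF op])
  then show "simply_connected (strip \<inter> f -` W)"
    by (rule conformal_onto_simply_connected) (auto simp: convex_imp_simply_connected)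
qed

section \<open>The basin as an increasing union of pullbacks\<close>

primrec pre_petal :: "nat \<Rightarrow> complex set" where
  "pre_petal 0 = petal"
| "pre_petal (Suc k) = strip \<inter> f -` pre_petal k"

text \<open>Preimages are taken within the strip at every stage, so each stage is one pullback
  through the conformal map \<open>\<zeta>\<close>, and the basin is completely invariant relative
  to the strip.\<close>

definition basin :: "complex set" where
  "basin = (\<Union>k. pre_petal k)"

lemma pre_petal_subset_strip: "pre_petal k \<subseteq> strip"
  by (cases k) (auto simp: petal_def)

lemma pre_petal_Suc: "pre_petal k \<subseteq> pre_petal (Suc k)"
  by (induction k) (use f_petal in \<open>auto simp: petal_def\<close>)

lemma incseq_pre_petal: "incseq pre_petal"
  by (intro incseq_SucI pre_petal_Suc)

lemma petal_subset_pre_petal: "petal \<subseteq> pre_petal k"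
  using incseq_pre_petal pre_petal.simps(1) by (metis incseq_def zero_le)

lemma pre_petal_topology: "open (pre_petal k) \<and> simply_connected (pre_petal k)"
proof (induction k)
  case (Suc k)
  have "of_real crit_val \<in> pre_petal k"
    using petal_subset_pre_petal of_real_in_petal crit_val_pos by (meson less_imp_le subsetD)
  then show ?case using pullback_simply_connected[OF pre_petal_subset_strip] Suc by simp
qed (simp add: open_petal simply_connected_petal)

lemma open_basin: "open basin" and simply_connected_basin: "simply_connected basin"
  unfolding basin_def
  using pre_petal_topology incseq_pre_petal by (auto intro: simply_connected_incseq_UN)

lemma connected_basin: "connected basin"
  using simply_connected_basin by (rule simply_connected_imp_connected)

lemma basin_subset_strip: "basin \<subseteq> strip"
  using pre_petal_subset_strip by (auto simp: basin_def)

lemma petal_subset_basin: "petal \<subseteq> basin"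
  using petal_subset_pre_petal by (auto simp: basin_def)

lemma of_real_in_basin: "x \<ge> 0 \<Longrightarrow> of_real x \<in> basin"
  using of_real_in_petal petal_subset_basin by blast

lemma f_in_basin_iff:
  assumes "z \<in> strip"
  shows "f z \<in> basin \<longleftrightarrow> z \<in> basin"
proof
  assume "f z \<in> basin"
  then obtain k where "f z \<in> pre_petal k" by (auto simp: basin_def)
  then have "z \<in> pre_petal (Suc k)" using assms by simp
  then show "z \<in> basin" unfolding basin_def by blast
next
  assume "z \<in> basin"
  then obtain k where "z \<in> pre_petal k" by (auto simp: basin_def)
  then have "z \<in> pre_petal (Suc k)" using pre_petal_Suc by blast
  then show "f z \<in> basin" by (auto simp: basin_def)
qed

lemma basin_eq_pullback: "strip \<inter> f -` basin = basin"
  using f_in_basin_iff basin_subset_strip by auto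

lemma iter_basin: "z \<in> basin \<Longrightarrow> (f ^^ k) z \<in> basin"
  by (induction k) (use f_in_basin_iff basin_subset_strip in auto)

lemma cpetal_subset_basin: "cpetal \<subseteq> basin"
proof
  fix z assume z: "z \<in> cpetal"
  then have "f z \<in> basin" using f_cpetal petal_subset_basin by blast
  then show "z \<in> basin" using z f_in_basin_iff[of z] by (simp add: cpetal_def)
qed

lemma iter_pre_petal: "z \<in> pre_petal k \<Longrightarrow> (f ^^ k) z \<in> petal"
proof (induction k arbitrary: z)
  case (Suc k)
  then show ?case by (simp only: funpow_Suc_right o_def) auto
qed simp

lemma in_basin_if_iter:
  assumes "\<And>j. j < k \<Longrightarrow> (f ^^ j) z \<in> strip" and "(f ^^ k) z \<in> basin"
  shows "z \<in> basin"
  using assms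
proof (induction k)
  case (Suc k)
  then have "(f ^^ k) z \<in> basin" using f_in_basin_iff[of "(f ^^ k) z"] by simp
  then show ?case using Suc by simp
qed simp

lemma eventually_petal_on_compact:
  assumes X: "compact X" "X \<subseteq> basin"
  shows "\<forall>\<^sub>F k in sequentially. \<forall>z\<in>X. (f ^^ k) z \<in> petal \<and> Re ((f ^^ k) z) > M"
proof -
  obtain F where F: "finite F" "X \<subseteq> (\<Union>k\<in>F. pre_petal k)"
    using compactE_image[OF X(1), of UNIV pre_petal] pre_petal_topology X(2) unfolding basin_def by metis
  obtain m where "\<And>k. k \<in> F \<Longrightarrow> k \<le> m"
    using F(1) by (meson finite_nat_set_iff_bounded_le)
  then have "(\<Union>k\<in>F. pre_petal k) \<subseteq> pre_petal m"
    using incseq_pre_petal by (auto simp: incseq_def)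
  then have Xm: "(f ^^ m) z \<in> petal" if "z \<in> X" for z
    using that F(2) iter_pre_petal by blast
  obtain N where N: "\<And>k z. k \<ge> N \<Longrightarrow> z \<in> petal \<Longrightarrow> Re ((f ^^ k) z) > M"
    using uniform_escape_petal by blast
  have "(f ^^ k) z \<in> petal \<and> Re ((f ^^ k) z) > M" if "k \<ge> N + m" "z \<in> X" for k z
  proof -
    have "(f ^^ k) z = (f ^^ (k - m)) ((f ^^ m) z)"
      using that(1) by (simp flip: funpow_add comp_apply[of "f ^^ (k - m)"])
    then show ?thesis using N[of "k - m" "(f ^^ m) z"] Xm[OF that(2)] iter_petal that by simp
  qed
  then show ?thesis unfolding eventually_sequentially by blast
qed

text \<open>The Fatou coordinate of the parabolic point, to first order, is \<open>exp z\<close>.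
  With \<open>f z = z + Q w\<close> and \<open>w = exp (- z)\<close>, the increment of
  \<open>exp z\<close> is \<open>(exp (Q w) - 1) / w\<close>, which tends to
  \<open>Q' 0 = n\<close>.\<close>

lemma f_asymptotic:
  "\<exists>M. \<forall>z. Re z > M \<longrightarrow> norm (exp (f z) - exp z - of_nat n) \<le> real n / 4"
  and f_minus_id_small: "\<epsilon> > 0 \<Longrightarrow> \<exists>M. \<forall>z. Re z > M \<longrightarrow> norm (f z - z) < \<epsilon>"
proof -
  define Q where "Q = (\<lambda>w::complex. \<Sum>k=1..n. (1 - (1 - w) ^ k) / of_nat k)"
  have fQ: "f z = z + Q (exp (- z))" for z by (simp add: f_eq Q_def)
  have Q0: "Q 0 = 0" by (simp add: Q_def)
  have "((\<lambda>w. (1 - (1 - w) ^ k) / of_nat k) has_field_derivative 1) (at (0::complex))" if "k \<in> {1..n}" for k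
  proof -
    have "((\<lambda>w. (1 - (1 - w) ^ k) / of_nat k) has_field_derivative of_nat k / of_nat k) (at (0::complex))"
      by (auto intro!: derivative_eq_intros)
    then show ?thesis using that by simp
  qed
  then have "(Q has_field_derivative (\<Sum>k=1..n. 1)) (at 0)"
    unfolding Q_def by (intro DERIV_sum)
  then have dQ: "(Q has_field_derivative of_nat n) (at 0)" by simp
  then have "((\<lambda>w. exp (Q w)) has_field_derivative exp (Q 0) * of_nat n) (at 0)"
    by (rule DERIV_fun_exp)
  then have "((\<lambda>w. (exp (Q w) - 1) / w) \<longlongrightarrow> of_nat n) (at 0)"
    by (simp add: has_field_derivative_iff Q0)
  from tendstoD[OF this, of "real n / 4"] obtain \<delta> where \<delta>: "\<delta> > 0"
      "\<And>w. w \<noteq> 0 \<Longrightarrow> norm w < \<delta> \<Longrightarrow> norm ((exp (Q w) - 1) / w - of_nat n) < real n / 4"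
    using n_pos by (auto simp: eventually_at dist_norm)
  have small: "norm (exp (- z)) < \<delta>" if "Re z > - ln \<delta>" "\<delta> > 0" for z :: complex and \<delta>
  proof -
    have "exp (- Re z) < exp (ln \<delta>)" using that(1) by simp
    then show ?thesis using that(2) by simp
  qed
  have "norm (exp (f z) - exp z - of_nat n) \<le> real n / 4" if "Re z > - ln \<delta>" for z
  proof -
    have "exp (f z) - exp z = (exp (Q (exp (- z))) - 1) / exp (- z)"
      unfolding fQ exp_add by (simp add: exp_minus field_simps)
    then show ?thesis using \<delta>(2)[of "exp (- z)"] small[OF that \<delta>(1)] by simp
  qed
  then show "\<exists>M. \<forall>z. Re z > M \<longrightarrow> norm (exp (f z) - exp z - of_nat n) \<le> real n / 4" by blast
  assume "\<epsilon> > 0"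
  have "isCont Q 0" using dQ by (rule DERIV_isCont)
  then obtain \<eta> where \<eta>: "\<eta> > 0" "\<And>w. norm w < \<eta> \<Longrightarrow> norm (Q w) < \<epsilon>"
    using \<open>\<epsilon> > 0\<close> unfolding continuous_at_eps_delta by (auto simp: Q0 dist_norm)
  have "norm (f z - z) < \<epsilon>" if "Re z > - ln \<eta>" for z
    using \<eta>(2)[OF small[OF that \<eta>(1)]] by (simp add: fQ)
  then show "\<exists>M. \<forall>z. Re z > M \<longrightarrow> norm (f z - z) < \<epsilon>" by blast
qed

definition far :: "real \<Rightarrow> bool" where
  "far M \<longleftrightarrow> (\<forall>z. Re z > M \<longrightarrow> norm (exp (f z) - exp z - of_nat n) \<le> real n / 4 \<and> norm (f z - z) < 1 / 4)"

lemma far_exists: "\<exists>M\<ge>0. far M"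
proof -
  obtain M1 M2 where "\<And>z. Re z > M1 \<Longrightarrow> norm (exp (f z) - exp z - of_nat n) \<le> real n / 4"
      "\<And>z. Re z > M2 \<Longrightarrow> norm (f z - z) < 1 / 4"
    using f_asymptotic f_minus_id_small[of "1/4"] by auto
  then have "far (max 0 (max M1 M2))" by (auto simp: far_def)
  then show ?thesis by (intro exI[of _ "max 0 (max M1 M2)"]) simp
qed

lemma far_step:
  assumes "far M" "Re z > M"
  shows "Re (exp (f z)) \<ge> Re (exp z) + 3 * real n / 4"
    and "\<bar>Im (exp (f z))\<bar> \<ge> \<bar>Im (exp z)\<bar> - real n / 4"
proof -
  have *: "norm (exp (f z) - exp z - of_nat n) \<le> real n / 4" using assms by (auto simp: far_def)
  have "\<bar>Re (exp (f z) - exp z - of_nat n)\<bar> \<le> real n / 4"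
    using abs_Re_le_cmod order_trans * by blast
  then show "Re (exp (f z)) \<ge> Re (exp z) + 3 * real n / 4"
    by (simp only: minus_complex.sel complex_Re_of_nat abs_le_iff) linarith
  have "\<bar>Im (exp (f z) - exp z - of_nat n)\<bar> \<le> real n / 4"
    using abs_Im_le_cmod order_trans * by blast
  then show "\<bar>Im (exp (f z))\<bar> \<ge> \<bar>Im (exp z)\<bar> - real n / 4"
    by (simp only: minus_complex.sel complex_Im_of_nat)
qed

text \<open>With \<open>W = exp z\<close> one has \<open>u z = (W - 1) / W\<close>, so the petal is
  the half-plane \<open>Re W > 1 / 2\<close>.\<close>

lemma in_petal_if_Re_exp:
  assumes "z \<in> strip" "Re (exp z) > 1 / 2"
  shows "z \<in> petal"
proof -
  define W where "W = exp z"
  have "(norm (W - 1))\<^sup>2 < (norm W)\<^sup>2"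
    unfolding cmod_power2 using assms(2) by (simp add: W_def power2_eq_square algebra_simps)
  then have "norm (W - 1) < norm W" by (metis norm_ge_zero power_less_imp_less_base)
  moreover have "u z = (W - 1) / W" by (simp add: u_def W_def exp_minus field_simps)
  ultimately have "norm (u z) < 1" by (simp add: norm_divide W_def)
  with assms(1) show ?thesis by (simp add: petal_def)
qed

text \<open>Each step far to the right adds at least \<open>3 * n / 4\<close> to
  \<open>Re (exp z)\<close>, so the orbit reaches the petal.\<close>

lemma in_basin_if_far_orbit:
  assumes M: "far M" and orbit: "\<And>j. (f ^^ j) z \<in> strip" "\<And>j. Re ((f ^^ j) z) > M"
  shows "z \<in> basin"
proof -
  have step: "Re (exp ((f ^^ j) z)) \<ge> Re (exp z) + real j * (3 * real n / 4)" for j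
  proof (induction j)
    case (Suc j)
    have "real (Suc j) * (3 * real n / 4) = real j * (3 * real n / 4) + 3 * real n / 4"
      by (simp add: field_simps)
    then show ?case using far_step(1)[OF M orbit(2)[of j]] Suc
      by (simp only: funpow.simps o_apply)
  qed simp
  have "3 * real n / 4 > 0" using n_pos by simp
  then obtain j where "real j * (3 * real n / 4) > 1 / 2 - Re (exp z)"
    using reals_Archimedean3 by blast
  then have "Re (exp ((f ^^ j) z)) > 1 / 2" using step[of j] by linarith
  then have "(f ^^ j) z \<in> basin"
    using in_petal_if_Re_exp orbit(1) petal_subset_basin by blast
  then show ?thesis using in_basin_if_iter[of j z] orbit(1) by blast
qed

text \<open>The region is forward invariant: in the coordinate \<open>exp z\<close> the real part
  gains at least \<open>3 * n / 4\<close>, while the modulus of the imaginary part loses at most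
  \<open>n / 4\<close>. Its points satisfy \<open>|Im z| < 3 * pi / 4\<close>, so a step shorter
  than 1/4 stays in the strip.\<close>

lemma sector_subset_basin:
  "\<exists>C>0. \<forall>z\<in>strip. Re (exp z) + \<bar>Im (exp z)\<bar> > C \<longrightarrow> z \<in> basin"
proof -
  obtain M where M: "M \<ge> 0" "far M" using far_exists by blast
  \<comment> \<open>\<open>Re W + |Im W|\<close> is at most \<open>2 * |W|\<close>, so exceeding
    \<open>2 * exp M\<close> forces \<open>Re z > M\<close>.\<close>
  define C where "C = 2 * exp M"
  have ReM: "Re z > M" if "Re (exp z) + \<bar>Im (exp z)\<bar> > C" for z
  proof -
    have "C < 2 * norm (exp z)" using that abs_Re_le_cmod[of "exp z"] abs_Im_le_cmod[of "exp z"] by linarith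
    then show ?thesis by (simp add: C_def)
  qed
  have inv: "f z \<in> strip \<and> Re (exp (f z)) + \<bar>Im (exp (f z))\<bar> > C"
    if z: "z \<in> strip" "Re (exp z) + \<bar>Im (exp z)\<bar> > C" for z
  proof
    have "exp (Re z) * (cos (Im z) + \<bar>sin (Im z)\<bar>) > 0"
      using z(2) exp_gt_zero[of M] by (simp add: C_def Re_exp Im_exp abs_mult algebra_simps) (smt (verit) exp_gt_zero)
    then have "cos (Im z) + \<bar>sin (Im z)\<bar> > 0" by (simp add: zero_less_mult_iff)
    then have "\<bar>Im z\<bar> < 3 * pi / 4"
      using z(1) by (intro cos_plus_abs_sin_pos) (auto simp: strip_def)
    moreover have "norm (f z - z) < 1/4" using M(2) ReM[OF z(2)] by (auto simp: far_def)
    then have "\<bar>Im (f z) - Im z\<bar> < 1/4" using abs_Im_le_cmod[of "f z - z"] by simp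
    ultimately show "f z \<in> strip" using pi_gt3 unfolding strip_def mem_Collect_eq by linarith
    show "Re (exp (f z)) + \<bar>Im (exp (f z))\<bar> > C"
      using far_step[OF M(2) ReM[OF z(2)]] z(2) by linarith
  qed
  have "z \<in> basin" if z: "z \<in> strip" "Re (exp z) + \<bar>Im (exp z)\<bar> > C" for z
  proof -
    have *: "(f ^^ j) z \<in> strip \<and> Re (exp ((f ^^ j) z)) + \<bar>Im (exp ((f ^^ j) z))\<bar> > C" for j
      by (induction j) (use z inv in auto)
    show ?thesis by (rule in_basin_if_far_orbit[OF M(2)]) (use * ReM in blast)+
  qed
  moreover have "C > 0" by (simp add: C_def)
  ultimately show ?thesis by blast
qed

text \<open>The set where \<open>f\<close> does not expand keeps a uniform distance from the
  frontier of the basin. On the bounded part this is compactness. To the right, a small shift of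
  \<open>z\<close> changes \<open>W = exp z\<close> by at most \<open>|W| / 4\<close>, and
  \<open>Re W + |Im W| >= |W|\<close> on the closed petal, so at least half of \<open>|W|\<close>
  remains and exceeds \<open>C\<close>.\<close>

lemma cpetal_margin: "\<exists>r>0. \<forall>z\<in>cpetal. ball z r \<subseteq> basin"
proof -
  obtain C where C: "C > 0" "\<And>z. z \<in> strip \<Longrightarrow> Re (exp z) + \<bar>Im (exp z)\<bar> > C \<Longrightarrow> z \<in> basin"
    using sector_subset_basin by blast
  define L where "L = ln (2 * C)"
  define Kc where "Kc = {z. \<bar>Im z\<bar> \<le> pi / 2 \<and> norm (u z) \<le> 1 \<and> \<bar>Re z\<bar> \<le> max 1 L}"
  have "closed Kc"
    unfolding Kc_def by (intro closed_Collect_conj closed_Collect_le continuous_intros)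
  moreover have "bounded Kc"
  proof -
    have "norm z \<le> max 1 L + pi / 2" if "z \<in> Kc" for z
      using cmod_le[of z] that by (auto simp: Kc_def)
    then show ?thesis by (auto simp: bounded_iff)
  qed
  ultimately have "compact Kc" by (simp add: compact_eq_bounded_closed)
  moreover have "Kc \<subseteq> basin"
  proof
    fix z assume "z \<in> Kc"
    moreover have "\<bar>y\<bar> < pi" if "\<bar>y\<bar> \<le> pi / 2" for y using that pi_gt_zero by linarith
    ultimately have "z \<in> cpetal" by (auto simp: Kc_def cpetal_def strip_def)
    then show "z \<in> basin" using cpetal_subset_basin by blast
  qed
  ultimately obtain r1 where r1: "r1 > 0" "\<And>z. z \<in> Kc \<Longrightarrow> ball z r1 \<subseteq> basin"
    using compact_subset_open_imp_ball_epsilon_subset[OF _ open_basin] by (metis UN_subset_iff)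
  have "isCont exp (0::complex)" by (rule isCont_exp)
  then obtain r2 where r2: "r2 > 0" "\<And>w::complex. norm w < r2 \<Longrightarrow> norm (exp w - 1) < 1 / 4"
    unfolding continuous_at_eps_delta dist_norm by (metis diff_zero exp_zero zero_less_divide_1_iff zero_less_numeral)
  define r where "r = min (min r1 r2) 1"
  have "ball z r \<subseteq> basin" if z: "z \<in> cpetal" for z
  proof (cases "Re z \<le> L")
    case True
    have "ln 2 \<le> (1::real)" using ln_2_less_1 by simp
    then have "z \<in> Kc"
      using z True cpetal_cos_pos[OF z] by (auto simp: Kc_def cpetal_def abs_le_iff)
    then show ?thesis using r1(2)[of z] by (auto simp: r_def)
  next
    case False
    show ?thesis
    proof
      fix z' assume z': "z' \<in> ball z r"
      define \<delta> where "\<delta> = z' - z"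
      have \<delta>: "norm \<delta> < r2" "norm \<delta> < 1" using z' by (auto simp: \<delta>_def r_def dist_norm norm_minus_commute)
      have "\<bar>Im z' - Im z\<bar> < 1" using \<delta>(2) abs_Im_le_cmod[of \<delta>] by (simp add: \<delta>_def)
      then have strip': "z' \<in> strip" using cpetal_cos_pos(2)[OF z] pi_gt3 by (auto simp: strip_def)
      have W: "exp z' - exp z = exp z * (exp \<delta> - 1)" by (simp add: \<delta>_def exp_diff algebra_simps)
      have "norm (exp z' - exp z) = norm (exp z) * norm (exp \<delta> - 1)"
        unfolding W norm_mult ..
      also have "\<dots> \<le> norm (exp z) * (1 / 4)" using r2(2)[OF \<delta>(1)] by (intro mult_left_mono) auto
      finally have d: "norm (exp z' - exp z) \<le> norm (exp z) * (1 / 4)" .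
      have "\<bar>Re (exp z' - exp z)\<bar> \<le> norm (exp z) * (1 / 4)" "\<bar>Im (exp z' - exp z)\<bar> \<le> norm (exp z) * (1 / 4)"
        using d abs_Re_le_cmod abs_Im_le_cmod order_trans by blast+
      then have "Re (exp z') \<ge> Re (exp z) - norm (exp z) * (1 / 4)"
        "\<bar>Im (exp z')\<bar> \<ge> \<bar>Im (exp z)\<bar> - norm (exp z) * (1 / 4)"
        unfolding minus_complex.sel abs_le_iff using abs_triangle_ineq2[of "Im (exp z)" "Im (exp z')"] by linarith+
      then have 1: "Re (exp z') + \<bar>Im (exp z')\<bar> \<ge> Re (exp z) + \<bar>Im (exp z)\<bar> - norm (exp z) * (1/2)"
        by linarith
      have "Re (exp z) \<ge> 0" using cpetal_cos_pos(1)[OF z] by (simp add: Re_exp)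
      then have 2: "Re (exp z) + \<bar>Im (exp z)\<bar> \<ge> norm (exp z)" using cmod_le[of "exp z"] by simp
      have "norm (exp z) > 2 * C"
      proof -
        have "exp L < exp (Re z)" using False by simp
        then show ?thesis using C(1) by (simp add: L_def)
      qed
      then have "Re (exp z') + \<bar>Im (exp z')\<bar> > C" using 1 2 by linarith
      then show "z' \<in> basin" using C(2) strip' by blast
    qed
  qed
  moreover have "r > 0" using r1 r2 by (simp add: r_def)
  ultimately show ?thesis by blast
qed

end

section \<open>The basin is a Fatou component\<close>

lemma strict_mono_subseq_cases:
  fixes \<kappa> :: "nat \<Rightarrow> nat"
  obtains (unbounded) s :: "nat \<Rightarrow> nat" where "strict_mono s" "filterlim (\<kappa> \<circ> s) at_top sequentially"
  | (const) s :: "nat \<Rightarrow> nat" and v where "strict_mono s" "\<And>i. \<kappa> (s i) = v"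
proof (cases "\<forall>N i. \<exists>i'>i. \<kappa> i' \<ge> N")
  case True
  have "\<exists>s. \<forall>i. \<kappa> (s i) \<ge> i \<and> s i < s (Suc i)"
    by (rule dependent_nat_choice) (use True in auto)
  then obtain s where s: "\<And>i. \<kappa> (s i) \<ge> i" "\<And>i. s i < s (Suc i)" by blast
  have "filterlim (\<kappa> \<circ> s) at_top sequentially"
    using s(1) by (intro filterlim_at_top_mono[OF filterlim_ident]) auto
  moreover have "strict_mono s" using s(2) by (simp add: strict_mono_Suc_iff)
  ultimately show thesis by (intro unbounded)
next
  case False
  then obtain N i0 where N: "\<And>i. i > i0 \<Longrightarrow> \<kappa> i < N" by (meson not_le)
  have "finite (\<kappa> ` {i0<..})"
    by (rule finite_subset[of _ "{..<N}"]) (use N in auto)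
  then obtain v where v: "infinite {i \<in> {i0<..}. \<kappa> i = \<kappa> v}"
    using pigeonhole_infinite[of "{i0<..}" \<kappa>] infinite_Ioi by blast
  have inf: "infinite {i. \<kappa> i = \<kappa> v}"
    by (rule infinite_super[OF _ v]) auto
  show thesis
  proof (rule const[of "enumerate {i. \<kappa> i = \<kappa> v}" "\<kappa> v"])
    show "strict_mono (enumerate {i. \<kappa> i = \<kappa> v})" using inf by (rule strict_mono_enumerate)
    show "\<kappa> (enumerate {i. \<kappa> i = \<kappa> v} i) = \<kappa> v" for i using enumerate_in_set[OF inf, of i] by simp
  qed
qed

lemma normal_family_on_iterates_to_infinity:
  assumes "locally_uniform_to_infinity V (\<lambda>k. f ^^ k)"
  shows "normal_family_on (range (\<lambda>k. f ^^ k)) V"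
  unfolding normal_family_on_def
proof (intro allI impI)
  fix g :: "nat \<Rightarrow> complex \<Rightarrow> complex" assume "range g \<subseteq> range (\<lambda>k. f ^^ k)"
  then have "\<exists>k. g i = f ^^ k" for i by auto
  then obtain \<kappa> where \<kappa>: "\<And>i. g i = f ^^ \<kappa> i" by metis
  show "\<exists>s. strict_mono s \<and> ((\<exists>h. locally_uniform_limit V (g \<circ> s) h) \<or> locally_uniform_to_infinity V (g \<circ> s))"
  proof (rule strict_mono_subseq_cases[of \<kappa>])
    fix s :: "nat \<Rightarrow> nat" assume unbounded: "strict_mono s" "filterlim (\<kappa> \<circ> s) at_top sequentially"
    have "locally_uniform_to_infinity V (g \<circ> s)"
      unfolding locally_uniform_to_infinity_def
    proof (intro allI impI)
      fix X M assume "compact X \<and> X \<subseteq> V"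
      then have "\<forall>\<^sub>F k in sequentially. \<forall>z\<in>X. norm ((f ^^ k) z) > M"
        using assms by (auto simp: locally_uniform_to_infinity_def)
      then show "\<forall>\<^sub>F k in sequentially. \<forall>z\<in>X. norm ((g \<circ> s) k z) > M"
        using unbounded(2) by (auto simp: \<kappa> filterlim_iff)
    qed
    then show ?thesis using unbounded(1) by blast
  next
    fix s :: "nat \<Rightarrow> nat" and v assume const: "strict_mono s" "\<And>i. \<kappa> (s i) = v"
    have "g \<circ> s = (\<lambda>_. f ^^ v)" using \<kappa> const(2) by auto
    then have "locally_uniform_limit V (g \<circ> s) (f ^^ v)"
      by (simp add: locally_uniform_limit_def uniform_limit_const)
    then show ?thesis using const(1) by blast
  qed
qed

text \<open>One escaping orbit excludes a finite limit for every subsequence of iterates, so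
  normality leaves only uniform divergence.\<close>

lemma normal_family_on_to_infinity:
  assumes normal: "normal_family_on (range (\<lambda>k. f ^^ k)) V" and c: "c \<in> V"
    and lim: "filterlim (\<lambda>k. (f ^^ k) c) at_infinity sequentially"
  shows "locally_uniform_to_infinity V (\<lambda>k. f ^^ k)"
  unfolding locally_uniform_to_infinity_def
proof (intro allI impI, rule ccontr)
  fix X M assume X: "compact X \<and> X \<subseteq> V" and "\<not> (\<forall>\<^sub>F k in sequentially. \<forall>z\<in>X. norm ((f ^^ k) z) > M)"
  then have "infinite {k. \<not> (\<forall>z\<in>X. norm ((f ^^ k) z) > M)}"
    by (simp add: cofinite_eq_sequentially[symmetric] eventually_cofinite)
  define s where "s = enumerate {k. \<not> (\<forall>z\<in>X. norm ((f ^^ k) z) > M)}"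
  have s: "strict_mono s" "\<And>i. \<not> (\<forall>z\<in>X. norm ((f ^^ s i) z) > M)"
    using \<open>infinite _\<close> enumerate_in_set[OF \<open>infinite _\<close>] by (auto simp: s_def strict_mono_enumerate)
  have "range (\<lambda>i. f ^^ s i) \<subseteq> range (\<lambda>k. f ^^ k)" by auto
  then obtain t where t: "strict_mono t"
      "(\<exists>h. locally_uniform_limit V ((\<lambda>i. f ^^ s i) \<circ> t) h) \<or> locally_uniform_to_infinity V ((\<lambda>i. f ^^ s i) \<circ> t)"
    using normal unfolding normal_family_on_def by blast
  have st: "filterlim (s \<circ> t) at_top sequentially"
    using s(1) t(1) by (intro filterlim_subseq strict_mono_o)
  from t(2) show False
  proof
    assume "\<exists>h. locally_uniform_limit V ((\<lambda>i. f ^^ s i) \<circ> t) h"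
    then obtain h where "locally_uniform_limit V ((\<lambda>i. f ^^ s i) \<circ> t) h" by blast
    then have "uniform_limit {c} ((\<lambda>i. f ^^ s i) \<circ> t) h sequentially"
      unfolding locally_uniform_limit_def using c by (metis compact_sing empty_subsetI insert_subset)
    then have "(\<lambda>i. ((\<lambda>i. f ^^ s i) \<circ> t) i c) \<longlonglongrightarrow> h c"
      by (rule tendsto_uniform_limitI) simp
    moreover have "filterlim (\<lambda>i. (f ^^ (s \<circ> t) i) c) at_infinity sequentially"
      by (rule filterlim_compose[OF lim st])
    ultimately show False
      using not_tendsto_and_filterlim_at_infinity[of sequentially] by (auto simp: o_def)
  next
    assume "locally_uniform_to_infinity V ((\<lambda>i. f ^^ s i) \<circ> t)"
    then have "\<forall>\<^sub>F k in sequentially. \<forall>z\<in>X. norm (((\<lambda>i. f ^^ s i) \<circ> t) k z) > M"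
      using X by (auto simp: locally_uniform_to_infinity_def)
    then obtain k where "\<forall>z\<in>X. norm (((\<lambda>i. f ^^ s i) \<circ> t) k z) > M"
      using eventually_happens'[OF sequentially_bot] by blast
    then show False using s(2)[of "t k"] by simp
  qed
qed

text \<open>The 9 is the constant of \<open>ln_norm_Harnack\<close>: the modulus at exponential rate
  outgrows the ninth power of the modulus at linear rate.\<close>

lemma exponential_not_le_power_linear:
  fixes A B :: real
  assumes "A \<ge> 1" "B \<ge> 0"
  shows "\<exists>j\<ge>j0. real j * ln 2 > 9 * ln (A + B * real j)"
proof -
  \<comment> \<open>Since \<open>x <= (A + B) * j\<close>, this gives
    \<open>1296 * x < j ^ 2\<close>, that is \<open>18 * sqrt x < j / 2\<close>; and
    \<open>9 * ln x\<close> is at most \<open>18 * sqrt x\<close>.\<close>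
  obtain j :: nat where "real j > max (real j0) (1296 * (A + B))"
    using reals_Archimedean2 by blast
  then have j: "real j > real j0" "real j > 1296 * (A + B)" by simp_all
  define x where "x = A + B * real j"
  have x: "x \<ge> 1" using assms by (simp add: x_def add_increasing2)
  have "ln x = 2 * ln (sqrt x)" using x by (simp add: ln_sqrt)
  also have "\<dots> \<le> 2 * sqrt x" using x ln_bound[of "sqrt x"] by simp
  finally have "9 * ln x \<le> 18 * sqrt x" by simp
  also have "\<dots> < real j / 2"
  proof -
    have "1296 * 1 \<le> 1296 * (A + B)" using assms by (intro mult_left_mono) auto
    then have j1: "real j \<ge> 1" using j(2) by simp
    have "1296 * x \<le> 1296 * (A * real j + B * real j)"
      using assms j1 by (simp add: x_def mult_left_le)
    also have "\<dots> = (1296 * (A + B)) * real j" by (simp add: algebra_simps)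
    also have "\<dots> < real j * real j" using j j1 by (intro mult_strict_right_mono) auto
    finally have "1296 * x < (real j)\<^sup>2" by (simp add: power2_eq_square)
    then have "sqrt (1296 * x) < real j" using real_sqrt_less_mono real_sqrt_abs by fastforce
    moreover have "sqrt (1296 * x) = 36 * sqrt x"
    proof -
      have "sqrt 1296 = (36::real)" by (rule real_sqrt_unique) auto
      then show ?thesis by (simp add: real_sqrt_mult)
    qed
    ultimately show ?thesis by simp
  qed
  also have "\<dots> \<le> real j * ln 2"
  proof -
    have "1/2 \<le> ln (2::real)" using ln2_ge_two_thirds by simp
    then have "real j * (1/2) \<le> real j * ln 2" by (intro mult_left_mono) auto
    then show ?thesis by simp
  qed
  finally show ?thesis using j by (intro exI[of _ j]) (auto simp: x_def)
qed

context strip_map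
begin

text \<open>\<open>a = - Re\<close> increases by at least \<open>exp a\<close> per step: it passes 1
  after finitely many steps and from then on at least doubles.\<close>

lemma boundary_line_growth:
  assumes "\<bar>Im c\<bar> = pi"
  shows "\<exists>N. \<forall>j. norm ((f ^^ (N + j)) c) \<ge> 2 ^ j"
proof -
  have line: "\<bar>Im ((f ^^ j) c)\<bar> = pi" for j
    by (induction j) (use assms f_boundary_line(1) in auto)
  define a where "a j = - Re ((f ^^ j) c)" for j
  have a: "a (Suc j) \<ge> a j + exp (a j)" for j
    using f_boundary_line(2)[OF line[of j]] by (simp add: a_def)
  have a0: "a j \<ge> a 0 + real j * exp (a 0)" for j
  proof (induction j)
    case (Suc j)
    have "0 \<le> real j * exp (a 0)" by simp
    then have "a j \<ge> a 0" using Suc by linarith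
    then have "exp (a j) \<ge> exp (a 0)" by simp
    moreover have "real (Suc j) * exp (a 0) = real j * exp (a 0) + exp (a 0)" by (simp add: algebra_simps)
    ultimately show ?case using a[of j] Suc by linarith
  qed simp
  obtain N :: nat where "real N * exp (a 0) > 1 - a 0"
    using reals_Archimedean3[of "exp (a 0)"] by auto
  then have N: "a N \<ge> 1" using a0[of N] by linarith
  have aN: "a (N + j) \<ge> 2 ^ j" for j
  proof (induction j)
    case (Suc j)
    have "exp (a (N + j)) \<ge> a (N + j)" using exp_ge_add_one_self[of "a (N + j)"] by linarith
    then show ?case using a[of "N + j"] Suc by simp
  qed (use N in simp)
  have "norm ((f ^^ (N + j)) c) \<ge> 2 ^ j" for j
    using aN[of j] abs_Re_le_cmod[of "(f ^^ (N + j)) c"] by (simp add: a_def)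
  then show ?thesis by blast
qed

lemma basin_growth:
  assumes "z \<in> basin"
  shows "\<exists>m C. \<forall>j. norm ((f ^^ (m + j)) z) \<le> C + 2 * crit_val * real j"
proof -
  obtain m where m: "(f ^^ m) z \<in> petal" using assms iter_pre_petal by (auto simp: basin_def)
  have "norm ((f ^^ (m + j)) z) \<le> norm ((f ^^ m) z) + 2 * crit_val * real j" for j
  proof (induction j)
    case (Suc j)
    have "(f ^^ (m + j)) z = (f ^^ j) ((f ^^ m) z)" by (simp add: add.commute[of m] funpow_add)
    then have "(f ^^ (m + j)) z \<in> cpetal" using iter_petal[OF m] petal_subset_cpetal by auto
    from norm_f_minus_id_cpetal[OF this] have "norm (f ((f ^^ (m + j)) z)) \<le> norm ((f ^^ (m + j)) z) + 2 * crit_val"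
      using norm_triangle_ineq2[of "f ((f ^^ (m + j)) z)" "(f ^^ (m + j)) z"] by linarith
    then show ?case using Suc by (simp add: algebra_simps)
  qed simp
  then show ?thesis by blast
qed

lemma basin_to_infinity: "locally_uniform_to_infinity basin (\<lambda>k. f ^^ k)"
  unfolding locally_uniform_to_infinity_def
proof (intro allI impI)
  fix X M assume "compact X \<and> X \<subseteq> basin"
  then have "\<forall>\<^sub>F k in sequentially. \<forall>z\<in>X. (f ^^ k) z \<in> petal \<and> Re ((f ^^ k) z) > M"
    using eventually_petal_on_compact by blast
  then show "\<forall>\<^sub>F k in sequentially. \<forall>z\<in>X. norm ((f ^^ k) z) > M"
    by (rule eventually_mono) (meson complex_Re_le_cmod less_le_trans)
qed

lemma Re_iter_at_top:
  assumes "z \<in> basin"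
  shows "filterlim (\<lambda>k. Re ((f ^^ k) z)) at_top sequentially"
  unfolding filterlim_at_top_dense
proof
  fix M show "\<forall>\<^sub>F k in sequentially. M < Re ((f ^^ k) z)"
    using eventually_petal_on_compact[of "{z}" M] assms by (auto elim: eventually_mono)
qed

lemma iter_at_infinity:
  assumes "z \<in> basin"
  shows "filterlim (\<lambda>k. (f ^^ k) z) at_infinity sequentially"
proof (rule filterlim_norm_at_top_imp_at_infinity)
  show "filterlim (\<lambda>k. norm ((f ^^ k) z)) at_top sequentially"
    by (rule filterlim_at_top_mono[OF Re_iter_at_top[OF assms]])
      (intro always_eventually allI complex_Re_le_cmod)
qed

lemma basin_subset_fatou: "basin \<subseteq> fatou_set f"
proof
  fix z assume "z \<in> basin"
  then obtain \<rho> where \<rho>: "\<rho> > 0" "ball z \<rho> \<subseteq> basin" using open_basin by (meson openE)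
  then have "locally_uniform_to_infinity (ball z \<rho>) (\<lambda>k. f ^^ k)"
    using basin_to_infinity by (auto simp: locally_uniform_to_infinity_def)
  then show "z \<in> fatou_set f"
    using normal_family_on_iterates_to_infinity \<rho>(1) by (auto simp: fatou_set_def)
qed

text \<open>
  Near a boundary point of the basin in the Fatou set the iterates would tend to infinity, hence,
  by Harnack's inequality for the logarithm of their modulus, at comparable rates. Orbits on the
  boundary lines of the strip escape at least exponentially, orbits in the basin at most linearly.
\<close>

lemma frontier_basin_Int_fatou: "frontier basin \<inter> fatou_set f = {}"
proof (rule ccontr)
  assume "\<not> ?thesis"
  then obtain b where b: "b \<in> frontier basin" "b \<in> fatou_set f" by blast
  then obtain \<rho> where \<rho>: "\<rho> > 0" "normal_family_on (range (\<lambda>k. f ^^ k)) (ball b \<rho>)"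
    by (auto simp: fatou_set_def)
  have "b \<in> closure basin" and b_notin: "b \<notin> basin"
    using b(1) open_basin by (auto simp: frontier_def interior_open)
  then obtain a where a: "a \<in> basin" "dist a b < \<rho> / 4"
    using \<rho>(1) by (meson closure_approachable divide_pos_pos zero_less_numeral)
  have a_in: "a \<in> ball b (\<rho>/4)" using a(2) by (simp add: dist_commute)
  have "locally_uniform_to_infinity (ball b \<rho>) (\<lambda>k. f ^^ k)"
    using a_in \<rho> by (intro normal_family_on_to_infinity[OF \<rho>(2) _ iter_at_infinity[OF a(1)]]) auto
  moreover have "cball b (\<rho>/2) \<subseteq> ball b \<rho>" using \<rho>(1) by auto
  ultimately have big: "\<forall>\<^sub>F k in sequentially. \<forall>z\<in>cball b (\<rho>/2). norm ((f ^^ k) z) > M" for M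
    by (auto simp: locally_uniform_to_infinity_def)
  show False
  \<comment> \<open>Either some iterate of the small disc leaves the strip and then, by
    connectedness, meets a boundary line, which brings in the fast rate; or all iterates stay
    inside, and then \<open>b\<close> itself would belong to the basin.\<close>
  proof (cases "\<forall>k. \<forall>c\<in>ball b (\<rho>/4). (f ^^ k) c \<in> strip")
    case False
    then obtain k c where c: "c \<in> ball b (\<rho>/4)" "(f ^^ k) c \<notin> strip" by blast
    define I where "I = (\<lambda>z. Im ((f ^^ k) z)) ` ball b (\<rho>/4)"
    have "connected I"
      unfolding I_def by (intro connected_continuous_image continuous_intros iter_continuous) auto
    moreover have "Im ((f ^^ k) a) \<in> I" "Im ((f ^^ k) c) \<in> I" using a_in c(1) by (auto simp: I_def)
    moreover have "\<bar>Im ((f ^^ k) a)\<bar> < pi"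
      using iter_basin[OF a(1), of k] basin_subset_strip by (auto simp: strip_def)
    moreover have "pi \<le> Im ((f ^^ k) c) \<or> Im ((f ^^ k) c) \<le> - pi" using c(2) by (auto simp: strip_def)
    ultimately have "pi \<in> I \<or> - pi \<in> I"
      using connectedD_interval[of I "Im ((f ^^ k) a)" "Im ((f ^^ k) c)" pi]
        connectedD_interval[of I "Im ((f ^^ k) c)" "Im ((f ^^ k) a)" "- pi"] unfolding abs_less_iff
      by (smt (verit))
    then obtain y where "y \<in> I" "\<bar>y\<bar> = pi" using pi_gt_zero by force
    then obtain c' where c': "c' \<in> ball b (\<rho>/4)" "\<bar>Im ((f ^^ k) c')\<bar> = pi" by (auto simp: I_def)
    obtain N where N: "\<And>j. norm ((f ^^ (N + j)) ((f ^^ k) c')) \<ge> 2 ^ j"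
      using boundary_line_growth[OF c'(2)] by blast
    obtain m C where mC: "\<And>j. norm ((f ^^ (m + j)) a) \<le> C + 2 * crit_val * real j"
      using basin_growth[OF a(1)] by blast
    obtain k0 where k0: "\<And>j. j \<ge> k0 \<Longrightarrow> \<forall>z\<in>cball b (\<rho>/2). norm ((f ^^ j) z) > 1"
      using big[of 1] by (auto simp: eventually_sequentially)
    define A where "A = max 1 (C + 2 * crit_val * real (N + k))"
    obtain j where j: "j \<ge> k0 + m" "real j * ln 2 > 9 * ln (A + 2 * crit_val * real j)"
      using exponential_not_le_power_linear[of A "2 * crit_val" "k0 + m"] crit_val_pos by (auto simp: A_def)
    \<comment> \<open>One common iterate for both rates: \<open>c'\<close> needs \<open>k\<close>
      steps to reach the line and \<open>N\<close> more before the growth \<open>2 ^ j\<close>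
      starts; \<open>j >= k0 + m\<close> puts \<open>i\<close> beyond both thresholds.\<close>
    define i where "i = N + j + k"
    have "\<And>z. z \<in> ball b (\<rho>/2) \<Longrightarrow> norm ((f ^^ i) z) > 1"
      using k0[of i] j(1) by (auto simp: i_def)
    then have "ln (norm ((f ^^ i) c')) \<le> 9 * ln (norm ((f ^^ i) a))"
      using \<rho>(1) c'(1) a_in by (intro ln_norm_Harnack[of "\<rho>/2" _ b] iter_holomorphic) auto
    moreover have "ln (norm ((f ^^ i) c')) \<ge> real j * ln 2"
    proof -
      have "(f ^^ i) c' = (f ^^ (N + j)) ((f ^^ k) c')" by (simp add: i_def funpow_add)
      then have "norm ((f ^^ i) c') \<ge> 2 ^ j" using N[of j] by simp
      then have "ln (2 ^ j) \<le> ln (norm ((f ^^ i) c'))" by (intro ln_mono) auto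
      then show ?thesis by (simp add: ln_realpow)
    qed
    moreover have "ln (norm ((f ^^ i) a)) \<le> ln (A + 2 * crit_val * real j)"
    proof (rule ln_mono)
      have "norm ((f ^^ (m + (i - m))) a) \<le> C + 2 * crit_val * real (i - m)" by (rule mC)
      moreover have "m \<le> i" using j(1) by (simp add: i_def)
      moreover have "2 * crit_val * real (i - m) \<le> 2 * crit_val * real i"
        using crit_val_pos by (intro mult_left_mono) auto
      ultimately have "norm ((f ^^ i) a) \<le> C + 2 * crit_val * real i" by simp
      also have "\<dots> = (C + 2 * crit_val * real (N + k)) + 2 * crit_val * real j" by (simp add: i_def algebra_simps)
      also have "\<dots> \<le> A + 2 * crit_val * real j" by (simp add: A_def)
      finally show "norm ((f ^^ i) a) \<le> A + 2 * crit_val * real j" .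
      have "norm ((f ^^ i) a) > 1" using k0[of i] j(1) a_in \<rho>(1) by (auto simp: i_def)
      then show "0 < norm ((f ^^ i) a)" by linarith
    qed
    ultimately show False using j(2) by linarith
  next
    case True
    obtain M where M: "M \<ge> 0" "far M" using far_exists by blast
    have "\<forall>\<^sub>F k in sequentially. Re ((f ^^ k) a) > 0"
      using eventually_petal_on_compact[of "{a}" 0] a(1) by (auto elim: eventually_mono)
    from eventually_conj[OF this big[of "M + pi"]]
    obtain k0 where k0: "\<And>j. j \<ge> k0 \<Longrightarrow> Re ((f ^^ j) a) > 0"
      "\<And>j z. j \<ge> k0 \<Longrightarrow> z \<in> cball b (\<rho>/2) \<Longrightarrow> norm ((f ^^ j) z) > M + pi"
      unfolding eventually_sequentially by metis
    \<comment> \<open>Inside the strip and outside the ball of radius \<open>M + pi\<close> one has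
      \<open>|Re| > M\<close>. The image of the disc is connected, so it lies on the same side as
      the orbit of \<open>a\<close>, which is to the right.\<close>
    have ReM: "Re ((f ^^ j) b) > M" if j: "j \<ge> k0" for j
    proof (rule ccontr)
      assume "\<not> ?thesis"
      have absRe: "\<bar>Re ((f ^^ j) z)\<bar> > M" if z: "z \<in> ball b (\<rho>/4)" for z
      proof -
        have "norm ((f ^^ j) z) > M + pi" using z \<rho>(1) j by (intro k0(2)) auto
        moreover have "\<bar>Im ((f ^^ j) z)\<bar> < pi" using True z by (auto simp: strip_def)
        ultimately show ?thesis using cmod_le[of "(f ^^ j) z"] by linarith
      qed
      define I where "I = (\<lambda>z. Re ((f ^^ j) z)) ` ball b (\<rho>/4)"
      have "connected I"
        unfolding I_def by (intro connected_continuous_image continuous_intros iter_continuous) auto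
      moreover have "Re ((f ^^ j) a) \<in> I" "Re ((f ^^ j) b) \<in> I" using a_in \<rho>(1) by (auto simp: I_def)
      moreover have "Re ((f ^^ j) b) \<le> 0"
        using \<open>\<not> Re ((f ^^ j) b) > M\<close> absRe[of b] \<rho>(1) M(1) by auto
      ultimately have "0 \<in> I"
        using connectedD_interval[of I "Re ((f ^^ j) b)" "Re ((f ^^ j) a)" 0] k0(1)[OF j] by auto
      then obtain z where z: "z \<in> ball b (\<rho>/4)" "Re ((f ^^ j) z) = 0" by (auto simp: I_def)
      show False using absRe[OF z(1)] z(2) M(1) by simp
    qed
    have "(f ^^ k0) b \<in> basin"
    proof (rule in_basin_if_far_orbit[OF M(2)])
      fix j
      have eq: "(f ^^ j) ((f ^^ k0) b) = (f ^^ (j + k0)) b" by (simp add: funpow_add)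
      show "(f ^^ j) ((f ^^ k0) b) \<in> strip" unfolding eq using True \<rho>(1) by auto
      show "Re ((f ^^ j) ((f ^^ k0) b)) > M" unfolding eq by (rule ReM) simp
    qed
    then have "b \<in> basin" using in_basin_if_iter[of k0 b] True \<rho>(1) by auto
    then show False using b_notin by blast
  qed
qed

lemma basin_in_components: "basin \<in> components (fatou_set f)"
  unfolding in_components_maximal
proof (intro conjI allI impI)
  show "basin \<noteq> {}" using of_real_in_basin[of 0] by auto
  show "basin \<subseteq> fatou_set f" by (rule basin_subset_fatou)
  show "connected basin" by (rule connected_basin)
  fix d assume d: "d \<noteq> {} \<and> basin \<subseteq> d \<and> d \<subseteq> fatou_set f \<and> connected d"
  show "d = basin"
  proof (rule ccontr)
    assume "d \<noteq> basin"
    then have "d - basin \<noteq> {}" using d by blast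
    moreover have "d \<inter> basin \<noteq> {}" using d \<open>basin \<noteq> {}\<close> by blast
    ultimately have "d \<inter> frontier basin \<noteq> {}" using d by (intro connected_Int_frontier) auto
    then show False using frontier_basin_Int_fatou d by blast
  qed
qed

text \<open>\<open>f' = u ^ n\<close> vanishes at all multiples of \<open>2 * pi * \<i>\<close>
  without being identically zero.\<close>

lemma transcendental_f: "transcendental_entire f"
  unfolding transcendental_entire_def
proof (intro conjI notI)
  show "f holomorphic_on UNIV" by (rule f_holomorphic)
  assume "\<exists>p. \<forall>z. f z = poly p z"
  then obtain p where p: "f = poly p" by auto
  have d: "poly (pderiv p) z = u z ^ n" for z
    using poly_DERIV[of p z] f_has_field_derivative[of z UNIV] unfolding p by (rule DERIV_unique)
  have "u 1 \<noteq> 0" using u_eq_0_iff[of 1] of_real_in_strip[of 1] by simp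
  then have "pderiv p \<noteq> 0" using d[of 1] by auto
  then have "finite {z. poly (pderiv p) z = 0}" by (rule poly_roots_finite)
  moreover have "range (\<lambda>k. of_real (2 * pi * real k) * \<i>) \<subseteq> {z. poly (pderiv p) z = 0}"
  proof clarify
    fix k :: nat
    have "exp (- (of_real (2 * pi * real k) * \<i>)) = 1"
      by (subst exp_eq_1) (auto intro: exI[of _ "- int k"])
    then have "u (of_real (2 * pi * real k) * \<i>) = 0" by (simp add: u_def)
    then show "poly (pderiv p) (of_real (2 * pi * real k) * \<i>) = 0" using n_pos by (simp add: d)
  qed
  ultimately have "finite (range (\<lambda>k. of_real (2 * pi * real k) * \<i>))" by (rule finite_subset[rotated])
  moreover have "inj (\<lambda>k. of_real (2 * pi * real k) * \<i>)" by (auto simp: inj_on_def)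
  ultimately show False using finite_imageD infinite_UNIV_nat by blast
qed

lemma baker_domain_basin: "baker_domain f basin"
  unfolding baker_domain_def
  using transcendental_f basin_in_components basin_to_infinity iter_basin[of _ 1] by auto

lemma baker_domain_eq_basin:
  assumes "baker_domain f U" "of_real ` {0<..} \<subseteq> U"
  shows "U = basin"
proof (rule components_eq[THEN iffD2])
  have "(1::complex) \<in> U" using assms(2) by force
  moreover have "(1::complex) \<in> basin" using of_real_in_basin[of 1] by simp
  ultimately show "U \<inter> basin \<noteq> {}" by blast
  show "U \<in> components (fatou_set f)" using assms(1) by (simp add: baker_domain_def)
qed (rule basin_in_components)

end

section \<open>A Blaschke product model\<close>

definition root_fun :: "nat \<Rightarrow> complex \<Rightarrow> complex" where
  "root_fun d v = exp (Ln v / of_nat d)"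

lemma root_fun_power: "d > 0 \<Longrightarrow> v \<noteq> 0 \<Longrightarrow> root_fun d v ^ d = v"
  by (simp add: root_fun_def exp_of_nat_mult[symmetric])

lemma root_fun_nonzero [simp]: "root_fun d v \<noteq> 0"
  by (simp add: root_fun_def)

lemma root_fun_continuous:
  assumes "continuous_on X g" and "\<And>x. x \<in> X \<Longrightarrow> g x \<notin> \<real>\<^sub>\<le>\<^sub>0" and "d > 0"
  shows "continuous_on X (\<lambda>x. root_fun d (g x))"
  unfolding root_fun_def using assms by (intro continuous_intros) auto

lemma root_fun_of_real_power:
  assumes "y > 0" "d > 0"
  shows "root_fun d (of_real y ^ d) = of_real y"
proof -
  have "Ln (of_real y ^ d) = of_real (ln (y ^ d))"
    using assms by (simp flip: of_real_power add: Ln_of_real)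
  also have "\<dots> = of_nat d * of_real (ln y)" using assms by (simp add: ln_realpow)
  finally have "root_fun d (of_real y ^ d) = exp (of_real (ln y))"
    using assms by (simp add: root_fun_def)
  then show ?thesis using assms by (simp add: exp_of_real)
qed

lemma Im_pos_not_nonpos: "Im v > 0 \<Longrightarrow> v \<notin> \<real>\<^sub>\<le>\<^sub>0"
  by (auto simp: complex_nonpos_Reals_iff)

text \<open>The inner function of the basin has this form with \<open>d = n + 1\<close>.\<close>

definition blaschke :: "nat \<Rightarrow> real \<Rightarrow> complex \<Rightarrow> complex" where
  "blaschke d c v = Moebius_function 0 (- of_real c) (v ^ d)"

lemma blaschke_eq: "blaschke d c v = (v ^ d + of_real c) / (1 + of_real c * v ^ d)"
  by (simp add: blaschke_def Moebius_function_simple)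

lemma blaschke_denominator:
  fixes v :: complex
  assumes "\<bar>c\<bar> < 1" "norm v \<le> 1"
  shows "1 + of_real c * v ^ d \<noteq> 0"
proof
  assume "1 + of_real c * v ^ d = 0"
  then have "of_real c * v ^ d = - 1" by (simp add: add_eq_0_iff)
  then have "norm (of_real c * v ^ d) = 1" by simp
  then have "\<bar>c\<bar> * norm v ^ d = 1" by (simp add: norm_mult norm_power)
  moreover have "\<bar>c\<bar> * norm v ^ d \<le> \<bar>c\<bar> * 1"
    using assms by (intro mult_left_mono power_le_one) auto
  ultimately show False using assms(1) by simp
qed

lemma blaschke_continuous:
  assumes "\<bar>c\<bar> < 1"
  shows "continuous_on (cball 0 1) (blaschke d c)"
  unfolding blaschke_eq[abs_def] by (intro continuous_intros) (use blaschke_denominator[OF assms] in auto)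

context strip_map
begin

section \<open>Symmetric Riemann maps and the Blaschke model\<close>

lemma cnj_in_strip_iff [simp]: "cnj z \<in> strip \<longleftrightarrow> z \<in> strip"
  by (simp add: strip_def)

lemma cnj_in_basin_iff [simp]: "cnj z \<in> basin \<longleftrightarrow> z \<in> basin"
proof -
  have u: "norm (u (cnj z)) = norm (u z)" for z
  proof -
    have "u (cnj z) = cnj (u z)" by (simp add: u_def exp_cnj flip: complex_cnj_minus)
    then show ?thesis by simp
  qed
  have "cnj z \<in> pre_petal k \<longleftrightarrow> z \<in> pre_petal k" for k z
    by (induction k arbitrary: z) (simp_all add: petal_def f_cnj u)
  then show ?thesis by (simp add: basin_def)
qed

lemma basin_neq_UNIV: "basin \<noteq> UNIV"
proof
  assume "basin = UNIV"
  then have "\<i> * of_real pi \<in> strip" using basin_subset_strip by auto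
  then show False by (simp add: strip_def)
qed

text \<open>Conjugating \<open>A\<close> by complex conjugation gives a Riemann map with the same
  zero and the same real value at 0, hence \<open>A\<close> itself.\<close>

lemma symmetric_Riemann_map:
  obtains A c where "conformal_onto A basin unit_disc" "A (of_real crit_val) = 0"
    "A 0 = - of_real c" "0 < c" "c < 1" "\<And>z. z \<in> basin \<Longrightarrow> A (cnj z) = cnj (A z)"
proof -
  have cb: "of_real crit_val \<in> basin" and zb: "0 \<in> basin"
    using of_real_in_basin[of crit_val] of_real_in_basin[of 0] crit_val_pos by auto
  obtain A0 where A0: "conformal_onto A0 basin unit_disc" "A0 (of_real crit_val) = 0"
    using Riemann_map_centered[OF open_basin simply_connected_basin basin_neq_UNIV cb] by blast
  define c where "c = norm (A0 0)"
  have "A0 0 \<noteq> 0"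
    using A0 cb zb crit_val_pos unfolding conformal_onto_def bij_betw_def
    by (metis inj_onD less_irrefl of_real_0 of_real_eq_iff)
  then have c0: "c > 0" by (simp add: c_def)
  have c1: "c < 1" using A0(1) zb by (auto simp: c_def conformal_onto_def bij_betw_def)
  \<comment> \<open>The rotation that puts the image of the critical point 0 on the negative
    axis.\<close>
  define \<alpha> where "\<alpha> = - of_real c / A0 0"
  have \<alpha>: "norm \<alpha> = 1" using \<open>A0 0 \<noteq> 0\<close> by (simp add: \<alpha>_def norm_divide c_def)
  have rot: "conformal_onto (\<lambda>p. \<alpha> * p) unit_disc unit_disc"
    unfolding conformal_onto_def
  proof
    have \<alpha>0: "\<alpha> \<noteq> 0" using \<alpha> by auto
    show "bij_betw (\<lambda>p. \<alpha> * p) unit_disc unit_disc"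
      by (rule bij_betw_byWitness[where f' = "\<lambda>p. p / \<alpha>"]) (use \<alpha> \<alpha>0 in \<open>auto simp: norm_mult norm_divide\<close>)
  qed (intro holomorphic_intros)
  define A where "A = (\<lambda>p. \<alpha> * p) \<circ> A0"
  have A: "conformal_onto A basin unit_disc"
    unfolding A_def by (rule conformal_onto_comp[OF A0(1) rot])
  have A00: "A 0 = - of_real c" using \<open>A0 0 \<noteq> 0\<close> by (simp add: A_def \<alpha>_def)
  have Acv: "A (of_real crit_val) = 0" by (simp add: A_def A0)
  define A' where "A' = cnj \<circ> A \<circ> cnj"
  have A': "conformal_onto A' basin unit_disc"
    unfolding conformal_onto_def
  proof
    have "cnj ` basin = basin"
      using cnj_in_basin_iff by (auto simp: image_iff) (metis cnj_in_basin_iff complex_cnj_cnj)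
    then show "A' holomorphic_on basin"
      unfolding A'_def using A open_basin
      by (intro holomorphic_on_compose_cnj_cnj) (auto simp: conformal_onto_def)
    show "bij_betw A' basin unit_disc"
    proof (rule bij_betw_byWitness[where f' = "cnj \<circ> inv_into basin A \<circ> cnj"])
      have *: "A (inv_into basin A p) = p" "inv_into basin A p \<in> basin" if "p \<in> unit_disc" for p
        using A that by (auto simp: conformal_onto_def bij_betw_def f_inv_into_f inv_into_into)
      have **: "inv_into basin A (A z) = z" "A z \<in> unit_disc" if "z \<in> basin" for z
        using A that by (auto simp: conformal_onto_def bij_betw_def)
      show "\<forall>z\<in>basin. (cnj \<circ> inv_into basin A \<circ> cnj) (A' z) = z"
        by (simp add: A'_def **)
      show "\<forall>p\<in>unit_disc. A' ((cnj \<circ> inv_into basin A \<circ> cnj) p) = p"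
        by (simp add: A'_def *)
      show "A' ` basin \<subseteq> unit_disc" "(cnj \<circ> inv_into basin A \<circ> cnj) ` unit_disc \<subseteq> basin"
        using * ** by (auto simp: A'_def)
    qed
  qed
  define \<kappa> where "\<kappa> = A' \<circ> inv_into basin A"
  have "conformal_onto \<kappa> unit_disc unit_disc"
    unfolding \<kappa>_def by (rule conformal_onto_comp[OF conformal_onto_inv_into[OF open_basin A] A'])
  then obtain \<beta> a where \<beta>: "norm \<beta> = 1" "norm a < 1" "\<And>p. p \<in> unit_disc \<Longrightarrow> \<kappa> p = \<beta> * Moebius_function 0 a p"
    using conformal_onto_unit_disc_eq_Moebius by blast
  have \<kappa>A: "\<kappa> (A z) = A' z" if "z \<in> basin" for z
    using A that by (simp add: \<kappa>_def conformal_onto_def bij_betw_def inv_into_f_f)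
  have "\<kappa> 0 = 0" using \<kappa>A[OF cb] Acv by (simp add: A'_def)
  then have "a = 0" using \<beta>(1) \<beta>(3)[of 0] by (auto simp: Moebius_function_of_zero)
  then have lin: "\<kappa> p = \<beta> * p" if "p \<in> unit_disc" for p using \<beta>(3)[OF that] by (simp add: Moebius_function_simple)
  have "\<kappa> (- of_real c) = - of_real c" using \<kappa>A[OF zb] A00 by (simp add: A'_def)
  then have "\<beta> = 1" using lin[of "- of_real c"] c0 c1 by simp
  have "A' z = A z" if "z \<in> basin" for z
  proof -
    have "A z \<in> unit_disc" using A that by (auto simp: conformal_onto_def bij_betw_def)
    then show ?thesis using \<kappa>A[OF that] lin[of "A z"] \<open>\<beta> = 1\<close> by simp
  qed
  then have "A (cnj z) = cnj (A z)" if "z \<in> basin" for z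
    using that by (metis A'_def complex_cnj_cnj o_apply)
  then show thesis using that A Acv A00 c0 c1 by blast
qed

text \<open>The basin is its own pullback in the strip, so an \<open>(n + 1)\<close>-st root
  \<open>q\<close> of \<open>A o f\<close> is again a Riemann map of the basin. Both
  \<open>q\<close> and \<open>A\<close> being Riemann maps, \<open>q = M o A\<close> for a disc
  automorphism \<open>M\<close>, and therefore \<open>q o f = M o (A o f) = M (q ^ (n + 1))\<close>.
  The values at the critical point and the critical value determine \<open>M\<close>.\<close>

lemma Riemann_model:
  obtains q c where "conformal_onto q basin unit_disc" "0 < c" "c < 1"
    "\<And>z. z \<in> basin \<Longrightarrow> q (f z) = blaschke (Suc n) c (q z)"
    "\<And>x. x > 0 \<Longrightarrow> \<exists>y>0. q (of_real x) = of_real y"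
    "q 0 = 0" "\<And>z. z \<in> basin \<Longrightarrow> q (cnj z) = cnj (q z)"
proof -
  obtain A c where A: "conformal_onto A basin unit_disc" "A (of_real crit_val) = 0"
    "A 0 = - of_real c" "0 < c" "c < 1" "\<And>z. z \<in> basin \<Longrightarrow> A (cnj z) = cnj (A z)"
    using symmetric_Riemann_map by blast
  have hol: "A holomorphic_on basin" and inj: "inj_on A basin" and Aim: "A ` basin = unit_disc"
    using A(1) by (auto simp: conformal_onto_def bij_betw_def)
  have cb: "of_real crit_val \<in> basin" and zb: "0 \<in> basin"
    using of_real_in_basin[of crit_val] of_real_in_basin[of 0] crit_val_pos by auto
  obtain \<sigma> where \<sigma>: "\<sigma> holomorphic_on basin" "\<And>v. v \<in> basin \<Longrightarrow> \<sigma> v \<noteq> 0"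
      "\<And>v. v \<in> basin \<Longrightarrow> A v = (v - of_real crit_val) * \<sigma> v ^ Suc n"
    using conformal_onto_zero_factor[OF open_basin simply_connected_basin A(1) cb A(2), of "Suc n"] by blast
  define q0 where "q0 z = \<zeta> z * \<sigma> (f z)" for z
  have q0: "conformal_onto q0 basin unit_disc"
    using pullback_conformal(1)[OF basin_subset_strip open_basin A(1) \<sigma>]
    unfolding basin_eq_pullback q0_def[abs_def] by simp
  have q0pow: "q0 z ^ Suc n = A (f z)" if "z \<in> basin" for z
  proof -
    have "z \<in> strip" "f z \<in> basin" using that basin_subset_strip f_in_basin_iff by auto
    then show ?thesis
      unfolding q0_def power_mult_distrib using \<zeta>_power \<sigma>(3) by simp
  qed
  have Areal: "A (of_real x) = of_real (Re (A (of_real x)))" if "x \<ge> 0" for x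
  proof -
    have "A (of_real x) = cnj (A (of_real x))"
      using A(6)[OF of_real_in_basin[OF that]] by simp
    then show ?thesis by (simp add: complex_eq_iff)
  qed
  have contA: "continuous_on basin A" using hol by (rule holomorphic_on_imp_continuous_on)
  \<comment> \<open>\<open>A\<close> is real and injective on this part of the axis, hence monotone;
    \<open>A 0 < 0 = A crit_val\<close> decides the direction.\<close>
  have Apos: "Re (A (of_real x)) > 0" if "x > crit_val" for x
  proof -
    have "continuous_on {0..x} (\<lambda>x. Re (A (of_real x)))"
      by (intro continuous_intros continuous_on_compose2[OF contA]) (use of_real_in_basin in auto)
    moreover have "inj_on (\<lambda>x. Re (A (of_real x))) {0..x}"
    proof (rule inj_onI)
      fix s t assume st: "s \<in> {0..x}" "t \<in> {0..x}" "Re (A (of_real s)) = Re (A (of_real t))"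
      then have "A (of_real s) = A (of_real t)" using Areal[of s] Areal[of t] by (metis atLeastAtMost_iff)
      then show "s = t" using inj_onD[OF inj] of_real_in_basin st(1,2) by fastforce
    qed
    ultimately have "(Re (A (of_real 0)) < Re (A (of_real crit_val)) \<and> Re (A (of_real crit_val)) < Re (A (of_real x))) \<or>
      (Re (A (of_real x)) < Re (A (of_real crit_val)) \<and> Re (A (of_real crit_val)) < Re (A (of_real 0)))"
      using crit_val_pos that by (intro continuous_inj_imp_mono) auto
    then show ?thesis using A(2-4) by simp
  qed
  \<comment> \<open>\<open>f x - crit_val = \<zeta> x ^ Suc n\<close> is positive for
    \<open>x > 0\<close>, so \<open>f x\<close> lies to the right of the critical value.\<close>
  have freal: "\<exists>r>0. A (f (of_real x)) = of_real r" if x: "x > 0" for x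
  proof -
    obtain y where y: "f (of_real x) = of_real y" "y > x" using f_of_real_gt[of x] x by auto
    have "f (of_real x) \<noteq> of_real crit_val"
    proof
      assume "f (of_real x) = of_real crit_val"
      then have "\<zeta> (of_real x) ^ Suc n = 0" by (subst \<zeta>_power) auto
      then show False using \<zeta>_eq_0_iff[of "of_real x"] x by simp
    qed
    moreover have "of_real y - of_real crit_val = \<zeta> (of_real x) ^ Suc n"
      using y(1) \<zeta>_power[of "of_real x"] by simp
    moreover obtain t where "t > 0" "\<zeta> (of_real x) = of_real t" using \<zeta>_of_real_pos[OF x] by blast
    ultimately have "complex_of_real (y - crit_val) = of_real (t ^ Suc n)" by simp
    then have "y - crit_val = t ^ Suc n" using of_real_eq_iff by blast
    then have "y > crit_val" using \<open>t > 0\<close> by (metis diff_gt_0_iff_gt zero_less_power)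
    then show ?thesis using Apos[of y] Areal[of y] crit_val_pos y(1) by (metis less_trans less_imp_le)
  qed
  define X where "X = complex_of_real ` {0<..}"
  have Xb: "X \<subseteq> basin" using of_real_in_basin by (auto simp: X_def)
  have q0cont: "continuous_on basin q0" using q0 by (auto simp: conformal_onto_def intro: holomorphic_on_imp_continuous_on)
  have notneg: "A (f z) \<notin> \<real>\<^sub>\<le>\<^sub>0" if "z \<in> X" for z
    using freal that by (auto simp: X_def complex_nonpos_Reals_iff) (metis Re_complex_of_real linorder_not_less)
  have conn: "connected X"
    unfolding X_def by (intro connected_continuous_image continuous_intros) auto
  have cont: "continuous_on X (\<lambda>z. q0 z / root_fun (Suc n) (A (f z)))"
    by (intro continuous_intros root_fun_continuous continuous_on_subset[OF q0cont Xb] notneg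
        continuous_on_compose2[OF contA] f_continuous)
      (use Xb f_in_basin_iff basin_subset_strip in auto)
  have pow: "(q0 z / root_fun (Suc n) (A (f z))) ^ Suc n = 1" if "z \<in> X" for z
  proof -
    have "A (f z) \<noteq> 0" using notneg[OF that] by auto
    then show ?thesis
      unfolding power_divide using q0pow[of z] Xb that by (subst root_fun_power) auto
  qed
  obtain \<omega> where \<omega>: "\<And>z. z \<in> X \<Longrightarrow> q0 z / root_fun (Suc n) (A (f z)) = \<omega>"
    by (rule power_eq_1_constant[OF conn cont zero_less_Suc pow]) (assumption, blast intro: that)
  have \<omega>q0: "q0 (of_real x) = \<omega> * root_fun (Suc n) (A (f (of_real x)))" if "x > 0" for x
    using \<omega>[of "of_real x"] that by (auto simp: X_def field_simps)
  have "1 \<in> X" unfolding X_def by (rule image_eqI[of _ _ 1]) auto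
  then have \<omega>pow: "\<omega> ^ Suc n = 1" using pow[of 1] \<omega>[of 1] by simp
  then have "norm \<omega> ^ Suc n = 1" by (metis norm_one norm_power)
  then have \<omega>1: "norm \<omega> = 1" using power_eq_imp_eq_base[of "norm \<omega>" "Suc n" 1] by simp
  have \<omega>0: "\<omega> \<noteq> 0" using \<omega>1 by auto
  \<comment> \<open>Division by the root of unity \<open>\<omega>\<close> leaves the power
    \<open>q ^ Suc n\<close> unchanged and makes \<open>q\<close> positive on the positive
    axis.\<close>
  define q where "q = (\<lambda>p. p / \<omega>) \<circ> q0"
  have "conformal_onto (\<lambda>p. p / \<omega>) unit_disc unit_disc"
    unfolding conformal_onto_def
  proof
    show "bij_betw (\<lambda>p. p / \<omega>) unit_disc unit_disc"
      by (rule bij_betw_byWitness[where f' = "\<lambda>p. p * \<omega>"]) (use \<omega>1 \<omega>0 in \<open>auto simp: norm_mult norm_divide\<close>)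
  qed (use \<omega>0 in \<open>intro holomorphic_intros, auto\<close>)
  then have q: "conformal_onto q basin unit_disc"
    unfolding q_def by (rule conformal_onto_comp[OF q0])
  have qpow: "q z ^ Suc n = A (f z)" if "z \<in> basin" for z
    using q0pow[OF that] \<omega>pow unfolding q_def o_apply power_divide by simp
  have qpos: "\<exists>y>0. q (of_real x) = of_real y" if x: "x > 0" for x
  proof -
    obtain r where r: "r > 0" "A (f (of_real x)) = of_real r" using freal[OF x] by blast
    define y where "y = root (Suc n) r"
    have y: "y > 0" "y ^ Suc n = r" using r(1) by (simp_all add: y_def real_root_pow_pos del: power_Suc)
    have "q (of_real x) = root_fun (Suc n) (of_real y ^ Suc n)"
      using \<omega>q0[OF x] \<omega>0 r(2) y(2) by (simp add: q_def del: power_Suc flip: of_real_power)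
    also have "\<dots> = of_real y" using y(1) by (intro root_fun_of_real_power) auto
    finally show ?thesis using y(1) by blast
  qed
  have q00: "q 0 = 0" using \<zeta>_eq_0_iff[of 0] of_real_in_strip[of 0] by (simp add: q_def q0_def)
  define \<kappa> where "\<kappa> = q \<circ> inv_into basin A"
  have "conformal_onto \<kappa> unit_disc unit_disc"
    unfolding \<kappa>_def by (rule conformal_onto_comp[OF conformal_onto_inv_into[OF open_basin A(1)] q])
  then obtain \<alpha> a where \<alpha>: "norm \<alpha> = 1" "norm a < 1" "\<And>p. p \<in> unit_disc \<Longrightarrow> \<kappa> p = \<alpha> * Moebius_function 0 a p"
    using conformal_onto_unit_disc_eq_Moebius by blast
  have \<kappa>A: "\<kappa> (A z) = q z" if "z \<in> basin" for z
    using inj that by (simp add: \<kappa>_def inv_into_f_f)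
  have AinD: "A z \<in> unit_disc" if "z \<in> basin" for z using Aim that by blast
  have "\<kappa> (- of_real c) = 0" using \<kappa>A[OF zb] q00 A(3) by simp
  then have "Moebius_function 0 a (- of_real c) = 0" using \<alpha>(1) \<alpha>(3)[of "- of_real c"] A(4,5) by auto
  moreover have "Moebius_function 0 (- a) (Moebius_function 0 a (- of_real c)) = - of_real c"
    using \<alpha>(2) A(4,5) by (intro Moebius_function_compose) auto
  \<comment> \<open>\<open>\<kappa>\<close> vanishes at \<open>- c = A 0\<close> because
    \<open>q 0 = 0\<close>. Then \<open>\<kappa> 0 = \<alpha> * c\<close> is positive, which forces
    the unimodular factor to be 1.\<close>
  ultimately have a: "a = - of_real c" by (simp add: Moebius_function_of_zero)
  obtain y where y: "y > 0" "q (of_real crit_val) = of_real y" using qpos[OF crit_val_pos] by blast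
  have "\<kappa> 0 = of_real y" using \<kappa>A[OF cb] A(2) y(2) by simp
  then have \<alpha>y: "\<alpha> * of_real c = of_real y" using \<alpha>(3)[of 0] by (simp add: Moebius_function_of_zero a)
  then have "\<alpha> = of_real (y / c)" using A(4) by (simp add: field_simps)
  moreover have "y / c > 0" using y(1) A(4) by simp
  ultimately have "y / c = 1" using \<alpha>(1) by (simp only: norm_of_real abs_of_pos)
  with \<open>\<alpha> = of_real (y / c)\<close> have "\<alpha> = 1" by simp
  then have \<kappa>: "q z = Moebius_function 0 (- of_real c) (A z)" if "z \<in> basin" for z
    using \<alpha>(3)[OF AinD[OF that]] \<kappa>A[OF that] a by simp
  show thesis
  proof (rule that[OF q A(4,5) _ qpos q00])
    fix z assume z: "z \<in> basin"
    then have "f z \<in> basin" using f_in_basin_iff basin_subset_strip by auto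
    then show "q (f z) = blaschke (Suc n) c (q z)"
      by (simp only: \<kappa> blaschke_def qpow[OF z])
    show "q (cnj z) = cnj (q z)"
      using z by (simp add: \<kappa> A(6) Moebius_function_simple)
  qed
qed

end

locale disc_model = strip_map +
  fixes q :: "complex \<Rightarrow> complex" and c :: real
  assumes q_conformal: "conformal_onto q basin unit_disc"
    and c_pos: "0 < c" and c_less_1: "c < 1"
    and q_f: "\<And>z. z \<in> basin \<Longrightarrow> q (f z) = blaschke (Suc n) c (q z)"
    and q_of_real_pos: "\<And>x. x > 0 \<Longrightarrow> \<exists>y>0. q (of_real x) = of_real y"
    and q_0: "q 0 = 0"
    and q_cnj: "\<And>z. z \<in> basin \<Longrightarrow> q (cnj z) = cnj (q z)"
begin

abbreviation g :: "complex \<Rightarrow> complex" where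
  "g \<equiv> blaschke (Suc n) c"

abbreviation q_inv :: "complex \<Rightarrow> complex" where
  "q_inv \<equiv> inv_into basin q"

section \<open>Hyperbolic steps and orbits in the model\<close>

lemma q_in_disc: "z \<in> basin \<Longrightarrow> q z \<in> unit_disc"
  and q_inj: "inj_on q basin"
  and q_holomorphic: "q holomorphic_on basin"
  using q_conformal by (auto simp: conformal_onto_def bij_betw_def)

lemma q_q_inv: "p \<in> unit_disc \<Longrightarrow> q (q_inv p) = p"
  and q_inv_in_basin: "p \<in> unit_disc \<Longrightarrow> q_inv p \<in> basin"
  and q_inv_q: "z \<in> basin \<Longrightarrow> q_inv (q z) = z"
  using q_conformal by (auto simp: conformal_onto_def bij_betw_def f_inv_into_f inv_into_into)

lemma q_inv_conformal: "conformal_onto q_inv unit_disc basin"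
  by (rule conformal_onto_inv_into[OF open_basin q_conformal])

lemma q_continuous: "continuous_on basin q"
  by (rule holomorphic_on_imp_continuous_on[OF q_holomorphic])

lemma f_basin: "z \<in> basin \<Longrightarrow> f z \<in> basin"
  using iter_basin[of z 1] by simp

lemma hyperbolic_dist_basin:
  assumes "z \<in> basin" "w \<in> basin"
  shows "hyperbolic_dist basin z w = 2 * artanh (norm (Moebius_function 0 (q w) (q z)))"
  using hyperbolic_dist_conformal[OF q_inv_conformal q_in_disc[OF assms(1)] q_in_disc[OF assms(2)]]
  by (simp add: q_inv_q assms disc_hyperbolic_dist_Moebius)

text \<open>Schwarz-Pick for \<open>q\<close> on a Euclidean disc in the basin: hyperbolic distance
  is controlled by Euclidean distance relative to the size of the disc.\<close>

lemma norm_Moebius_q_le: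
  assumes "ball w r \<subseteq> basin" "norm (z - w) < r"
  shows "norm (Moebius_function 0 (q w) (q z)) \<le> norm (z - w) / r"
proof -
  have r: "r > 0" using assms(2) by (meson le_less_trans norm_ge_zero)
  define m where "m \<xi> = w + of_real r * \<xi>" for \<xi>
  have m: "m \<xi> \<in> basin" if "\<xi> \<in> unit_disc" for \<xi>
  proof -
    have "m \<xi> \<in> ball w r" using that r by (simp add: m_def dist_norm norm_mult)
    then show ?thesis using assms(1) by blast
  qed
  have "(q \<circ> m) holomorphic_on unit_disc"
    by (rule holomorphic_on_compose_gen[OF _ q_holomorphic]) (use m in \<open>auto simp: m_def[abs_def] intro!: holomorphic_intros\<close>)
  moreover have "(q \<circ> m) ` unit_disc \<subseteq> unit_disc" using m q_in_disc by auto
  moreover have a: "(z - w) / of_real r \<in> unit_disc" using assms(2) r by (simp add: norm_divide)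
  ultimately have "norm (Moebius_function 0 ((q \<circ> m) 0) ((q \<circ> m) ((z - w) / of_real r)))
      \<le> norm (Moebius_function 0 0 ((z - w) / of_real r))"
    by (intro Schwarz_Pick centre_in_ball[THEN iffD2] zero_less_one)
  then show ?thesis using r by (simp add: m_def Moebius_function_simple norm_divide)
qed

lemma f_minus_id_tendsto_0:
  assumes "z \<in> basin"
  shows "(\<lambda>k. norm ((f ^^ Suc k) z - (f ^^ k) z)) \<longlonglongrightarrow> 0"
proof (rule LIMSEQ_I)
  fix \<epsilon> :: real assume "\<epsilon> > 0"
  then obtain M where M: "\<And>z. Re z > M \<Longrightarrow> norm (f z - z) < \<epsilon>" using f_minus_id_small by blast
  have "\<forall>\<^sub>F k in sequentially. Re ((f ^^ k) z) > M"
    using Re_iter_at_top[OF assms] by (auto simp: filterlim_at_top_dense)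
  then show "\<exists>no. \<forall>k\<ge>no. norm (norm ((f ^^ Suc k) z - (f ^^ k) z) - 0) < \<epsilon>"
    using M by (auto simp: eventually_sequentially)
qed

text \<open>The Euclidean steps tend to 0, while the orbit, once in the petal, keeps a fixed
  distance from the frontier by \<open>cpetal_margin\<close>.\<close>

lemma hyperbolic_step:
  assumes z: "z \<in> basin"
  shows "(\<lambda>k. norm (Moebius_function 0 (q ((f ^^ Suc k) z)) (q ((f ^^ k) z)))) \<longlonglongrightarrow> 0"
proof -
  obtain r where r: "r > 0" "\<And>z. z \<in> cpetal \<Longrightarrow> ball z r \<subseteq> basin" using cpetal_margin by blast
  have "\<forall>\<^sub>F k in sequentially. (f ^^ k) z \<in> petal"
    using eventually_petal_on_compact[of "{z}" 0] z by (auto elim: eventually_mono)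
  then have 1: "\<forall>\<^sub>F k in sequentially. (f ^^ Suc k) z \<in> petal"
    using eventually_sequentially_Suc[of "\<lambda>k. (f ^^ k) z \<in> petal"] by blast
  have "\<forall>\<^sub>F k in sequentially. norm ((f ^^ Suc k) z - (f ^^ k) z) < r"
    using order_tendstoD(2)[OF f_minus_id_tendsto_0[OF z] r(1)] .
  with 1 have bound: "\<forall>\<^sub>F k in sequentially. norm (Moebius_function 0 (q ((f ^^ Suc k) z)) (q ((f ^^ k) z)))
      \<le> norm ((f ^^ Suc k) z - (f ^^ k) z) / r"
  proof eventually_elim
    case (elim k)
    then show ?case
      using norm_Moebius_q_le[OF r(2), of "(f ^^ Suc k) z" "(f ^^ k) z"] petal_subset_cpetal
      by (auto simp: norm_minus_commute)
  qed
  show ?thesis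
  proof (rule tendsto_sandwich[OF _ bound tendsto_const])
    show "(\<lambda>k. norm ((f ^^ Suc k) z - (f ^^ k) z) / r) \<longlonglongrightarrow> 0"
      using tendsto_divide[OF f_minus_id_tendsto_0[OF z] tendsto_const[of r]] r(1) by simp
  qed simp
qed

lemma doubly_parabolic_basin: "doubly_parabolic_baker_domain f basin"
  unfolding doubly_parabolic_baker_domain_def
proof (intro conjI ballI baker_domain_basin simply_connected_basin)
  fix z assume z: "z \<in> basin"
  have "(\<lambda>k. 2 * artanh (norm (Moebius_function 0 (q ((f ^^ Suc k) z)) (q ((f ^^ k) z))))) \<longlonglongrightarrow> 2 * artanh 0"
    by (intro tendsto_intros hyperbolic_step[OF z]) auto
  then show "(\<lambda>k. hyperbolic_dist basin ((f ^^ k) z) ((f ^^ Suc k) z)) \<longlonglongrightarrow> 0"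
    using z iter_basin by (simp add: hyperbolic_dist_basin f_basin)
qed

text \<open>The orbit escapes, so its image leaves every compact subset of the disc; being positive
  real, it can only tend to 1.\<close>

lemma q_real_orbit_tendsto_1: "(\<lambda>k. q ((f ^^ k) 1)) \<longlonglongrightarrow> 1"
proof -
  have pos: "\<exists>y>0. q ((f ^^ k) 1) = of_real y" for k
    using iter_one_of_real[of k] q_of_real_pos by metis
  have one: "1 \<in> basin" using of_real_in_basin[of 1] by simp
  have "(\<lambda>k. norm (q ((f ^^ k) 1))) \<longlonglongrightarrow> 1"
  proof (rule order_tendstoI)
    fix s :: real assume s: "s < 1"
    have comp: "compact (q_inv ` cball 0 s)"
    proof (rule compact_continuous_image)
      have "q_inv holomorphic_on unit_disc" using q_inv_conformal by (simp add: conformal_onto_def)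
      then show "continuous_on (cball 0 s) q_inv"
        using s by (intro continuous_on_subset[OF holomorphic_on_imp_continuous_on]) auto
    qed simp
    then obtain B where B: "\<And>z. z \<in> q_inv ` cball 0 s \<Longrightarrow> norm z \<le> B"
      using compact_imp_bounded bounded_iff by metis
    have "\<forall>\<^sub>F k in sequentially. Re ((f ^^ k) 1) > B"
      using Re_iter_at_top[OF one] by (auto simp: filterlim_at_top_dense)
    then show "\<forall>\<^sub>F k in sequentially. norm (q ((f ^^ k) 1)) > s"
    proof eventually_elim
      case (elim k)
      show ?case
      proof (rule ccontr)
        assume "\<not> ?thesis"
        then have "q_inv (q ((f ^^ k) 1)) \<in> q_inv ` cball 0 s" by (intro imageI) auto
        then have "norm ((f ^^ k) 1) \<le> B" using B by (simp add: q_inv_q iter_basin one)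
        then show False using elim complex_Re_le_cmod[of "(f ^^ k) 1"] by linarith
      qed
    qed
  next
    fix s :: real assume "1 < s"
    then show "\<forall>\<^sub>F k in sequentially. norm (q ((f ^^ k) 1)) < s"
      using q_in_disc iter_basin[OF one] by (intro always_eventually allI) (metis less_trans mem_ball_0)
  qed
  then have "(\<lambda>k. complex_of_real (norm (q ((f ^^ k) 1)))) \<longlonglongrightarrow> of_real 1" by (rule tendsto_of_real)
  moreover have "complex_of_real (norm (q ((f ^^ k) 1))) = q ((f ^^ k) 1)" for k
    using pos[of k] by auto
  ultimately show ?thesis by simp
qed

text \<open>By Schwarz-Pick for the iterates, the orbit of \<open>z\<close> stays within a fixed
  hyperbolic distance of the orbit of 1.\<close>

lemma q_orbit_tendsto_1:
  assumes z: "z \<in> basin"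
  shows "(\<lambda>k. q ((f ^^ k) z)) \<longlonglongrightarrow> 1"
proof (rule tendsto_unit_circle_bounded_hyperbolic)
  have one: "1 \<in> basin" using of_real_in_basin[of 1] by simp
  show "q ((f ^^ k) z) \<in> unit_disc" "q ((f ^^ k) 1) \<in> unit_disc" for k
    using q_in_disc iter_basin z one by auto
  show "norm (Moebius_function 0 (q 1) (q z)) < 1"
    using q_in_disc[OF z] q_in_disc[OF one] by (simp add: Moebius_function_norm_lt_1)
  show "norm (Moebius_function 0 (q ((f ^^ k) 1)) (q ((f ^^ k) z))) \<le> norm (Moebius_function 0 (q 1) (q z))" for k
  proof -
    define h where "h = q \<circ> ((f ^^ k) \<circ> q_inv)"
    have "q_inv holomorphic_on unit_disc" "q_inv ` unit_disc \<subseteq> basin"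
      using q_inv_conformal by (auto simp: conformal_onto_def bij_betw_def)
    then have h: "h holomorphic_on unit_disc"
      unfolding h_def
      by (intro holomorphic_on_compose_gen[OF _ q_holomorphic] holomorphic_on_compose_gen[OF _ iter_holomorphic[of k UNIV]])
        (auto simp: iter_basin)
    have him: "h ` unit_disc \<subseteq> unit_disc"
      using \<open>q_inv ` unit_disc \<subseteq> basin\<close> iter_basin q_in_disc by (auto simp: h_def)
    have "norm (Moebius_function 0 (h (q 1)) (h (q z))) \<le> norm (Moebius_function 0 (q 1) (q z))"
      by (rule Schwarz_Pick[OF h him q_in_disc[OF z] q_in_disc[OF one]])
    then show ?thesis by (simp add: h_def q_inv_q z one)
  qed
qed (use q_real_orbit_tendsto_1 in auto)

text \<open>
  The multiplier of the Denjoy--Wolff point is 1 because the hyperbolic steps of the real orbit,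
  computed in the half-plane coordinate \<open>(1 + y) / (1 - y)\<close>, tend to 0.
\<close>

lemma multiplier_one: "1 + c = real (Suc n) * (1 - c)"
proof -
  have one: "1 \<in> basin" using of_real_in_basin[of 1] by simp
  define y where "y k = Re (q ((f ^^ k) 1))" for k
  have ylim: "y \<longlonglongrightarrow> 1"
    using tendsto_Re[OF q_real_orbit_tendsto_1] by (simp add: y_def[abs_def])
  have qy: "q ((f ^^ k) 1) = of_real (y k)" and ypos: "y k > 0" for k
  proof -
    obtain t where "t > 0" "q ((f ^^ k) 1) = of_real t" using iter_one_of_real[of k] q_of_real_pos by metis
    then show "q ((f ^^ k) 1) = of_real (y k)" "y k > 0" by (auto simp: y_def)
  qed
  have y1: "y k < 1" for k
    using q_in_disc[OF iter_basin[OF one, of k]] qy[of k] ypos[of k] by simp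
  define X where "X k = (1 + y k) / (1 - y k)" for k
  define \<rho> where "\<rho> k = X (Suc k) / X k" for k
  have Xpos: "X k > 0" for k using ypos[of k] y1[of k] by (simp add: X_def)
  define \<kappa> where "\<kappa> = (1 + c) / (1 - c)"
  have \<kappa>: "\<kappa> > 0" using c_pos c_less_1 by (simp add: \<kappa>_def)
  have ySuc: "y (Suc k) = (y k ^ Suc n + c) / (1 + c * y k ^ Suc n)" for k
  proof -
    have "q ((f ^^ Suc k) 1) = g (q ((f ^^ k) 1))" using q_f[OF iter_basin[OF one, of k]] by simp
    then have "complex_of_real (y (Suc k)) = of_real ((y k ^ Suc n + c) / (1 + c * y k ^ Suc n))"
      by (simp only: qy blaschke_eq) simp
    then show ?thesis using of_real_eq_iff by blast
  qed
  have XSuc: "X (Suc k) = \<kappa> * ((1 + y k ^ Suc n) / (1 - y k ^ Suc n))" for k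
  proof -
    define p where "p = y k ^ Suc n"
    have p: "0 < p" "p < 1" unfolding p_def using ypos[of k] y1[of k] by (simp_all add: power_less_one_iff del: power_Suc)
    have den: "1 + c * p > 0" using c_pos p by (simp add: add_pos_pos)
    have "1 + (p + c) / (1 + c * p) = (1 + c) * (1 + p) / (1 + c * p)"
      using den by (simp add: field_simps)
    moreover have "1 - (p + c) / (1 + c * p) = (1 - c) * (1 - p) / (1 + c * p)"
      using den by (simp add: field_simps)
    ultimately show ?thesis
      unfolding X_def ySuc p_def[symmetric] \<kappa>_def using den p by simp
  qed
  have \<rho>eq: "\<rho> k = \<kappa> * (1 + y k ^ Suc n) / ((1 + y k) * (\<Sum>j<Suc n. y k ^ j))" for k
  proof -
    have "1 - y k ^ Suc n = (1 - y k) * (\<Sum>j<Suc n. y k ^ j)" by (rule one_diff_power_eq)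
    then show ?thesis
      unfolding \<rho>_def XSuc unfolding X_def using y1[of k] by (simp del: power_Suc sum.lessThan_Suc)
  qed
  have "(\<lambda>k. \<kappa> * (1 + y k ^ Suc n) / ((1 + y k) * (\<Sum>j<Suc n. y k ^ j))) \<longlonglongrightarrow>
      \<kappa> * (1 + 1 ^ Suc n) / ((1 + 1) * (\<Sum>j<Suc n. 1 ^ j))"
    by (intro tendsto_intros ylim) simp
  \<comment> \<open>The limit is the reciprocal of \<open>(n + 1) * (1 - c) / (1 + c)\<close>, the
    derivative of \<open>g\<close> at 1.\<close>
  then have \<rho>lim: "\<rho> \<longlonglongrightarrow> \<kappa> / real (Suc n)"
    unfolding \<rho>eq[symmetric] by (simp del: of_nat_Suc)
  \<comment> \<open>In the half-plane coordinate the hyperbolic distance of two real points depends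
    only on the ratio of their coordinates.\<close>
  have step: "norm (Moebius_function 0 (q ((f ^^ Suc k) 1)) (q ((f ^^ k) 1))) = \<bar>1 - \<rho> k\<bar> / (1 + \<rho> k)" for k
  proof -
    define a where "a = y k" define b where "b = y (Suc k)"
    have ab: "0 < a" "a < 1" "0 < b" "b < 1" using ypos y1 by (auto simp: a_def b_def)
    have "a * b < 1" using ab by (metis mult_strict_mono mult_1 less_imp_le zero_less_one)
    have n1: "norm (Moebius_function 0 (q ((f ^^ Suc k) 1)) (q ((f ^^ k) 1))) = \<bar>a - b\<bar> / (1 - a * b)"
    proof -
      have "Moebius_function 0 (q ((f ^^ Suc k) 1)) (q ((f ^^ k) 1)) = of_real ((a - b) / (1 - b * a))"
        unfolding qy Moebius_function_simple a_def b_def by simp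
      then show ?thesis using \<open>a * b < 1\<close> by (simp only: norm_of_real) (simp add: abs_divide mult.commute)
    qed
    have r: "\<rho> k = ((1 + b) * (1 - a)) / ((1 - b) * (1 + a))"
      by (simp add: \<rho>_def X_def a_def b_def)
    have D: "(1 - b) * (1 + a) > 0" using ab by simp
    define D' where "D' = (1 - b) * (1 + a)"
    define N' where "N' = (1 + b) * (1 - a)"
    have D': "D' > 0" using D by (simp add: D'_def)
    have r': "\<rho> k = N' / D'" by (simp only: r D'_def N'_def)
    have "1 - N' / D' = (D' - N') / D'" using D' by (simp add: diff_divide_distrib)
    moreover have "D' - N' = 2 * (a - b)" by (simp add: D'_def N'_def algebra_simps)
    ultimately have 1: "1 - \<rho> k = (2 * (a - b)) / D'" by (simp only: r')
    have "1 + N' / D' = (D' + N') / D'" using D' by (simp add: add_divide_distrib)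
    moreover have "D' + N' = 2 * (1 - a * b)" by (simp add: D'_def N'_def algebra_simps)
    ultimately have 2: "1 + \<rho> k = (2 * (1 - a * b)) / D'" by (simp only: r')
    have "\<bar>2 * (a - b) / D'\<bar> = 2 * \<bar>a - b\<bar> / D'" using D' by (simp only: abs_divide abs_mult)
    moreover have "(2 * x / D') / (2 * w / D') = x / w" for x w
      using D' by (simp only: divide_divide_eq_left divide_divide_eq_right) simp
    ultimately have "\<bar>1 - \<rho> k\<bar> / (1 + \<rho> k) = \<bar>a - b\<bar> / (1 - a * b)"
      unfolding 1 2 by metis
    then show ?thesis using n1 by simp
  qed
  define L where "L = \<kappa> / real (Suc n)"
  have L: "L > 0" using \<kappa> by (simp add: L_def)
  have "(\<lambda>k. \<bar>1 - \<rho> k\<bar> / (1 + \<rho> k)) \<longlonglongrightarrow> \<bar>1 - L\<bar> / (1 + L)"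
    using L by (intro tendsto_intros \<rho>lim[folded L_def]) auto
  moreover have "(\<lambda>k. \<bar>1 - \<rho> k\<bar> / (1 + \<rho> k)) \<longlonglongrightarrow> 0"
    using hyperbolic_step[OF one] by (simp only: step)
  ultimately have "\<bar>1 - L\<bar> / (1 + L) = 0" using LIMSEQ_unique by blast
  then have "L = 1" using L by simp
  then have "\<kappa> = real (Suc n)" by (simp add: L_def del: of_nat_Suc)
  then show ?thesis using c_less_1 by (simp add: \<kappa>_def field_simps)
qed

end

section \<open>Expansion near the boundary\<close>

text \<open>This is \<open>k * tan s < tan (k * s)\<close> without denominators, so that the end
  \<open>k * s = pi / 2\<close> is included. The addition formulas express the difference of the two
  sides for \<open>k + 1\<close> by the one for \<open>k\<close> plus a positive term.\<close>

lemma sin_cos_multiple_angle_less: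
  fixes s :: real
  assumes "k \<ge> 2" "0 < s" "real k * s \<le> pi / 2"
  shows "real k * sin s * cos (real k * s) < cos s * sin (real k * s)"
proof -
  have strict: "real (Suc k) * sin s * cos (real (Suc k) * s) < cos s * sin (real (Suc k) * s)"
    if k: "k \<ge> 1" "real (Suc k) * s \<le> pi / 2"
      and IH: "real k * sin s * cos (real k * s) \<le> cos s * sin (real k * s)" for k
  proof -
    have ks: "0 < real k * s" "real k * s \<le> pi / 2" "s \<le> pi / 2"
    proof -
      show "0 < real k * s" using k(1) assms(2) by simp
      moreover have "real (Suc k) * s = real k * s + s" by (simp add: algebra_simps)
      ultimately show "real k * s \<le> pi / 2" "s \<le> pi / 2" using k(2) assms(2) by linarith+
    qed
    have s1: "sin s > 0" and c1: "cos s \<ge> 0" and sk: "sin (real k * s) > 0"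
      using ks assms(2) pi_gt_zero by (auto intro!: sin_gt_zero cos_ge_zero)
    have e: "real (Suc k) * s = real k * s + s" by (simp add: algebra_simps)
    have "cos s * sin (real (Suc k) * s) - real (Suc k) * sin s * cos (real (Suc k) * s) =
        cos s * (cos s * sin (real k * s) - real k * sin s * cos (real k * s)) + real (Suc k) * (sin s)\<^sup>2 * sin (real k * s)"
      unfolding e sin_add cos_add by (simp add: algebra_simps power2_eq_square)
    moreover have "\<dots> > 0"
      using IH s1 c1 sk by (intro add_nonneg_pos mult_nonneg_nonneg mult_pos_pos) auto
    ultimately show ?thesis by linarith
  qed
  have weak: "real k * sin s * cos (real k * s) \<le> cos s * sin (real k * s)"
    if "k \<ge> 1" "real k * s \<le> pi / 2" for k
    using that
  proof (induction k rule: dec_induct)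
    case (step k)
    have "real k * s \<le> real (Suc k) * s" using assms(2) by (intro mult_right_mono) auto
    then have "real k * sin s * cos (real k * s) \<le> cos s * sin (real k * s)"
      using step.IH step.prems by linarith
    then show ?case using strict[OF step.hyps(1) step.prems] by simp
  qed simp
  obtain j where j: "k = Suc j" "j \<ge> 1" using assms(1) by (cases k) auto
  have "real j * s \<le> real k * s" using assms(2) j by (intro mult_right_mono) auto
  then have "real j * s \<le> pi / 2" using assms(3) by linarith
  then show ?thesis using strict[OF j(2) _ weak[OF j(2)]] assms(3) j(1) by simp
qed

definition sector :: "nat \<Rightarrow> complex set" where
  "sector d = (\<lambda>(t, \<theta>). of_real t * cis \<theta>) ` ({0..1} \<times> {0..pi / real d})"

lemma closed_sector: "closed (sector d)"
  unfolding sector_def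
  by (intro compact_imp_closed compact_continuous_image compact_Times)
    (auto simp: split_beta intro!: continuous_intros)

lemma in_sector:
  assumes "norm p \<le> 1" "d > 0" "Im (p ^ d) > 0" "p = root_fun d (p ^ d)"
  shows "p \<in> sector d"
proof -
  define \<theta> where "\<theta> = Im (Ln (p ^ d)) / real d"
  have "0 < Im (Ln (p ^ d))" "Im (Ln (p ^ d)) < pi"
    using assms(3) Im_Ln_pos_lt_imp[of "p ^ d"] by auto
  then have "\<theta> \<in> {0..pi / real d}" using assms(2) by (auto simp: \<theta>_def divide_right_mono)
  moreover have "p = of_real (norm p) * cis \<theta>"
  proof -
    have "p = exp (Ln (p ^ d) / of_nat d)" using assms(4) by (simp add: root_fun_def)
    then have "p = of_real (norm (exp (Ln (p ^ d) / of_nat d))) * cis \<theta>"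
      by (metis \<theta>_def Im_divide_of_nat exp_eq_polar norm_exp_eq_Re)
    then show ?thesis using \<open>p = exp (Ln (p ^ d) / of_nat d)\<close> by metis
  qed
  ultimately show ?thesis using assms(1) unfolding sector_def by (auto intro!: image_eqI[of _ _ "(norm p, \<theta>)"])
qed

text \<open>For \<open>p = cis (2 * s)\<close>, \<open>S = sin (d * s)\<close> and
  \<open>C = cos (d * s)\<close>, the squared distances to 1 are \<open>4 * sin s ^ 2\<close> and
  \<open>4 * S ^ 2 / (d ^ 2 * C ^ 2 + S ^ 2)\<close>, the latter because \<open>mult\<close> gives
  derivative 1 at the fixed point 1. The claim becomes \<open>d * tan s < tan (d * s)\<close>, which
  the sector makes available.\<close>

lemma blaschke_expands_on_sector:
  assumes d: "d \<ge> 2" and c: "0 < c" "c < 1" and mult: "1 + c = real d * (1 - c)"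
    and p: "p \<in> sector d" "norm p = 1" "p \<noteq> 1"
  shows "norm (1 - p) < norm (1 - blaschke d c p)"
proof -
  obtain t \<theta> where t: "t \<in> {0..1}" "\<theta> \<in> {0..pi / real d}" "p = of_real t * cis \<theta>"
    using p(1) by (auto simp: sector_def)
  have "t = 1" using t p(2) by (simp add: norm_mult)
  then have p\<theta>: "p = cis \<theta>" using t by simp
  have "\<theta> \<noteq> 0" using p(3) p\<theta> by auto
  then have \<theta>: "\<theta> > 0" using t by simp
  define s where "s = \<theta> / 2"
  have ds: "real d * s \<le> pi / 2" and s: "s > 0"
    using t(2) \<theta> d by (auto simp: s_def field_simps)
  have s2: "s \<le> pi / 2"
  proof -
    have "1 * s \<le> real d * s" using d s by (intro mult_right_mono) auto
    then show ?thesis using ds by simp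
  qed
  define S C s1 c1 where "S = sin (real d * s)" and "C = cos (real d * s)" and "s1 = sin s" and "c1 = cos s"
  have key: "real d * s1 * C < c1 * S"
    unfolding S_def C_def s1_def c1_def by (rule sin_cos_multiple_angle_less[OF d s ds])
  have pos: "S > 0" "C \<ge> 0" "s1 > 0"
  proof -
    have "real d * s > 0" using d s by simp
    moreover have "real d * s < pi" "s < pi" using ds s2 pi_gt_zero by linarith+
    moreover have "- (pi / 2) \<le> real d * s" using \<open>real d * s > 0\<close> pi_gt_zero by linarith
    ultimately show "S > 0" "C \<ge> 0" "s1 > 0"
      unfolding S_def C_def s1_def using s ds by (auto intro!: sin_gt_zero cos_ge_zero)
  qed
  have sq: "S\<^sup>2 + C\<^sup>2 = 1" "s1\<^sup>2 + c1\<^sup>2 = 1" by (simp_all add: S_def C_def s1_def c1_def)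
  have norm1: "(norm (1 - cis (2 * x)))\<^sup>2 = 4 * (sin x)\<^sup>2" for x
  proof -
    have "(norm (1 - cis (2 * x)))\<^sup>2 = (1 - cos (2 * x))\<^sup>2 + (sin (2 * x))\<^sup>2"
      by (simp add: cmod_power2)
    also have "\<dots> = 2 - 2 * cos (2 * x)"
      using sin_cos_squared_add[of "2 * x"] by (simp add: power2_eq_square algebra_simps)
    also have "\<dots> = 4 * (sin x)\<^sup>2" by (simp add: cos_double_sin)
    finally show ?thesis .
  qed
  have pd: "p ^ d = cis (2 * (real d * s))" by (simp add: p\<theta> Complex.DeMoivre s_def)
  have den: "1 + of_real c * p ^ d \<noteq> 0" by (rule blaschke_denominator) (use c p in auto)
  have "1 - blaschke d c p = of_real (1 - c) * (1 - p ^ d) / (1 + of_real c * p ^ d)"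
    using den by (simp add: blaschke_eq divide_simps) (simp add: algebra_simps)
  then have "(norm (1 - blaschke d c p))\<^sup>2 = (1 - c)\<^sup>2 * (norm (1 - p ^ d))\<^sup>2 / (norm (1 + of_real c * p ^ d))\<^sup>2"
    by (simp only: norm_divide norm_mult power_divide power_mult_distrib norm_of_real power2_abs)
  also have "(norm (1 - p ^ d))\<^sup>2 = 4 * S\<^sup>2" unfolding pd norm1 S_def ..
  also have "(norm (1 + of_real c * p ^ d))\<^sup>2 = (1 - c)\<^sup>2 * ((real d)\<^sup>2 * C\<^sup>2 + S\<^sup>2)"
  proof -
    have "(norm (1 + of_real c * p ^ d))\<^sup>2 = (1 + c * cos (2 * (real d * s)))\<^sup>2 + (c * sin (2 * (real d * s)))\<^sup>2"
      unfolding pd by (simp add: cmod_power2)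
    also have "\<dots> = 1 + 2 * c * cos (2 * (real d * s)) + c\<^sup>2"
      by (simp add: power_mult_distrib sin_squared_eq power2_sum algebra_simps)
    also have "cos (2 * (real d * s)) = C\<^sup>2 - S\<^sup>2" by (simp only: cos_double C_def S_def)
    also have "1 + 2 * c * (C\<^sup>2 - S\<^sup>2) + c\<^sup>2 = (1 + c)\<^sup>2 * C\<^sup>2 + (1 - c)\<^sup>2 * S\<^sup>2"
    proof -
      have "(1 + c)\<^sup>2 * C\<^sup>2 + (1 - c)\<^sup>2 * S\<^sup>2 = (S\<^sup>2 + C\<^sup>2) * (1 + c\<^sup>2) + 2 * c * (C\<^sup>2 - S\<^sup>2)"
        by (simp add: power2_sum power2_diff algebra_simps)
      then show ?thesis by (simp add: sq(1))
    qed
    also have "\<dots> = (1 - c)\<^sup>2 * ((real d)\<^sup>2 * C\<^sup>2 + S\<^sup>2)"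
      unfolding mult power_mult_distrib by (simp add: distrib_left mult_ac)
    finally show ?thesis .
  qed
  finally have n: "(norm (1 - blaschke d c p))\<^sup>2 = 4 * S\<^sup>2 / ((real d)\<^sup>2 * C\<^sup>2 + S\<^sup>2)"
    using c by simp
  have D: "(real d)\<^sup>2 * C\<^sup>2 + S\<^sup>2 > 0" using pos by (simp add: add_nonneg_pos)
  have "(real d * s1 * C)\<^sup>2 < (c1 * S)\<^sup>2"
    using key pos by (intro power_strict_mono) auto
  then have "s1\<^sup>2 * ((real d)\<^sup>2 * C\<^sup>2) < (1 - s1\<^sup>2) * S\<^sup>2"
    using sq(2) by (simp add: power_mult_distrib mult_ac eq_diff_eq[symmetric])
  then have "4 * s1\<^sup>2 * ((real d)\<^sup>2 * C\<^sup>2 + S\<^sup>2) < 4 * S\<^sup>2" by (simp add: algebra_simps)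
  then have "4 * s1\<^sup>2 < 4 * S\<^sup>2 / ((real d)\<^sup>2 * C\<^sup>2 + S\<^sup>2)" using D by (simp add: pos_less_divide_eq)
  moreover have "(norm (1 - p))\<^sup>2 = 4 * s1\<^sup>2" using norm1[of s] by (simp add: p\<theta> s_def s1_def)
  ultimately have "(norm (1 - p))\<^sup>2 < (norm (1 - blaschke d c p))\<^sup>2" using n by simp
  then show ?thesis by (metis norm_ge_zero power_less_imp_less_base)
qed

context strip_map
begin

section \<open>Branches near the right end of the strip\<close>

lemma u_tendsto_1_at_right:
  assumes "\<epsilon> > 0"
  shows "\<exists>M. \<forall>z. Re z > M \<longrightarrow> norm (u z ^ n - 1) < \<epsilon>"
proof -
  have "isCont (\<lambda>w::complex. (1 - w) ^ n) 0" by (intro continuous_intros)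
  then obtain \<delta> where \<delta>: "\<delta> > 0" "\<And>w::complex. norm w < \<delta> \<Longrightarrow> norm ((1 - w) ^ n - 1) < \<epsilon>"
    using assms unfolding continuous_at_eps_delta by (auto simp: dist_norm)
  have "norm (u z ^ n - 1) < \<epsilon>" if "Re z > - ln \<delta>" for z
  proof -
    have "exp (- Re z) < exp (ln \<delta>)" using that by simp
    then have "norm (exp (- z)) < \<delta>" using \<delta>(1) by simp
    then show ?thesis using \<delta>(2) by (simp add: u_def)
  qed
  then show ?thesis by blast
qed

text \<open>\<open>f\<close> is real on the real axis and \<open>f'\<close> is within 1/2 of 1, so
  at least half of \<open>Im z\<close> survives.\<close>

lemma Im_f_pos_far_right: "\<exists>M. \<forall>z. Re z > M \<and> Im z > 0 \<longrightarrow> Im (f z) > 0"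
proof -
  obtain M where M: "\<And>z. Re z > M \<Longrightarrow> norm (u z ^ n - 1) < 1 / 2"
    using u_tendsto_1_at_right[of "1/2"] by auto
  have "Im (f z) > 0" if z: "Re z > M" "Im z > 0" for z
  proof -
    have "norm ((f z - z) - (f (of_real (Re z)) - of_real (Re z))) \<le> 1 / 2 * norm (z - of_real (Re z))"
    proof (rule field_differentiable_bound[of "{z. Re z > M}" _ "\<lambda>z. u z ^ n - 1"])
      show "convex {z. Re z > M}" by (rule convex_halfspace_Re_gt)
      show "((\<lambda>z. f z - z) has_field_derivative u z ^ n - 1) (at z within {z. Re z > M})" for z
        by (intro DERIV_diff f_has_field_derivative DERIV_ident)
    qed (use M z in \<open>auto intro: less_imp_le\<close>)
    also have "z - of_real (Re z) = \<i> * of_real (Im z)" by (simp add: complex_eq_iff)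
    also have "norm \<dots> = Im z" using z by (simp add: norm_mult)
    finally have "norm ((f z - z) - (f (of_real (Re z)) - of_real (Re z))) \<le> Im z / 2" by simp
    then have "\<bar>Im ((f z - z) - (f (of_real (Re z)) - of_real (Re z)))\<bar> \<le> Im z / 2"
      using abs_Im_le_cmod order_trans by blast
    then have "\<bar>Im (f z) - Im z\<bar> \<le> Im z / 2" by (simp add: f_of_real)
    then show ?thesis using z by linarith
  qed
  then show ?thesis by blast
qed

text \<open>Both sides are continuous \<open>(n + 1)\<close>-st roots of the same function on the
  connected set \<open>Z\<close>. The set includes its real boundary, where both are
  positive.\<close>

lemma \<zeta>_eq_root_fun_far_right:
  "\<exists>M\<ge>0. \<forall>z\<in>strip. Re z > M \<and> Im z > 0 \<longrightarrow>
     Im (f z) > 0 \<and> \<zeta> z = root_fun (Suc n) (f z - of_real crit_val)"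
proof -
  obtain M0 where M0: "\<And>z. Re z > M0 \<Longrightarrow> Im z > 0 \<Longrightarrow> Im (f z) > 0"
    using Im_f_pos_far_right by blast
  define M where "M = max M0 0"
  define Z where "Z = {z. Re z > M} \<inter> ({z. Im z \<ge> 0} \<inter> {z. Im z < pi})"
  have Zstrip: "Z \<subseteq> strip" using pi_gt_zero by (auto simp: Z_def strip_def)
  have real_case: "\<exists>t>0. \<zeta> z = of_real t \<and> f z - of_real crit_val = of_real t ^ Suc n"
    if z0: "Im z = 0" "Re z > 0" for z
  proof -
    have z: "z = of_real (Re z)" using z0 by (simp add: complex_eq_iff)
    obtain t where t: "t > 0" "\<zeta> (of_real (Re z)) = of_real t" using \<zeta>_of_real_pos[OF z0(2)] by blast
    have "f (of_real (Re z)) - of_real crit_val = of_real t ^ Suc n"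
      by (metis \<zeta>_power of_real_in_strip t(2))
    with t z show ?thesis by metis
  qed
  have nonpos: "f z - of_real crit_val \<notin> \<real>\<^sub>\<le>\<^sub>0" if "z \<in> Z" for z
  proof (cases "Im z = 0")
    case True
    have "Re z > 0" using that by (auto simp: Z_def M_def)
    then obtain t where "t > 0" "f z - of_real crit_val = of_real t ^ Suc n"
      using real_case[OF True] by blast
    moreover from this have "f z - of_real crit_val = of_real (t ^ Suc n)" by simp
    ultimately show ?thesis by (metis linorder_not_less nonpos_Reals_of_real_iff zero_less_power)
  next
    case False
    then have "Im (f z) > 0" using that by (intro M0) (auto simp: Z_def M_def)
    then show ?thesis by (intro Im_pos_not_nonpos) simp
  qed
  have conn: "connected Z"
    unfolding Z_def
    by (intro convex_connected convex_Int convex_halfspace_Re_gt convex_halfspace_Im_lt convex_halfspace_Im_ge)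
  have cont: "continuous_on Z (\<lambda>z. \<zeta> z / root_fun (Suc n) (f z - of_real crit_val))"
    by (intro continuous_intros root_fun_continuous continuous_on_subset[OF \<zeta>_continuous Zstrip] f_continuous nonpos) auto
  have pow: "(\<zeta> z / root_fun (Suc n) (f z - of_real crit_val)) ^ Suc n = 1" if "z \<in> Z" for z
  proof -
    have "f z - of_real crit_val \<noteq> 0" using nonpos[OF that] by auto
    then show ?thesis
      unfolding power_divide using \<zeta>_power[of z] Zstrip that by (subst root_fun_power) auto
  qed
  obtain \<omega> where \<omega>: "\<And>z. z \<in> Z \<Longrightarrow> \<zeta> z / root_fun (Suc n) (f z - of_real crit_val) = \<omega>"
    by (rule power_eq_1_constant[OF conn cont zero_less_Suc pow]) (assumption, blast intro: that)
  define x where "x = complex_of_real (M + 1)"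
  have x: "x \<in> Z" "Im x = 0" "Re x > 0" using pi_gt_zero by (auto simp: x_def Z_def M_def)
  obtain t where "t > 0" "\<zeta> x = of_real t" "f x - of_real crit_val = of_real t ^ Suc n"
    using real_case[OF x(2,3)] by blast
  then have "\<omega> = 1" using \<omega>[OF x(1)] root_fun_of_real_power[of t "Suc n"] by simp
  then have "\<zeta> z = root_fun (Suc n) (f z - of_real crit_val)" if "z \<in> Z" for z
    using \<omega>[OF that] by simp
  moreover have "z \<in> Z" if "z \<in> strip" "Re z > M" "Im z > 0" for z
    using that by (auto simp: Z_def strip_def)
  ultimately show ?thesis using M0 by (intro exI[of _ M]) (auto simp: M_def)
qed

section \<open>Margins and inverse branches at the frontier\<close>

lemma frontier_basin_strip: "x \<in> frontier basin \<Longrightarrow> \<bar>Im x\<bar> \<le> pi \<and> x \<notin> basin"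
  using closure_mono[OF basin_subset_strip] closure_strip open_basin
  by (auto simp: frontier_def interior_open)

text \<open>
  The set where \<open>\<bar>f'\<bar> \<le> 1\<close> is the union of the translates of the closed petal by \<open>2\<pi>i\<int>\<close>.
\<close>

lemma frontier_basin_margin:
  "\<exists>r>0. \<forall>x\<in>frontier basin. \<forall>z\<in>ball x r. norm (u z) > 1"
proof -
  obtain r where r: "r > 0" "\<And>z. z \<in> cpetal \<Longrightarrow> ball z r \<subseteq> basin" using cpetal_margin by blast
  have "norm (u z) > 1" if x: "x \<in> frontier basin" and z: "z \<in> ball x r" for x z
  proof (rule ccontr)
    assume "\<not> ?thesis"
    then have u1: "norm (u z) \<le> 1" by simp
    \<comment> \<open>The translation by \<open>p\<close> that brings the imaginary part of
      \<open>z\<close> into \<open>[- pi, pi]\<close>.\<close>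
    define k where "k = round (Im z / (2 * pi))"
    define p where "p = \<i> * (of_int k * (of_real pi * 2))"
    have "exp (- (z - p)) = exp (- z)"
      using exp_plus_2pin[of "- z" k] by (simp add: p_def)
    then have up: "norm (u (z - p)) \<le> 1" using u1 by (simp add: u_def)
    have Imp: "Im p = 2 * pi * of_int k" by (simp add: p_def)
    have "\<bar>Im z / (2 * pi) - of_int k\<bar> \<le> 1 / 2"
      unfolding k_def using of_int_round_abs_le[of "Im z / (2 * pi)"] by (simp add: abs_minus_commute)
    then have "\<bar>2 * pi * (Im z / (2 * pi) - of_int k)\<bar> \<le> 2 * pi * (1 / 2)"
      unfolding abs_mult by (intro mult_mono) auto
    then have le: "\<bar>Im (z - p)\<bar> \<le> pi" by (simp add: Imp algebra_simps)
    have "cos (Im (z - p)) > 0"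
      using up exp_gt_zero[of "- Re (z - p)"] unfolding norm_u_le_1_iff by linarith
    then have "cos \<bar>Im (z - p)\<bar> > 0" by (simp only: cos_abs_real)
    have "\<bar>Im (z - p)\<bar> \<noteq> pi"
    proof
      assume eq: "\<bar>Im (z - p)\<bar> = pi"
      show False using \<open>cos \<bar>Im (z - p)\<bar> > 0\<close> unfolding eq by simp
    qed
    then have "z - p \<in> cpetal" using le up by (auto simp: cpetal_def strip_def)
    moreover have "x - p \<in> ball (z - p) r" using z by (simp add: dist_norm norm_minus_commute)
    ultimately have xp: "x - p \<in> basin" using r(2) by blast
    then have "\<bar>Im (x - p)\<bar> < pi" using basin_subset_strip by (auto simp: strip_def)
    \<comment> \<open>\<open>x\<close> lies in the closed strip and \<open>x - p\<close> in the open
      one, so the translation is trivial and \<open>x\<close> would be in the basin.\<close>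
    then have "\<bar>2 * pi * of_int k\<bar> < 2 * pi"
    proof -
      have "\<bar>Im x\<bar> \<le> pi" using frontier_basin_strip[OF x] by blast
      moreover have "\<bar>Im x - 2 * pi * of_int k\<bar> < pi" using \<open>\<bar>Im (x - p)\<bar> < pi\<close> Imp by simp
      ultimately show ?thesis by linarith
    qed
    then have "\<bar>of_int k\<bar> < (1::real)" by (simp add: abs_mult)
    then have "k = 0" by linarith
    then show False using xp frontier_basin_strip[OF x] by (simp add: p_def)
  qed
  then show ?thesis using r(1) by blast
qed

text \<open>On a disc of radius \<open>\<rho>\<close> independent of \<open>y\<close> the derivative
  stays within half its size of its value \<open>a\<close> at \<open>y\<close>, and
  \<open>|a| >= 1\<close>. Hence \<open>f\<close> is injective there, shrinks distances at most by
  the factor 1/2, and covers the disc of radius \<open>\<rho> / 4\<close> around \<open>f y\<close>.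
  The last clause ties the branch to \<open>y\<close>.\<close>

lemma uniform_inverse_branch:
  "\<exists>r>0. \<forall>y. norm (u y) > 1 \<longrightarrow>
     (\<exists>F \<epsilon>. \<epsilon> > 0 \<and> F holomorphic_on ball (f y) r \<and> (\<forall>z\<in>ball (f y) r. f (F z) = z) \<and>
        (\<forall>z\<in>ball y \<epsilon>. F (f z) = z))"
proof -
  have "isCont (\<lambda>w::complex. (1 + w) ^ n) 0" by (intro continuous_intros)
  moreover have "(0::real) < 1 / 2" by simp
  ultimately obtain \<eta> where \<eta>: "\<eta> > 0" "\<And>w::complex. norm w < \<eta> \<Longrightarrow> norm ((1 + w) ^ n - 1) < 1 / 2"
    unfolding continuous_at_eps_delta dist_norm by (metis diff_zero add_0_right power_one)
  have "isCont exp (0::complex)" by (rule isCont_exp)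
  then have "\<exists>d>0. \<forall>w::complex. norm (w - 0) < d \<longrightarrow> norm (exp w - exp 0) < \<eta> / 2"
    using \<eta>(1) half_gt_zero unfolding continuous_at_eps_delta dist_norm by blast
  then obtain \<rho> where \<rho>: "\<rho> > 0" "\<And>w::complex. norm w < \<rho> \<Longrightarrow> norm (exp w - 1) < \<eta> / 2" by auto
  have "\<exists>F \<epsilon>. \<epsilon> > 0 \<and> F holomorphic_on ball (f y) (\<rho>/4) \<and> (\<forall>z\<in>ball (f y) (\<rho>/4). f (F z) = z) \<and>
      (\<forall>z\<in>ball y \<epsilon>. F (f z) = z)" if y: "norm (u y) > 1" for y
  proof -
    define a where "a = u y ^ n"
    have a1: "norm a \<ge> 1" using y by (simp add: a_def norm_power one_le_power)
    have uy0: "u y \<noteq> 0" using y by auto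
    have deriv_close: "norm (u z ^ n - a) \<le> norm a / 2" if z: "z \<in> ball y \<rho>" for z
    proof -
      \<comment> \<open>\<open>w\<close> is the relative change of \<open>u\<close> from
        \<open>y\<close> to \<open>z\<close>. The factor \<open>(1 - u y) / u y\<close> has modulus
        at most 2 because \<open>|u y| > 1\<close>; this is what makes \<open>\<rho>\<close>
        independent of \<open>y\<close>.\<close>
      define w where "w = (1 - u y) / u y * (1 - exp (- (z - y)))"
      have "exp (- z) = exp (- y) * exp (- (z - y))" by (simp flip: exp_add)
      then have "u z = u y + (1 - u y) * (1 - exp (- (z - y)))" by (simp add: u_def algebra_simps)
      also have "\<dots> = u y * (1 + w)" using uy0 by (simp add: w_def field_simps)
      finally have uz: "u z = u y * (1 + w)" .
      have "norm ((1 - u y) / u y) \<le> 2"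
      proof -
        have "norm (1 - u y) \<le> 1 + norm (u y)" by (metis norm_one norm_triangle_ineq4)
        then show ?thesis using y by (simp add: norm_divide divide_simps)
      qed
      moreover have "norm (exp (- (z - y)) - 1) < \<eta> / 2"
        using z by (intro \<rho>(2)) (simp add: dist_norm)
      ultimately have "norm w < \<eta>"
      proof -
        have "norm w = norm ((1 - u y) / u y) * norm (1 - exp (- (z - y)))" unfolding w_def norm_mult ..
        also have "\<dots> \<le> 2 * norm (1 - exp (- (z - y)))"
          using \<open>norm ((1 - u y) / u y) \<le> 2\<close> by (intro mult_right_mono) auto
        also have "\<dots> < 2 * (\<eta> / 2)"
          using \<open>norm (exp (- (z - y)) - 1) < \<eta> / 2\<close> by (simp add: norm_minus_commute)
        finally show ?thesis by simp
      qed
      then have "norm ((1 + w) ^ n - 1) \<le> 1 / 2" using \<eta>(2) by (intro less_imp_le) auto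
      moreover have "u z ^ n - a = a * ((1 + w) ^ n - 1)"
        unfolding uz a_def power_mult_distrib by (simp add: algebra_simps)
      ultimately show ?thesis
        using mult_left_mono[of "norm ((1 + w) ^ n - 1)" "1/2" "norm a"] by (simp add: norm_mult)
    qed
    have expand: "norm (f z1 - f z2) \<ge> norm (z1 - z2) / 2" if z: "z1 \<in> ball y \<rho>" "z2 \<in> ball y \<rho>" for z1 z2
    proof -
      have "norm ((f z1 - a * z1) - (f z2 - a * z2)) \<le> norm a / 2 * norm (z1 - z2)"
        by (rule field_differentiable_bound[of "ball y \<rho>" _ "\<lambda>z. u z ^ n - a"])
          (use z deriv_close in \<open>auto intro!: derivative_eq_intros f_has_field_derivative\<close>)
      moreover have "(f z1 - a * z1) - (f z2 - a * z2) = (f z1 - f z2) - a * (z1 - z2)"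
        by (simp add: algebra_simps)
      moreover have "norm (a * (z1 - z2)) - norm (f z1 - f z2) \<le> norm ((f z1 - f z2) - a * (z1 - z2))"
        by (metis norm_minus_commute norm_triangle_ineq2)
      ultimately have "norm a * norm (z1 - z2) - norm (f z1 - f z2) \<le> norm a / 2 * norm (z1 - z2)"
        by (simp add: norm_mult)
      moreover have "1 * norm (z1 - z2) \<le> norm a * norm (z1 - z2)" using a1 by (intro mult_right_mono) auto
      ultimately show ?thesis by simp
    qed
    have inj: "inj_on f (ball y \<rho>)"
      using expand by (intro inj_onI) (metis divide_eq_0_iff norm_le_zero_iff norm_zero order_antisym norm_ge_zero right_minus_eq zero_neq_numeral divide_nonneg_nonneg zero_le_numeral)
    obtain F where F: "F holomorphic_on f ` ball y \<rho>" "\<And>z. z \<in> ball y \<rho> \<Longrightarrow> F (f z) = z"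
      using holomorphic_has_inverse[OF f_holomorphic open_ball inj] by metis
    have sub: "ball (f y) (\<rho>/4) \<subseteq> f ` ball y (\<rho>/2)"
    proof (rule ball_subset_open_map_image)
      show "continuous_on (closure (ball y (\<rho> / 2))) f" by (rule f_continuous)
      have "inj_on f (ball y (\<rho>/2))" using inj \<rho>(1) by (auto intro: inj_on_subset)
      then show "open (f ` interior (ball y (\<rho> / 2)))"
        using open_mapping_thm3[OF f_holomorphic open_ball] by (simp add: interior_open)
      show "\<rho> / 4 \<le> norm (f z - f y)" if "z \<in> frontier (ball y (\<rho> / 2))" for z
        using expand[of z y] that \<rho>(1) by (auto simp: frontier_ball dist_norm norm_minus_commute)
    qed (use \<rho>(1) in auto)
    also have "\<dots> \<subseteq> f ` ball y \<rho>" using \<rho>(1) by auto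
    finally have sub: "ball (f y) (\<rho>/4) \<subseteq> f ` ball y \<rho>" .
    have "F holomorphic_on ball (f y) (\<rho>/4)" by (rule holomorphic_on_subset[OF F(1) sub])
    moreover have "f (F z) = z" if "z \<in> ball (f y) (\<rho>/4)" for z
      using sub that F(2) by auto
    ultimately show ?thesis using F(2) \<rho>(1) by blast
  qed
  then show ?thesis using \<rho>(1) by (intro exI[of _ "\<rho>/4"]) auto
qed

text \<open>On the connected set \<open>H\<close> the branch never takes values on the boundary
  lines, as \<open>f\<close> preserves them and \<open>H\<close> is in the open strip. It takes one
  value in the strip, at the image of a basin point near \<open>y\<close>, so all its values on
  \<open>H\<close> lie there, and relative complete invariance of the basin finishes.\<close>

lemma inverse_branch_basin:
  assumes r: "r > 0" and x: "x \<in> frontier basin" and y: "y \<in> frontier basin" and fy: "f y = x"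
    and F: "F holomorphic_on ball x r" "\<And>z. z \<in> ball x r \<Longrightarrow> f (F z) = z"
    and \<epsilon>: "\<epsilon> > 0" "\<And>z. z \<in> ball y \<epsilon> \<Longrightarrow> F (f z) = z"
  shows "F ` (ball x r \<inter> basin) \<subseteq> basin"
proof
  fix w assume "w \<in> F ` (ball x r \<inter> basin)"
  then obtain v where v: "v \<in> ball x r" "v \<in> basin" "w = F v" by auto
  define H where "H = ball x r \<inter> strip"
  define I where "I = (\<lambda>z. Im (F z)) ` H"
  have "continuous_on H F"
    using F(1) by (auto simp: H_def intro: continuous_on_subset[OF holomorphic_on_imp_continuous_on])
  then have connI: "connected I"
    unfolding I_def H_def
    by (intro connected_continuous_image continuous_intros convex_connected convex_Int convex_ball convex_strip) auto
  have notin: "\<bar>t\<bar> \<noteq> pi" if "t \<in> I" for t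
  proof
    assume "\<bar>t\<bar> = pi"
    then obtain z where z: "z \<in> H" "\<bar>Im (F z)\<bar> = pi" using \<open>t \<in> I\<close> by (auto simp: I_def)
    then have "\<bar>Im (f (F z))\<bar> = pi" using f_boundary_line(1) by simp
    then show False using F(2) z(1) by (auto simp: H_def strip_def)
  qed
  have "y \<in> closure basin" using y by (simp add: frontier_def)
  moreover have "open (ball y \<epsilon> \<inter> f -` ball x r)" by (intro open_Int open_ball open_vimage f_continuous)
  moreover have "y \<in> ball y \<epsilon> \<inter> f -` ball x r" using fy r \<epsilon>(1) by simp
  ultimately obtain a where a: "a \<in> basin" "a \<in> ball y \<epsilon>" "f a \<in> ball x r"
    using open_Int_closure_eq_empty[of "ball y \<epsilon> \<inter> f -` ball x r" basin] by blast
  have "f a \<in> H" using a basin_subset_strip f_in_basin_iff by (auto simp: H_def)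
  then have "Im (F (f a)) \<in> I" by (auto simp: I_def)
  then have aI: "Im a \<in> I" using \<epsilon>(2)[OF a(2)] by simp
  have a_lt: "\<bar>Im a\<bar> < pi" using a(1) basin_subset_strip by (auto simp: strip_def)
  have vI: "Im (F v) \<in> I" using v basin_subset_strip by (auto simp: I_def H_def)
  have "\<bar>Im (F v)\<bar> < pi"
  proof (rule ccontr)
    assume "\<not> ?thesis"
    then have "Im (F v) \<ge> pi \<or> Im (F v) \<le> - pi" by linarith
    then have "pi \<in> I \<or> - pi \<in> I"
      using connectedD_interval[OF connI aI vI, of pi] connectedD_interval[OF connI vI aI, of "- pi"] a_lt
      unfolding abs_less_iff by (smt (verit))
    then show False using notin[of pi] notin[of "- pi"] pi_gt_zero by auto
  qed
  then have "w \<in> strip" using v(3) by (simp add: strip_def)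
  moreover have "f w \<in> basin" using F(2)[OF v(1)] v by simp
  ultimately show "w \<in> basin" using f_in_basin_iff by blast
qed

text \<open>With \<open>Re\<close> bounded above, the relevant points range over a compact set on
  which \<open>|u| > 1\<close>, except far to the left, where \<open>|exp (- z)| > 3\<close> gives
  \<open>|u| > 2\<close> directly.\<close>

lemma expansion_bounded_Re:
  assumes r: "r > 0" "\<And>x z. x \<in> frontier basin \<Longrightarrow> z \<in> ball x (2 * r) \<Longrightarrow> norm (u z) > 1"
    and E: "E \<subseteq> frontier basin" "\<And>w. w \<in> E \<Longrightarrow> Re w \<le> M"
  shows "\<exists>K>1. \<forall>x\<in>E. \<forall>z\<in>ball x r. norm (deriv f z) \<ge> K"
proof -
  define D where "D = {z. norm (u z) \<le> 1}"
  \<comment> \<open>Expansion on discs of radius \<open>2 * r\<close> leaves every point of a disc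
    of radius \<open>r\<close> at distance at least \<open>r\<close> from \<open>D\<close>. This
    closed condition is what makes \<open>N\<close> compact.\<close>
  define N where "N = (\<Inter>w\<in>D. {z. r \<le> dist z w}) \<inter> {z. \<bar>Im z\<bar> \<le> pi + r \<and> - ln 3 \<le> Re z \<and> Re z \<le> M + r}"
  have "closed N"
    unfolding N_def by (intro closed_Int closed_INT ballI closed_Collect_conj closed_Collect_le continuous_intros)
  moreover have "bounded N"
  proof -
    have "norm z \<le> (ln 3 + \<bar>M + r\<bar>) + (pi + r)" if "z \<in> N" for z
    proof -
      have "- ln 3 \<le> Re z" "Re z \<le> M + r" "0 \<le> ln (3::real)" using that by (auto simp: N_def)
      then have "\<bar>Re z\<bar> \<le> ln 3 + \<bar>M + r\<bar>" by linarith
      moreover have "\<bar>Im z\<bar> \<le> pi + r" using that by (auto simp: N_def)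
      ultimately show ?thesis using cmod_le[of z] by linarith
    qed
    then show ?thesis by (auto simp: bounded_iff)
  qed
  ultimately have N: "compact N" by (simp add: compact_eq_bounded_closed)
  have N1: "norm (u z) > 1" if "z \<in> N" for z
  proof (rule ccontr)
    assume "\<not> ?thesis"
    then have "z \<in> D" by (simp add: D_def)
    then have "r \<le> dist z z" using that by (auto simp: N_def)
    then show False using r by simp
  qed
  obtain k where k: "k > 1" "\<And>z. z \<in> N \<Longrightarrow> norm (u z) \<ge> k"
  proof (cases "N = {}")
    case True
    then show thesis using that[of 2] by auto
  next
    case False
    have "continuous_on N (\<lambda>z. norm (u z))" by (intro continuous_intros)
    then obtain z0 where "z0 \<in> N" "\<And>z. z \<in> N \<Longrightarrow> norm (u z0) \<le> norm (u z)"
      using continuous_attains_inf[OF N False] by metis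
    then show thesis using that[of "norm (u z0)"] N1 by auto
  qed
  have "norm (deriv f z) \<ge> min k 2" if x: "x \<in> E" and z: "z \<in> ball x r" for x z
  proof -
    have xf: "x \<in> frontier basin" using x E by blast
    have d: "norm (x - z) < r" using z by (simp add: dist_norm)
    have "\<bar>Re x - Re z\<bar> < r" "\<bar>Im x - Im z\<bar> < r"
      using abs_Re_le_cmod[of "x - z"] abs_Im_le_cmod[of "x - z"] d by auto
    then have reim: "Re z \<le> M + r" "\<bar>Im z\<bar> \<le> pi + r"
      using E(2)[OF x] frontier_basin_strip[OF xf] by linarith+
    have "norm (u z) \<ge> min k 2"
    proof (cases "Re z \<ge> - ln 3")
      case True
      have "r \<le> dist z w" if "w \<in> D" for w
      proof (rule ccontr)
        assume "\<not> ?thesis"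
        then have "w \<in> ball x (2 * r)" using z dist_triangle[of x w z] by simp
        then have "norm (u w) > 1" using r(2) xf by blast
        then show False using that by (simp add: D_def)
      qed
      then have "z \<in> N" using True reim by (auto simp: N_def)
      then show ?thesis using k(2) by fastforce
    next
      case False
      then have "ln 3 < - Re z" by linarith
      then have "exp (ln 3) < exp (- Re z)" by (simp only: exp_less_cancel_iff)
      then have "norm (exp (- z)) > 3" by simp
      moreover have "norm (exp (- z)) - 1 \<le> norm (u z)"
        unfolding u_def by (metis norm_minus_commute norm_one norm_triangle_ineq2)
      ultimately show ?thesis by simp
    qed
    moreover have "norm (u z) \<ge> 1" using r z xf by (intro less_imp_le r(2)) auto
    then have "norm (u z) \<le> norm (u z) ^ n" using n_pos by (intro self_le_power) auto
    ultimately show ?thesis by (simp add: deriv_f norm_power)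
  qed
  then show ?thesis using k(1) by (intro exI[of _ "min k 2"]) auto
qed

end

section \<open>Boundary orbits and finite targets\<close>

lemma Cayley_conformal: "conformal_onto (\<lambda>t. (t - \<i>) / (t + \<i>)) upper_half_plane unit_disc"
  unfolding conformal_onto_def
proof
  have ne: "t + \<i> \<noteq> 0" if "Im t > 0" for t
    using that by (auto simp: complex_eq_iff)
  then show "(\<lambda>t. (t - \<i>) / (t + \<i>)) holomorphic_on upper_half_plane"
    by (intro holomorphic_intros) auto
  have norm_less: "norm (t - \<i>) < norm (t + \<i>)" if "Im t > 0" for t
  proof -
    have "(norm (t - \<i>))\<^sup>2 < (norm (t + \<i>))\<^sup>2"
      using that unfolding cmod_power2 by (simp add: power2_eq_square algebra_simps)
    then show ?thesis by (metis norm_ge_zero power_less_imp_less_base)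
  qed
  show "bij_betw (\<lambda>t. (t - \<i>) / (t + \<i>)) upper_half_plane unit_disc"
  proof (rule bij_betw_byWitness[where f' = "\<lambda>p. \<i> * (1 + p) / (1 - p)"])
    show "\<forall>t\<in>upper_half_plane. \<i> * (1 + (t - \<i>) / (t + \<i>)) / (1 - (t - \<i>) / (t + \<i>)) = t"
    proof
      fix t assume "t \<in> upper_half_plane"
      then have t: "t + \<i> \<noteq> 0" using ne by simp
      have "1 + (t - \<i>) / (t + \<i>) = 2 * t / (t + \<i>)" "1 - (t - \<i>) / (t + \<i>) = 2 * \<i> / (t + \<i>)"
        using t by (simp_all add: divide_simps)
      then show "\<i> * (1 + (t - \<i>) / (t + \<i>)) / (1 - (t - \<i>) / (t + \<i>)) = t"
        using t by simp
    qed
    show "\<forall>p\<in>unit_disc. (\<i> * (1 + p) / (1 - p) - \<i>) / (\<i> * (1 + p) / (1 - p) + \<i>) = p"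
    proof
      fix p :: complex assume "p \<in> unit_disc"
      then have p: "1 - p \<noteq> 0" by auto
      have "\<i> * (1 + p) / (1 - p) - \<i> = 2 * \<i> * p / (1 - p)" "\<i> * (1 + p) / (1 - p) + \<i> = 2 * \<i> / (1 - p)"
        using p by (simp_all add: divide_simps) (simp_all add: algebra_simps)
      then show "(\<i> * (1 + p) / (1 - p) - \<i>) / (\<i> * (1 + p) / (1 - p) + \<i>) = p"
        using p by simp
    qed
    show "(\<lambda>t. (t - \<i>) / (t + \<i>)) ` upper_half_plane \<subseteq> unit_disc"
      using norm_less ne by (auto simp: norm_divide divide_simps)
    show "(\<lambda>p. \<i> * (1 + p) / (1 - p)) ` unit_disc \<subseteq> upper_half_plane"
    proof clarify
      fix p :: complex assume p: "p \<in> unit_disc"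
      have "(norm p)\<^sup>2 < 1" using p by (simp add: abs_square_less_1)
      moreover have "\<i> * (1 + p) / (1 - p) = \<i> * ((1 + p) * cnj (1 - p)) / of_real ((norm (1 - p))\<^sup>2)"
        by (subst complex_div_cnj) simp
      moreover have "Im (\<i> * ((1 + p) * cnj (1 - p))) = 1 - (norm p)\<^sup>2"
        unfolding cmod_power2 by (simp add: power2_eq_square algebra_simps)
      moreover have "norm (1 - p) > 0" using p by auto
      ultimately show "Im (\<i> * (1 + p) / (1 - p)) > 0"
        by (simp only: Im_divide_of_real) simp
    qed
  qed
qed

lemma Cayley_norm_real: "norm ((of_real x - \<i>) / (of_real x + \<i>)) = 1"
proof -
  have "norm (of_real x - \<i>) = norm (of_real x + \<i>)"
    by (simp add: cmod_def)
  moreover have "of_real x + \<i> \<noteq> 0" by (simp add: complex_eq_iff)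
  ultimately show ?thesis by (simp add: norm_divide)
qed

lemma Cayley_tendsto_at_infinity:
  assumes "filterlim X at_infinity F"
  shows "((\<lambda>k. (X k - \<i>) / (X k + \<i>)) \<longlongrightarrow> 1) F"
proof -
  have "filterlim (\<lambda>k. X k + \<i>) at_infinity F"
    using tendsto_add_filterlim_at_infinity'[OF assms tendsto_const[of \<i>]] .
  then have "((\<lambda>k. 2 * \<i> / (X k + \<i>)) \<longlongrightarrow> 0) F"
    by (intro tendsto_divide_0[OF tendsto_const])
  then have "((\<lambda>k. 1 - 2 * \<i> / (X k + \<i>)) \<longlongrightarrow> 1 - 0) F"
    by (intro tendsto_intros)
  moreover have "\<forall>\<^sub>F k in F. 1 - 2 * \<i> / (X k + \<i>) = (X k - \<i>) / (X k + \<i>)"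
  proof -
    have "\<forall>\<^sub>F k in F. norm (X k) \<ge> 2"
      using assms by (simp add: filterlim_at_infinity[of 0])
    then show ?thesis
    proof eventually_elim
      case (elim k)
      have "X k + \<i> \<noteq> 0"
      proof
        assume "X k + \<i> = 0"
        then have "X k = - \<i>" by (simp add: eq_neg_iff_add_eq_0)
        then show False using elim by simp
      qed
      then show ?case by (simp add: field_simps)
    qed
  qed
  ultimately show ?thesis
    using Lim_transform_eventually by fastforce
qed

lemma conjugated_map_iter:
  assumes \<phi>: "bij_betw \<phi> S U" and f: "f ` U \<subseteq> U" and t: "t \<in> S"
  shows "(conjugated_map f \<phi> S ^^ k) t \<in> S" and "\<phi> ((conjugated_map f \<phi> S ^^ k) t) = (f ^^ k) (\<phi> t)"
proof -
  have "(conjugated_map f \<phi> S ^^ k) t \<in> S \<and> \<phi> ((conjugated_map f \<phi> S ^^ k) t) = (f ^^ k) (\<phi> t)"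
  proof (induction k)
    case (Suc k)
    let ?s = "(conjugated_map f \<phi> S ^^ k) t"
    have "\<phi> ?s \<in> U" using Suc bij_betwE[OF \<phi>] by blast
    then have "f (\<phi> ?s) \<in> \<phi> ` S" using f \<phi> by (auto simp: bij_betw_def)
    then have "inv_into S \<phi> (f (\<phi> ?s)) \<in> S" "\<phi> (inv_into S \<phi> (f (\<phi> ?s))) = f (\<phi> ?s)"
      by (auto intro: inv_into_into f_inv_into_f)
    moreover have "(conjugated_map f \<phi> S ^^ Suc k) t = inv_into S \<phi> (f (\<phi> ?s))"
      unfolding funpow.simps o_apply by (simp only: conjugated_map_def o_apply)
    ultimately show ?case using Suc by simp
  qed (use t in simp)
  then show "(conjugated_map f \<phi> S ^^ k) t \<in> S" "\<phi> ((conjugated_map f \<phi> S ^^ k) t) = (f ^^ k) (\<phi> t)"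
    by auto
qed

context disc_model
begin

lemma c_abs: "\<bar>c\<bar> < 1"
  using c_pos c_less_1 by simp

lemma f_image_basin: "f ` basin \<subseteq> basin"
  using f_basin by blast

lemma norm_g_unit: "norm p = 1 \<Longrightarrow> norm (g p) = 1"
  unfolding blaschke_def using c_abs by (intro norm_Moebius_function_unit) (simp_all add: norm_power del: power_Suc)

text \<open>An arbitrary Riemann map differs from the inverse of \<open>q\<close> by a disc
  automorphism. Its inner function is thus conjugate to the rational map \<open>g\<close>, which is
  analytic on the whole circle, and its Denjoy-Wolff point corresponds to 1.\<close>

lemma Denjoy_Wolff_basin:
  assumes \<phi>: "conformal_onto \<phi> unit_disc basin"
  shows "\<exists>\<zeta>. denjoy_wolff_point (conjugated_map f \<phi> unit_disc) \<zeta> \<and>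
    \<not> inner_singularity (conjugated_map f \<phi> unit_disc) \<zeta>"
proof -
  define G where "G = conjugated_map f \<phi> unit_disc"
  have \<phi>bij: "bij_betw \<phi> unit_disc basin" using \<phi> by (simp add: conformal_onto_def)
  obtain \<alpha> a where \<alpha>: "norm \<alpha> = 1" "norm a < 1"
      "\<And>p. p \<in> unit_disc \<Longrightarrow> (q \<circ> \<phi>) p = \<alpha> * Moebius_function 0 a p"
    using conformal_onto_unit_disc_eq_Moebius[OF conformal_onto_comp[OF \<phi> q_conformal]] by blast
  have \<alpha>0: "\<alpha> \<noteq> 0" using \<alpha>(1) by auto
  have na: "norm (- a) < 1" using \<alpha>(2) by simp
  have inv: "p = Moebius_function 0 (- a) (q (\<phi> p) / \<alpha>)" if p: "p \<in> unit_disc" for p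
  proof -
    have "q (\<phi> p) / \<alpha> = Moebius_function 0 a p" using \<alpha>(3)[OF p] \<alpha>0 by simp
    moreover have "Moebius_function 0 (- a) (Moebius_function 0 a p) = p"
      using \<alpha>(2) p by (intro Moebius_function_compose) auto
    ultimately show ?thesis by simp
  qed
  define \<zeta>0 where "\<zeta>0 = Moebius_function 0 (- a) (1 / \<alpha>)"
  have n1: "norm (1 / \<alpha>) = 1" using \<alpha>(1) by (simp add: norm_divide)
  have n\<zeta>: "norm \<zeta>0 = 1" unfolding \<zeta>0_def by (rule norm_Moebius_function_unit[OF na n1])
  have dw: "denjoy_wolff_point G \<zeta>0"
    unfolding denjoy_wolff_point_def
  proof (intro conjI ballI)
    show "\<zeta>0 \<in> sphere 0 1" using n\<zeta> by simp
    fix p :: complex assume p: "p \<in> unit_disc"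
    have "\<phi> p \<in> basin" using \<phi>bij p by (auto simp: bij_betw_def)
    have "(\<lambda>k. q ((f ^^ k) (\<phi> p)) / \<alpha>) \<longlonglongrightarrow> 1 / \<alpha>"
      using \<alpha>0 by (intro tendsto_intros q_orbit_tendsto_1[OF \<open>\<phi> p \<in> basin\<close>])
    then have "(\<lambda>k. Moebius_function 0 (- a) (q ((f ^^ k) (\<phi> p)) / \<alpha>)) \<longlonglongrightarrow> \<zeta>0"
      unfolding \<zeta>0_def by (rule tendsto_disc_automorphism[OF na n1])
    moreover have "Moebius_function 0 (- a) (q ((f ^^ k) (\<phi> p)) / \<alpha>) = (G ^^ k) p" for k
      using inv[of "(G ^^ k) p"] conjugated_map_iter[OF \<phi>bij f_image_basin p, of k] by (simp add: G_def)
    ultimately show "(\<lambda>k. (G ^^ k) p) \<longlonglongrightarrow> \<zeta>0" by simp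
  qed
  define h where "h z = Moebius_function 0 (- a) (g (\<alpha> * Moebius_function 0 a z) / \<alpha>)" for z
  have hG: "h p = G p" if p: "p \<in> unit_disc" for p
  proof -
    have "\<phi> p \<in> basin" using \<phi>bij p by (auto simp: bij_betw_def)
    have "G p \<in> unit_disc" "\<phi> (G p) = f (\<phi> p)"
      using conjugated_map_iter[OF \<phi>bij f_image_basin p, of 1] by (auto simp: G_def)
    then have "G p = Moebius_function 0 (- a) (q (f (\<phi> p)) / \<alpha>)" using inv by metis
    then show ?thesis using q_f[OF \<open>\<phi> p \<in> basin\<close>] \<alpha>(3)[OF p] by (simp add: h_def)
  qed
  have den: "1 - cnj b * w \<noteq> 0" if "norm b < 1" "norm w = 1" for b w
    using that by (metis complex_mod_cnj mult.right_neutral norm_mult norm_one order_less_irrefl right_minus_eq)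
  have an1: "(\<lambda>z. \<alpha> * Moebius_function 0 a z) analytic_on {\<zeta>0}"
    unfolding Moebius_function_simple by (intro analytic_intros) (use den[OF \<alpha>(2) n\<zeta>] in auto)
  have nw: "norm (\<alpha> * Moebius_function 0 a \<zeta>0) = 1"
    using \<alpha>(1) norm_Moebius_function_unit[OF \<alpha>(2) n\<zeta>] by (simp add: norm_mult)
  have g_analytic: "(\<lambda>z. g (k z)) analytic_on {x}" if "k analytic_on {x}" "norm (k x) \<le> 1" for k x
    unfolding blaschke_eq by (intro analytic_intros that(1))
      (use blaschke_denominator[OF c_abs that(2), of "Suc n"] in \<open>simp del: power_Suc\<close>)
  have an2: "(\<lambda>z. g (\<alpha> * Moebius_function 0 a z)) analytic_on {\<zeta>0}"
    using nw by (intro g_analytic an1) simp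
  have nw2: "norm (g (\<alpha> * Moebius_function 0 a \<zeta>0) / \<alpha>) = 1"
    using norm_g_unit[OF nw] \<alpha>(1) by (simp add: norm_divide)
  have "h analytic_on {\<zeta>0}"
    unfolding h_def[abs_def] Moebius_function_simple[of "- a"]
    by (intro analytic_intros an2) (use den[OF na nw2] \<alpha>0 in auto)
  then obtain e where "e > 0" "h holomorphic_on ball \<zeta>0 e" by (auto simp: analytic_at_ball)
  then have "\<not> inner_singularity G \<zeta>0"
    unfolding inner_singularity_def using hG by blast
  with dw show ?thesis unfolding G_def by blast
qed

section \<open>The upper half of the basin in the model\<close>

lemma Moebius_c_q: "z \<in> basin \<Longrightarrow> Moebius_function 0 (of_real c) (q (f z)) = q z ^ Suc n"
  using q_f q_in_disc c_abs norm_power[of "q z" "Suc n"] power_less_one_iff[of "norm (q z)" "Suc n"]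
  by (auto simp: blaschke_def intro!: Moebius_function_compose simp del: power_Suc)

lemma Im_Moebius_real_pos:
  assumes b: "\<bar>b\<bar> < 1" and p: "norm p < 1" "Im p > 0"
  shows "Im (Moebius_function 0 (of_real b) p) > 0"
proof -
  have "1 - cnj (of_real b) * p \<noteq> 0"
  proof
    assume "1 - cnj (of_real b) * p = 0"
    then have "\<bar>b\<bar> * norm p = 1" by (metis complex_cnj_complex_of_real norm_mult norm_of_real norm_one right_minus_eq)
    moreover have "\<bar>b\<bar> * norm p < 1 * 1" using b p(1) by (intro mult_strict_mono') auto
    ultimately show False by simp
  qed
  then have n: "norm (1 - of_real b * p) > 0" by simp
  have "Moebius_function 0 (of_real b) p
      = (p - of_real b) * cnj (1 - of_real b * p) / of_real ((norm (1 - of_real b * p))\<^sup>2)"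
    unfolding Moebius_function_simple by (subst complex_div_cnj) simp
  moreover have "Im ((p - of_real b) * cnj (1 - of_real b * p)) = (1 - b\<^sup>2) * Im p"
    by (simp add: algebra_simps power2_eq_square)
  moreover have "(1 - b\<^sup>2) * Im p > 0" using b p by (simp add: abs_square_less_1)
  ultimately show ?thesis using n by (simp only: Im_divide_of_real) simp
qed

text \<open>By symmetry and injectivity \<open>q\<close> is real exactly on the real axis, so
  \<open>Im\<close> has one sign on the preimage of the upper half disc. A point near 0 shows that
  this sign is positive.\<close>

lemma upper_basin:
  shows "connected {z \<in> basin. Im z > 0}" and "\<And>z. z \<in> basin \<Longrightarrow> Im z > 0 \<Longrightarrow> Im (q z) > 0"
proof -
  define P where "P = unit_disc \<inter> {p. Im p > 0}"
  have connP: "connected P"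
    unfolding P_def by (intro convex_connected convex_Int convex_ball convex_halfspace_Im_gt)
  have q_real: "Im (q z) = 0 \<longleftrightarrow> Im z = 0" if z: "z \<in> basin" for z
  proof
    assume "Im (q z) = 0"
    then have "cnj (q z) = q z" by (simp add: complex_eq_iff)
    then have "q (cnj z) = q z" using q_cnj[OF z] by simp
    then have "cnj z = z" using q_inj z by (auto simp: inj_on_def)
    then show "Im z = 0" by (simp add: complex_eq_iff)
  next
    assume "Im z = 0"
    then have "cnj z = z" by (simp add: complex_eq_iff)
    then have "cnj (q z) = q z" using q_cnj[OF z] by simp
    then show "Im (q z) = 0" by (simp add: complex_eq_iff)
  qed
  have qinv_cont: "continuous_on unit_disc q_inv"
    using q_inv_conformal by (auto simp: conformal_onto_def intro: holomorphic_on_imp_continuous_on)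
  define J where "J = (\<lambda>p. Im (q_inv p)) ` P"
  have "connected J"
    unfolding J_def using connP
    by (intro connected_continuous_image continuous_intros continuous_on_subset[OF qinv_cont]) (auto simp: P_def)
  have J0: "0 \<notin> J"
    using q_real q_inv_in_basin q_q_inv by (fastforce simp: J_def P_def)
  \<comment> \<open>The derivative \<open>D\<close> at 0 is positive, as seen along the positive
    axis; approaching 0 along the imaginary axis then gives a point with both imaginary parts
    positive.\<close>
  have ex: "\<exists>z\<in>basin. Im z > 0 \<and> Im (q z) > 0"
  proof -
    define D where "D = deriv q 0"
    have zb: "0 \<in> basin" using of_real_in_basin[of 0] by simp
    have D0: "D \<noteq> 0" unfolding D_def
      by (rule holomorphic_injective_imp_regular[OF q_holomorphic open_basin q_inj zb])
    have "(q has_field_derivative D) (at 0)"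
      unfolding D_def by (rule holomorphic_derivI[OF q_holomorphic open_basin zb])
    then have lim: "((\<lambda>w. q w / w) \<longlongrightarrow> D) (at 0)"
      by (simp add: has_field_derivative_iff q_0)
    have at0: "filterlim (\<lambda>k. w * of_real (inverse (real (Suc k)))) (at 0) sequentially" if "w \<noteq> 0" for w :: complex
    proof -
      have "(\<lambda>k. w * of_real (inverse (real (Suc k)))) \<longlonglongrightarrow> w * of_real 0"
        by (intro tendsto_intros LIMSEQ_inverse_real_of_nat)
      then show ?thesis using that by (auto simp: filterlim_at simp del: of_nat_Suc)
    qed
    have "(\<lambda>k. q (1 * of_real (inverse (real (Suc k)))) / (1 * of_real (inverse (real (Suc k))))) \<longlonglongrightarrow> D"
      by (rule filterlim_compose[OF lim at0]) simp
    moreover have "\<exists>y>0. q (1 * of_real (inverse (real (Suc k)))) / (1 * of_real (inverse (real (Suc k)))) = of_real y" for k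
    proof -
      obtain y where "y > 0" "q (of_real (inverse (real (Suc k)))) = of_real y"
        using q_of_real_pos[of "inverse (real (Suc k))"] by auto
      then show ?thesis by (intro exI[of _ "y / inverse (real (Suc k))"]) (simp del: of_nat_Suc)
    qed
    ultimately have ReD: "Re D \<ge> 0" "Im D = 0"
    proof -
      assume l: "(\<lambda>k. q (1 * of_real (inverse (real (Suc k)))) / (1 * of_real (inverse (real (Suc k))))) \<longlonglongrightarrow> D"
      assume r: "\<And>k. \<exists>y>0. q (1 * of_real (inverse (real (Suc k)))) / (1 * of_real (inverse (real (Suc k)))) = of_real y"
      have R: "Re (q (1 * of_real (inverse (real (Suc k)))) / (1 * of_real (inverse (real (Suc k))))) \<ge> 0" for k
        using r[of k] by (metis Re_complex_of_real less_imp_le)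
      have I: "Im (q (1 * of_real (inverse (real (Suc k)))) / (1 * of_real (inverse (real (Suc k))))) = 0" for k
        using r[of k] by (metis Im_complex_of_real)
      show "Re D \<ge> 0" using tendsto_lowerbound[OF tendsto_Re[OF l]] R by auto
      have "(\<lambda>k::nat. 0) \<longlonglongrightarrow> Im D" using tendsto_Im[OF l] by (simp only: I)
      then show "Im D = 0" by (simp add: LIMSEQ_const_iff)
    qed
    then have "Re D > 0" using D0 by (auto simp: complex_eq_iff less_le)
    define w where "w k = \<i> * of_real (inverse (real (Suc k)))" for k :: nat
    have wlim: "filterlim w (at 0) sequentially" unfolding w_def by (rule at0) simp
    have "(\<lambda>k. q (w k) / w k) \<longlonglongrightarrow> D" by (rule filterlim_compose[OF lim wlim])
    then have "\<forall>\<^sub>F k in sequentially. Re (q (w k) / w k) > 0"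
      using order_tendstoD(1)[OF tendsto_Re \<open>Re D > 0\<close>] by blast
    moreover have "\<forall>\<^sub>F k in sequentially. w k \<in> basin"
      using wlim open_basin zb by (auto simp: filterlim_at dest: topological_tendstoD)
    ultimately obtain k where k: "Re (q (w k) / w k) > 0" "w k \<in> basin"
      using eventually_happens'[OF sequentially_bot eventually_conj] by blast
    define s where "s = inverse (real (Suc k))"
    have s: "s > 0" by (simp add: s_def)
    have wk: "w k = \<i> * of_real s" by (simp add: w_def s_def)
    have "v / w k = - \<i> * v / of_real s" for v
      using s by (simp add: wk field_simps)
    then have "Re (q (w k) / w k) = Im (q (w k)) / s" by (simp only: Re_divide_of_real) simp
    then have "Im (q (w k)) > 0" using k(1) s by (simp add: zero_less_divide_iff)
    moreover have "Im (w k) > 0" using s by (simp add: w_def s_def[symmetric])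
    ultimately show ?thesis using k(2) by blast
  qed
  then obtain z0 where z0: "z0 \<in> basin" "Im z0 > 0" "Im (q z0) > 0" by blast
  have "q z0 \<in> P" using z0 q_in_disc by (simp add: P_def)
  then have z0J: "Im z0 \<in> J" using q_inv_q[OF z0(1)] by (force simp: J_def)
  have Jpos: "t > 0" if "t \<in> J" for t
  proof (rule ccontr)
    assume "\<not> t > 0"
    then have "0 \<in> J" using connectedD_interval[OF \<open>connected J\<close> that z0J, of 0] z0(2) by auto
    then show False using J0 by blast
  qed
  have pos: "Im z > 0" if "z \<in> basin" "Im (q z) > 0" for z
  proof -
    have "q z \<in> P" using that q_in_disc by (simp add: P_def)
    then have "Im z \<in> J" using q_inv_q[OF that(1)] by (force simp: J_def)
    then show ?thesis by (rule Jpos)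
  qed
  show up: "Im (q z) > 0" if z: "z \<in> basin" "Im z > 0" for z
  proof (rule ccontr)
    assume "\<not> ?thesis"
    then have "Im (q (cnj z)) > 0" using q_real[OF z(1)] z(2) q_cnj[OF z(1)] by simp
    then show False using pos[of "cnj z"] z by simp
  qed
  have "{z \<in> basin. Im z > 0} = q_inv ` P"
  proof
    show "{z \<in> basin. Im z > 0} \<subseteq> q_inv ` P"
    proof clarify
      fix z assume z: "z \<in> basin" "Im z > 0"
      then have "q z \<in> P" using up q_in_disc by (auto simp: P_def)
      then show "z \<in> q_inv ` P" using q_inv_q[OF z(1)] by force
    qed
    show "q_inv ` P \<subseteq> {z \<in> basin. Im z > 0}"
      using pos q_inv_in_basin q_q_inv by (auto simp: P_def)
  qed
  then show "connected {z \<in> basin. Im z > 0}"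
    using connP by (auto simp: P_def intro!: connected_continuous_image continuous_on_subset[OF qinv_cont])
qed

lemma q_power_upper:
  assumes "z \<in> basin" "Im (f z) > 0"
  shows "Im (q z ^ Suc n) > 0"
proof -
  have fb: "f z \<in> basin" using assms(1) by (rule f_basin)
  have "Im (q (f z)) > 0" by (rule upper_basin(2)[OF fb assms(2)])
  moreover have "norm (q (f z)) < 1" using q_in_disc[OF fb] by simp
  ultimately have "Im (Moebius_function 0 (of_real c) (q (f z))) > 0"
    using c_abs by (intro Im_Moebius_real_pos)
  then show ?thesis by (simp only: Moebius_c_q[OF assms(1)])
qed

text \<open>
  The branch of \<open>f\<^sup>-\<^sup>1\<close> on the upper half of the basin that fixes the right end corresponds in the
  model to the principal \<open>(n+1)\<close>-st root, because both are positive on the positive real axis.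
\<close>

lemma q_in_sector_far_right:
  "\<exists>M\<ge>0. \<forall>z\<in>basin. Re z > M \<and> Im z > 0 \<longrightarrow> Im (f z) > 0 \<and> q z \<in> sector (Suc n)"
proof -
  obtain M where M: "M \<ge> 0" "\<And>z. z \<in> strip \<Longrightarrow> Re z > M \<Longrightarrow> Im z > 0 \<Longrightarrow>
      Im (f z) > 0 \<and> \<zeta> z = root_fun (Suc n) (f z - of_real crit_val)"
    using \<zeta>_eq_root_fun_far_right by blast
  \<comment> \<open>The comparison of roots needs a connected domain. \<open>U1\<close> contains the
    far right part of the upper half of the basin and is the image of that half under a continuous
    inverse branch of \<open>f\<close>.\<close>
  define U1 where "U1 = {z \<in> basin. Im (f z) > 0 \<and> \<zeta> z = root_fun (Suc n) (f z - of_real crit_val)}"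
  have far: "z \<in> U1" if "z \<in> basin" "Re z > M" "Im z > 0" for z
    using that M(2) basin_subset_strip by (auto simp: U1_def)
  have "connected U1"
  proof -
    define V where "V = {z \<in> basin. Im z > 0}"
    define s where "s v = inv_into strip1 \<zeta> (root_fun (Suc n) (v - of_real crit_val))" for v
    have notneg: "v - of_real crit_val \<notin> \<real>\<^sub>\<le>\<^sub>0" if "v \<in> V" for v
      using that by (intro Im_pos_not_nonpos) (simp add: V_def)
    have rT: "root_fun (Suc n) (v - of_real crit_val) \<in> T" if "v \<in> V" for v
    proof -
      have "v - of_real crit_val \<noteq> 0" using notneg[OF that] by auto
      then have "of_real crit_val + root_fun (Suc n) (v - of_real crit_val) ^ Suc n = v"
        by (subst root_fun_power) auto
      then show ?thesis using that basin_subset_strip by (auto simp: T_def V_def)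
    qed
    have contr: "continuous_on V (\<lambda>v. root_fun (Suc n) (v - of_real crit_val))"
      using notneg by (intro root_fun_continuous continuous_intros) auto
    have conti: "continuous_on T (inv_into strip1 \<zeta>)"
      using conformal_onto_inv_into[OF open_strip1 \<zeta>_conformal]
      by (auto simp: conformal_onto_def intro: holomorphic_on_imp_continuous_on)
    have "continuous_on V s"
      unfolding s_def by (rule continuous_on_compose2[OF conti contr]) (use rT in blast)
    moreover have "connected V" unfolding V_def by (rule upper_basin(1))
    ultimately have "connected (s ` V)" by (rule connected_continuous_image)
    moreover have "s ` V = U1"
    proof
      show "s ` V \<subseteq> U1"
      proof clarify
        fix v assume v: "v \<in> V"
        have img: "root_fun (Suc n) (v - of_real crit_val) \<in> \<zeta> ` strip1"
          using rT[OF v] \<zeta>_conformal by (auto simp: conformal_onto_def bij_betw_def)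
        have s1: "s v \<in> strip1" "\<zeta> (s v) = root_fun (Suc n) (v - of_real crit_val)"
          using img by (auto simp: s_def intro: inv_into_into f_inv_into_f)
        then have sS: "s v \<in> strip" by (simp add: strip1_def)
        have "v - of_real crit_val \<noteq> 0" using notneg[OF v] by auto
        then have "\<zeta> (s v) ^ Suc n = v - of_real crit_val"
          unfolding s1(2) by (intro root_fun_power zero_less_Suc)
        then have "f (s v) - of_real crit_val = v - of_real crit_val"
          using \<zeta>_power[OF sS] by metis
        then have fs: "f (s v) = v" by simp
        then have "s v \<in> basin" using f_in_basin_iff[OF sS] v by (simp add: V_def)
        then show "s v \<in> U1" using fs v s1(2) by (simp add: U1_def V_def)
      qed
      show "U1 \<subseteq> s ` V"
      proof
        fix z assume z: "z \<in> U1"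
        then have zb: "z \<in> basin" by (simp add: U1_def)
        then have fb: "f z \<in> basin" by (rule f_basin)
        have "z \<in> strip1" using zb fb basin_subset_strip by (auto simp: strip1_def)
        then have "inv_into strip1 \<zeta> (\<zeta> z) = z"
          using \<zeta>_conformal by (simp add: conformal_onto_def bij_betw_def inv_into_f_f)
        then have "s (f z) = z" using z by (simp add: s_def U1_def)
        moreover have "f z \<in> V" using z fb by (simp add: U1_def V_def)
        ultimately show "z \<in> s ` V" by force
      qed
    qed
    ultimately show ?thesis by simp
  qed
  define R where "R z = q z / root_fun (Suc n) (q z ^ Suc n)" for z
  have U1b: "U1 \<subseteq> basin" by (auto simp: U1_def)
  have U1q: "Im (q z ^ Suc n) > 0" if "z \<in> U1" for z
    using that by (intro q_power_upper) (auto simp: U1_def)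
  have contq: "continuous_on U1 q" by (rule continuous_on_subset[OF q_continuous U1b])
  have cont: "continuous_on U1 R"
    unfolding R_def using U1q
    by (intro continuous_intros root_fun_continuous contq Im_pos_not_nonpos) auto
  have pow: "R z ^ Suc n = 1" if "z \<in> U1" for z
  proof -
    have "q z ^ Suc n \<noteq> 0" using U1q[OF that] by (metis less_irrefl zero_complex.sel(2))
    then show ?thesis unfolding R_def power_divide by (subst root_fun_power) auto
  qed
  obtain \<omega> where \<omega>: "\<And>z. z \<in> U1 \<Longrightarrow> R z = \<omega>"
    by (rule power_eq_1_constant[OF \<open>connected U1\<close> cont zero_less_Suc pow]) (assumption, blast intro: that)
  have "\<omega> = 1"
  proof -
    define x where "x = complex_of_real (M + 1)"
    obtain y where y: "y > 0" "q x = of_real y" using q_of_real_pos[of "M + 1"] M(1) by (auto simp: x_def)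
    have xb: "x \<in> basin" using of_real_in_basin[of "M + 1"] M(1) by (simp add: x_def)
    have Rx: "R x = 1" using y root_fun_of_real_power[of y "Suc n"] by (simp add: R_def)
    have "isCont q x"
      using q_continuous open_basin xb by (simp add: continuous_on_eq_continuous_at)
    moreover have "q x ^ Suc n \<notin> \<real>\<^sub>\<le>\<^sub>0"
      unfolding y(2) using y(1) by (metis linorder_not_less nonpos_Reals_of_real_iff of_real_power zero_less_power)
    ultimately have "isCont R x"
      unfolding R_def root_fun_def by (intro continuous_intros) (simp_all del: of_nat_Suc power_Suc)
    \<comment> \<open>The real point \<open>x\<close> is not in \<open>U1\<close>; its value
      \<open>R x = 1\<close> is carried over to \<open>U1\<close> by continuity along points above
      it.\<close>
    define Z where "Z k = x + \<i> * of_real (inverse (real (Suc k)))" for k :: nat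
    have "Z \<longlonglongrightarrow> x + \<i> * of_real 0"
      unfolding Z_def by (intro tendsto_intros LIMSEQ_inverse_real_of_nat)
    then have Zx: "Z \<longlonglongrightarrow> x" by simp
    have "(\<lambda>k. R (Z k)) \<longlonglongrightarrow> R x" by (rule isCont_tendsto_compose[OF \<open>isCont R x\<close> Zx])
    moreover have "\<forall>\<^sub>F k in sequentially. R (Z k) = \<omega>"
    proof -
      have "\<forall>\<^sub>F k in sequentially. Z k \<in> basin" using topological_tendstoD[OF Zx open_basin xb] .
      then show ?thesis
      proof eventually_elim
        case (elim k)
        have "Im (Z k) > 0" by (simp add: Z_def x_def)
        moreover have "Re (Z k) > M" by (simp add: Z_def x_def)
        ultimately show ?case using elim far \<omega> by blast
      qed
    qed
    ultimately have "(\<lambda>k::nat. \<omega>) \<longlonglongrightarrow> 1" unfolding Rx by (rule Lim_transform_eventually)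
    then show ?thesis by (simp add: LIMSEQ_const_iff)
  qed
  have "q z \<in> sector (Suc n)" if z: "z \<in> basin" "Re z > M" "Im z > 0" for z
  proof (rule in_sector)
    have zU: "z \<in> U1" by (rule far[OF z])
    show "norm (q z) \<le> 1" using q_in_disc[OF z(1)] by simp
    show "Im (q z ^ Suc n) > 0" by (rule U1q[OF zU])
    show "q z = root_fun (Suc n) (q z ^ Suc n)" using \<omega>[OF zU] \<open>\<omega> = 1\<close> by (simp add: R_def)
  qed simp
  moreover have "Im (f z) > 0" if "z \<in> basin" "Re z > M" "Im z > 0" for z
    using far[OF that] by (simp add: U1_def)
  ultimately show ?thesis using M(1) by blast
qed

text \<open>\<open>\<omega>\<close> is only assumed to be a limit of \<open>q\<close> along one
  sequence tending to \<open>w\<close>. Iterates of this sequence lie in the sector as long as they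
  are far to the right; the sector is closed, so the orbit of \<open>\<omega>\<close> under
  \<open>g\<close> lies in it too, and compactness makes each step away from 1 at least
  \<open>\<epsilon>\<close>.\<close>

lemma boundary_orbit_bound:
  assumes \<delta>: "\<delta> > 0"
  shows "\<exists>M\<ge>0. \<forall>Z w \<omega>. (\<forall>k::nat. Z k \<in> basin) \<and> Z \<longlonglongrightarrow> w \<and> Im w > 0 \<and> (\<lambda>k. q (Z k)) \<longlonglongrightarrow> \<omega> \<and>
    norm \<omega> = 1 \<and> \<delta> \<le> norm (1 - \<omega>) \<longrightarrow> Re w \<le> M"
proof -
  obtain M1 where M1: "M1 \<ge> 0" "\<And>z. z \<in> basin \<Longrightarrow> Re z > M1 \<Longrightarrow> Im z > 0 \<Longrightarrow> Im (f z) > 0 \<and> q z \<in> sector (Suc n)"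
    using q_in_sector_far_right by blast
  obtain M2 where M2: "M2 \<ge> 0" "far M2" using far_exists by blast
  define M0 where "M0 = max M1 M2"
  define X where "X = sector (Suc n) \<inter> sphere 0 1 \<inter> {p. \<delta> \<le> norm (1 - p)}"
  define e where "e p = norm (1 - g p) - norm (1 - p)" for p
  have "closed {p::complex. \<delta> \<le> norm (1 - p)}" by (intro closed_Collect_le continuous_intros)
  then have X: "compact X"
    unfolding X_def using closed_sector
    by (metis compact_Int_closed compact_sphere inf_commute inf_left_commute)
  have epos: "e p > 0" if "p \<in> X" for p
  proof -
    have "p \<noteq> 1" using that \<delta> by (auto simp: X_def)
    then have "norm (1 - p) < norm (1 - g p)"
      using that n_pos c_pos c_less_1 multiplier_one by (intro blaschke_expands_on_sector) (auto simp: X_def)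
    then show ?thesis by (simp add: e_def)
  qed
  have "continuous_on X e"
    unfolding e_def
    by (intro continuous_intros continuous_on_subset[OF blaschke_continuous[OF c_abs]]) (auto simp: X_def)
  obtain \<epsilon> where \<epsilon>: "\<epsilon> > 0" "\<And>p. p \<in> X \<Longrightarrow> \<epsilon> \<le> e p"
  proof (cases "X = {}")
    case True
    then show thesis using that[of 1] by auto
  next
    case False
    then obtain p0 where "p0 \<in> X" "\<And>p. p \<in> X \<Longrightarrow> e p0 \<le> e p"
      using continuous_attains_inf[OF X False \<open>continuous_on X e\<close>] by metis
    then show thesis using that[of "e p0"] epos by auto
  qed
  \<comment> \<open>After \<open>m\<close> steps the distance to 1 would exceed the diameter 2 of
    the disc. A step lowers \<open>Re\<close> by less than 1, so starting beyond
    \<open>M0 + m\<close> keeps all these steps in the far region.\<close>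
  obtain m :: nat where m: "real m * \<epsilon> > 2" using reals_Archimedean3[OF \<epsilon>(1)] by blast
  have "Re w \<le> M0 + real m"
    if Z: "\<And>k::nat. Z k \<in> basin" "Z \<longlonglongrightarrow> w" "Im w > 0" "(\<lambda>k. q (Z k)) \<longlonglongrightarrow> \<omega>" "norm \<omega> = 1" "\<delta> \<le> norm (1 - \<omega>)"
    for Z w \<omega>
  proof (rule ccontr)
    assume "\<not> ?thesis"
    then have Rew: "Re w > M0 + real m" by simp
    have ev: "\<forall>\<^sub>F k in sequentially. Re (Z k) > M0 + real m \<and> Im (Z k) > 0"
      using order_tendstoD(1)[OF tendsto_Re[OF Z(2)] Rew] order_tendstoD(1)[OF tendsto_Im[OF Z(2)] Z(3)]
      by (rule eventually_conj)
    have orbit: "Re ((f ^^ j) z) > M0 + real (m - j) \<and> Im ((f ^^ j) z) > 0"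
      if z: "z \<in> basin" "Re z > M0 + real m" "Im z > 0" and "j \<le> m" for z j
      using \<open>j \<le> m\<close>
    proof (induction j)
      case (Suc j)
      let ?z = "(f ^^ j) z"
      have IH: "Re ?z > M0 + real (m - j)" "Im ?z > 0" using Suc by auto
      have zb: "?z \<in> basin" by (rule iter_basin[OF z(1)])
      have far1: "Re ?z > M1" "Re ?z > M2" using IH(1) by (auto simp: M0_def)
      have "norm (f ?z - ?z) < 1 / 4" using M2(2) far1(2) by (auto simp: far_def)
      then have "\<bar>Re (f ?z) - Re ?z\<bar> < 1 / 4" using abs_Re_le_cmod[of "f ?z - ?z"] by simp
      then have "Re (f ?z) > Re ?z - 1" by linarith
      moreover have "real (m - j) = real (m - Suc j) + 1" using Suc.prems by simp
      ultimately show ?case using IH(1) M1(2)[OF zb far1(1) IH(2)] by simp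
    qed (use z in simp)
    have in_sec: "(g ^^ j) \<omega> \<in> sector (Suc n)" and norm1: "norm ((g ^^ j) \<omega>) = 1"
      and lim: "(\<lambda>k. q ((f ^^ j) (Z k))) \<longlonglongrightarrow> (g ^^ j) \<omega>" if "j \<le> m" for j
    proof -
      have l: "(\<lambda>k. q ((f ^^ j) (Z k))) \<longlonglongrightarrow> (g ^^ j) \<omega> \<and> norm ((g ^^ j) \<omega>) = 1" for j
      proof (induction j)
        case (Suc j)
        have "(\<lambda>k. g (q ((f ^^ j) (Z k)))) \<longlonglongrightarrow> g ((g ^^ j) \<omega>)"
        proof (rule continuous_on_tendsto_compose[OF blaschke_continuous[OF c_abs]])
          show "(\<lambda>k. q ((f ^^ j) (Z k))) \<longlonglongrightarrow> (g ^^ j) \<omega>" using Suc by blast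
          show "(g ^^ j) \<omega> \<in> cball 0 1" using Suc by simp
          have "q ((f ^^ j) (Z k)) \<in> cball 0 1" for k
            using q_in_disc[OF iter_basin[OF Z(1)[of k], of j]] by simp
          then show "\<forall>\<^sub>F k in sequentially. q ((f ^^ j) (Z k)) \<in> cball 0 1" by simp
        qed
        moreover have "g (q ((f ^^ j) (Z k))) = q ((f ^^ Suc j) (Z k))" for k
          using q_f[OF iter_basin[OF Z(1)[of k], of j]] by simp
        ultimately show ?case using norm_g_unit Suc by simp
      qed (use Z in simp)
      show "norm ((g ^^ j) \<omega>) = 1" "(\<lambda>k. q ((f ^^ j) (Z k))) \<longlonglongrightarrow> (g ^^ j) \<omega>" using l by blast+
      have "\<forall>\<^sub>F k in sequentially. q ((f ^^ j) (Z k)) \<in> sector (Suc n)"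
        using ev
      proof eventually_elim
        case (elim k)
        then have "Re ((f ^^ j) (Z k)) > M0 + real (m - j)" "Im ((f ^^ j) (Z k)) > 0"
          using orbit[OF Z(1) _ _ that] by auto
        moreover have "M1 \<le> M0 + real (m - j)" by (simp add: M0_def)
        ultimately show ?case using M1(2)[OF iter_basin[OF Z(1)]] by auto
      qed
      then show "(g ^^ j) \<omega> \<in> sector (Suc n)"
        by (rule Lim_in_closed_set[OF closed_sector _ sequentially_bot conjunct1[OF l[of j]]])
    qed
    have grow: "norm (1 - (g ^^ j) \<omega>) \<ge> \<delta> + real j * \<epsilon>" if "j \<le> m" for j
      using that
    proof (induction j)
      case (Suc j)
      then have IH: "norm (1 - (g ^^ j) \<omega>) \<ge> \<delta> + real j * \<epsilon>" by simp
      moreover have "0 \<le> real j * \<epsilon>" using \<epsilon>(1) by simp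
      ultimately have "(g ^^ j) \<omega> \<in> X" using in_sec[of j] norm1[of j] Suc.prems by (auto simp: X_def)
      then have "\<epsilon> \<le> e ((g ^^ j) \<omega>)" by (rule \<epsilon>(2))
      then show ?case using IH by (simp add: e_def algebra_simps)
    qed (use Z in simp)
    have "norm (1 - (g ^^ m) \<omega>) \<le> 1 + norm ((g ^^ m) \<omega>)" by (metis norm_one norm_triangle_ineq4)
    then show False using grow[of m] norm1[of m] m \<delta> by simp
  qed
  moreover have "M0 + real m \<ge> 0" using M1(1) by (simp add: M0_def)
  ultimately show ?thesis by blast
qed

text \<open>The Cayley map and a disc automorphism turn the real line into the circle with infinity
  sent to the Denjoy-Wolff point 1, so a bounded interval stays at positive distance from 1. Upper
  values are covered by \<open>boundary_orbit_bound\<close>, lower ones by conjugation, and real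
  ones are negative because the nonnegative axis lies in the basin.\<close>

lemma finite_target_bounded:
  assumes E: "finite_target f basin E"
  shows "E \<subseteq> frontier basin \<and> (\<exists>M. \<forall>w\<in>E. Re w \<le> M)"
proof -
  obtain \<psi> x1 x2 where \<psi>: "conformal_onto \<psi> upper_half_plane basin"
    and orb: "\<And>z. z \<in> upper_half_plane \<Longrightarrow>
      filterlim (\<lambda>k. (conjugated_map f \<psi> upper_half_plane ^^ k) z) at_infinity sequentially"
    and Eeq: "E = {w. \<exists>x\<in>{x1..x2}. nontangential_limit \<psi> x w}"
    using E unfolding finite_target_def by blast
  define Cay where "Cay t = (t - \<i>) / (t + \<i>)" for t
  have Cay: "conformal_onto Cay upper_half_plane unit_disc"
    using Cayley_conformal by (simp add: Cay_def[abs_def])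
  have openH: "open upper_half_plane" by (rule open_halfspace_Im_gt)
  have \<psi>b: "\<psi> t \<in> basin" if "Im t > 0" for t
    using \<psi> that by (auto simp: conformal_onto_def bij_betw_def)
  obtain \<alpha> a where \<alpha>: "norm \<alpha> = 1" "norm a < 1"
      "\<And>p. p \<in> unit_disc \<Longrightarrow> ((q \<circ> \<psi>) \<circ> inv_into upper_half_plane Cay) p = \<alpha> * Moebius_function 0 a p"
    using conformal_onto_unit_disc_eq_Moebius[OF conformal_onto_comp[OF conformal_onto_inv_into[OF openH Cay]
        conformal_onto_comp[OF \<psi> q_conformal]]] by blast
  have q\<psi>: "q (\<psi> t) = \<alpha> * Moebius_function 0 a (Cay t)" if "Im t > 0" for t
  proof -
    have "Cay t \<in> unit_disc" "inv_into upper_half_plane Cay (Cay t) = t"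
      using Cay that by (auto simp: conformal_onto_def bij_betw_def)
    then show ?thesis using \<alpha>(3)[of "Cay t"] by simp
  qed
  \<comment> \<open>The orbit of \<open>\<i>\<close> tends to infinity in the half-plane, hence to 1
    under the Cayley map, while its image under \<open>q o \<psi>\<close> tends to 1 by
    \<open>q_orbit_tendsto_1\<close>.\<close>
  have \<beta>1: "\<alpha> * Moebius_function 0 a 1 = 1"
  proof -
    have bij: "bij_betw \<psi> upper_half_plane basin" using \<psi> by (simp add: conformal_onto_def)
    have iH: "\<i> \<in> upper_half_plane" by simp
    define t where "t k = (conjugated_map f \<psi> upper_half_plane ^^ k) \<i>" for k
    have tH: "Im (t k) > 0" "\<psi> (t k) = (f ^^ k) (\<psi> \<i>)" for k
      using conjugated_map_iter[OF bij f_image_basin iH, of k] by (auto simp: t_def)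
    have "(\<lambda>k. Cay (t k)) \<longlonglongrightarrow> 1"
      unfolding Cay_def t_def by (rule Cayley_tendsto_at_infinity[OF orb[OF iH]])
    then have "(\<lambda>k. \<alpha> * Moebius_function 0 a (Cay (t k))) \<longlonglongrightarrow> \<alpha> * Moebius_function 0 a 1"
      using \<alpha>(2) by (intro tendsto_mult tendsto_const tendsto_disc_automorphism) auto
    then have "(\<lambda>k. q ((f ^^ k) (\<psi> \<i>))) \<longlonglongrightarrow> \<alpha> * Moebius_function 0 a 1"
      using q\<psi>[OF tH(1)] tH(2) by simp
    moreover have "(\<lambda>k. q ((f ^^ k) (\<psi> \<i>))) \<longlonglongrightarrow> 1"
      by (rule q_orbit_tendsto_1[OF \<psi>b]) simp
    ultimately show ?thesis by (rule LIMSEQ_unique)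
  qed
  define \<omega> where "\<omega> x = \<alpha> * Moebius_function 0 a (Cay (of_real x))" for x :: real
  have CayR: "norm (Cay (of_real x)) = 1" for x unfolding Cay_def by (rule Cayley_norm_real)
  have den: "1 - cnj a * s \<noteq> 0" if "norm s = 1" for s
    using \<alpha>(2) that by (metis complex_mod_cnj mult.right_neutral norm_mult norm_one order_less_irrefl right_minus_eq)
  have xi: "complex_of_real x + \<i> \<noteq> 0" for x by (simp add: complex_eq_iff)
  have n\<omega>: "norm (\<omega> x) = 1" for x
    unfolding \<omega>_def using \<alpha>(1) norm_Moebius_function_unit[OF \<alpha>(2) CayR] by (simp add: norm_mult)
  have \<omega>1: "\<omega> x \<noteq> 1" for x
  proof
    assume "\<omega> x = 1"
    define s where "s = Cay (of_real x)"
    have "\<alpha> \<noteq> 0" using \<alpha>(1) by auto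
    then have "Moebius_function 0 a s = Moebius_function 0 a 1"
      using \<open>\<omega> x = 1\<close> \<beta>1 by (metis \<omega>_def mult_left_cancel s_def)
    then have "(s - a) * (1 - cnj a) = (1 - a) * (1 - cnj a * s)"
      using den[of 1] den[OF CayR[of x]] unfolding Moebius_function_simple s_def by (simp add: frac_eq_eq)
    then have "(s - 1) * (1 - a * cnj a) = 0" by (simp add: algebra_simps)
    moreover have "1 - a * cnj a \<noteq> 0"
      using \<alpha>(2) by (metis abs_norm_cancel abs_square_less_1 complex_norm_square less_irrefl of_real_1 of_real_eq_iff right_minus_eq)
    ultimately have "s = 1" by simp
    then have "of_real x - \<i> = of_real x + \<i>" using xi[of x] by (simp add: s_def Cay_def)
    then show False by (simp add: complex_eq_iff)
  qed
  have "continuous_on UNIV (\<lambda>x. Cay (complex_of_real x))"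
    unfolding Cay_def using xi by (intro continuous_intros) auto
  then have "continuous_on UNIV \<omega>"
    unfolding \<omega>_def[abs_def] Moebius_function_simple
    by (intro continuous_intros) (use den[OF CayR] in auto)
  then have "continuous_on {x1..x2} (\<lambda>x. norm (1 - \<omega> x))"
    by (intro continuous_intros) (auto intro: continuous_on_subset)
  obtain \<delta> where \<delta>: "\<delta> > 0" "\<And>x. x \<in> {x1..x2} \<Longrightarrow> \<delta> \<le> norm (1 - \<omega> x)"
  proof (cases "{x1..x2} = {}")
    case True
    then show thesis using that[of 1] by auto
  next
    case False
    then obtain x0 where "x0 \<in> {x1..x2}" "\<And>x. x \<in> {x1..x2} \<Longrightarrow> norm (1 - \<omega> x0) \<le> norm (1 - \<omega> x)"
      using continuous_attains_inf[OF compact_Icc False \<open>continuous_on {x1..x2} (\<lambda>x. norm (1 - \<omega> x))\<close>] by metis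
    then show thesis using that[of "norm (1 - \<omega> x0)"] \<omega>1[of x0] by simp
  qed
  obtain M where M: "M \<ge> 0" "\<And>Z w \<omega>. (\<And>k::nat. Z k \<in> basin) \<Longrightarrow> Z \<longlonglongrightarrow> w \<Longrightarrow> Im w > 0 \<Longrightarrow> (\<lambda>k. q (Z k)) \<longlonglongrightarrow> \<omega> \<Longrightarrow>
    norm \<omega> = 1 \<Longrightarrow> \<delta> \<le> norm (1 - \<omega>) \<Longrightarrow> Re w \<le> M"
    using boundary_orbit_bound[OF \<delta>(1)] by blast
  have main: "w \<in> frontier basin \<and> Re w \<le> M" if w: "w \<in> E" for w
  proof -
    obtain x where x: "x \<in> {x1..x2}" "nontangential_limit \<psi> x w" using w Eeq by blast
    define t where "t k = of_real x + \<i> * of_real (inverse (real (Suc k)))" for k :: nat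
    have Imt: "Im (t k) > 0" for k by (simp add: t_def)
    have "t \<longlonglongrightarrow> of_real x + \<i> * of_real 0"
      unfolding t_def by (intro tendsto_intros LIMSEQ_inverse_real_of_nat)
    then have tx: "t \<longlonglongrightarrow> of_real x" by simp
    have "filterlim t (at_stolz x 1) sequentially"
      unfolding at_stolz_def filterlim_at
    proof (intro conjI always_eventually allI tx)
      fix k
      show "t k \<in> {z. Im z > 0 \<and> \<bar>Re z - x\<bar> \<le> 1 * Im z}" using Imt[of k] by (simp add: t_def)
      show "t k \<noteq> of_real x" using Imt[of k] by auto
    qed
    moreover have "(\<psi> \<longlongrightarrow> w) (at_stolz x 1)" using x(2) by (simp add: nontangential_limit_def)
    ultimately have Zw: "(\<lambda>k. \<psi> (t k)) \<longlonglongrightarrow> w" by (rule filterlim_compose[rotated])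
    have Zb: "\<psi> (t k) \<in> basin" for k using \<psi>b Imt by blast
    have "(\<lambda>k. Cay (t k)) \<longlonglongrightarrow> Cay (of_real x)"
      unfolding Cay_def by (intro tendsto_intros tx xi)
    then have "(\<lambda>k. \<alpha> * Moebius_function 0 a (Cay (t k))) \<longlonglongrightarrow> \<omega> x"
      unfolding \<omega>_def by (intro tendsto_mult tendsto_const tendsto_disc_automorphism \<alpha>(2) CayR)
    then have qZ: "(\<lambda>k. q (\<psi> (t k))) \<longlonglongrightarrow> \<omega> x" using q\<psi>[OF Imt] by simp
    have wcl: "w \<in> closure basin" using Zw Zb
      by (intro closure_sequential[THEN iffD2] exI[of _ "\<lambda>k. \<psi> (t k)"] conjI allI)
    have wnot: "w \<notin> basin"
    proof
      assume wb: "w \<in> basin"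
      have "(\<lambda>k. q (\<psi> (t k))) \<longlonglongrightarrow> q w"
        by (rule continuous_on_tendsto_compose[OF q_continuous Zw wb]) (simp add: Zb)
      then have "q w = \<omega> x" using qZ LIMSEQ_unique by blast
      then show False using q_in_disc[OF wb] n\<omega>[of x] by simp
    qed
    have "Re w \<le> M"
    proof (cases "Im w > 0")
      case True
      show ?thesis by (rule M(2)[OF Zb Zw True qZ n\<omega> \<delta>(2)[OF x(1)]])
    next
      case False
      show ?thesis
      proof (cases "Im w = 0")
        case True
        then have "w = of_real (Re w)" by (simp add: complex_eq_iff)
        then have "Re w < 0" using wnot of_real_in_basin by (metis linorder_not_less)
        then show ?thesis using M(1) by simp
      next
        case False
        have "Re (cnj w) \<le> M"
        proof (rule M(2))
          show "cnj (\<psi> (t k)) \<in> basin" for k using Zb by simp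
          show "(\<lambda>k. cnj (\<psi> (t k))) \<longlonglongrightarrow> cnj w" by (intro tendsto_cnj Zw)
          show "Im (cnj w) > 0" using False \<open>\<not> Im w > 0\<close> by simp
          have "(\<lambda>k. cnj (q (\<psi> (t k)))) \<longlonglongrightarrow> cnj (\<omega> x)" by (intro tendsto_cnj qZ)
          then show "(\<lambda>k. q (cnj (\<psi> (t k)))) \<longlonglongrightarrow> cnj (\<omega> x)" using q_cnj[OF Zb] by simp
          show "norm (cnj (\<omega> x)) = 1" using n\<omega> by simp
          have "1 - cnj (\<omega> x) = cnj (1 - \<omega> x)" by simp
          then show "\<delta> \<le> norm (1 - cnj (\<omega> x))" using \<delta>(2)[OF x(1)] by (metis complex_mod_cnj)
        qed
        then show ?thesis by simp
      qed
    qed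
    then show ?thesis using wcl wnot open_basin by (simp add: frontier_def interior_open)
  qed
  then show ?thesis by blast
qed

lemma expanding_basin: "expanding_baker_domain f basin"
proof -
  obtain r1 where r1: "r1 > 0" "\<And>x z. x \<in> frontier basin \<Longrightarrow> z \<in> ball x r1 \<Longrightarrow> norm (u z) > 1"
    using frontier_basin_margin by blast
  obtain r2 where r2: "r2 > 0" "\<And>y. norm (u y) > 1 \<Longrightarrow>
     \<exists>F \<epsilon>. \<epsilon> > 0 \<and> F holomorphic_on ball (f y) r2 \<and> (\<forall>z\<in>ball (f y) r2. f (F z) = z) \<and>
        (\<forall>z\<in>ball y \<epsilon>. F (f z) = z)"
    using uniform_inverse_branch by blast
  \<comment> \<open>Half of the margin \<open>r1\<close>, because the uniform expansion on targets
    uses discs of twice the radius.\<close>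
  define r where "r = min (r1 / 2) r2"
  have r: "r > 0" "2 * r \<le> r1" "r \<le> r2" using r1(1) r2(1) by (auto simp: r_def)
  have expand: "norm (u z) > 1" if "x \<in> frontier basin" "z \<in> ball x (2 * r)" for x z
    using that r(2) by (intro r1(2)[of x]) auto
  have branch: "\<exists>F. F holomorphic_on ball x r \<and> (\<forall>z\<in>ball x r. f (F z) = z) \<and> F x = y \<and> F ` (ball x r \<inter> basin) \<subseteq> basin"
    if x: "x \<in> frontier basin" and y: "y \<in> frontier basin" and fy: "f y = x" for x y
  proof -
    have "norm (u y) > 1" using y r1 by (intro r1(2)[of y]) auto
    then obtain F \<epsilon> where F: "\<epsilon> > 0" "F holomorphic_on ball x r2" "\<And>z. z \<in> ball x r2 \<Longrightarrow> f (F z) = z"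
        "\<And>z. z \<in> ball y \<epsilon> \<Longrightarrow> F (f z) = z"
      using r2(2) fy by blast
    have hol: "F holomorphic_on ball x r" using F(2) r(3) by (auto intro: holomorphic_on_subset)
    have fF: "f (F z) = z" if "z \<in> ball x r" for z using F(3) that r(3) by auto
    have "F x = y" using F(4)[of y] F(1) fy by simp
    moreover have "F ` (ball x r \<inter> basin) \<subseteq> basin"
      by (rule inverse_branch_basin[OF r(1) x y fy hol fF F(1,4)])
    ultimately show ?thesis using hol fF by blast
  qed
  have deriv1: "norm (deriv f z) > 1" if "x \<in> frontier basin" "z \<in> ball x r" for x z
  proof -
    have "norm (u z) > 1" using that r(1) by (intro expand[of x]) auto
    then show ?thesis using n_pos by (simp add: deriv_f norm_power one_less_power)
  qed
  have target: "\<exists>K>1. \<forall>x\<in>E. \<forall>z\<in>ball x r. norm (deriv f z) \<ge> K" if E: "finite_target f basin E" for E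
  proof -
    obtain M where "E \<subseteq> frontier basin" "\<And>w. w \<in> E \<Longrightarrow> Re w \<le> M"
      using finite_target_bounded[OF E] by blast
    then show ?thesis by (intro expansion_bounded_Re[OF r(1) expand]) auto
  qed
  show ?thesis
    unfolding expanding_baker_domain_def
    using r(1) doubly_parabolic_basin Denjoy_Wolff_basin branch deriv1 target
    by (intro exI[of _ r]) blast
qed

end

context strip_map
begin

lemma expanding_baker_domain_basin: "expanding_baker_domain f basin"
proof -
  obtain q c where model: "conformal_onto q basin unit_disc" "0 < c" "c < 1"
    "\<And>z. z \<in> basin \<Longrightarrow> q (f z) = blaschke (Suc n) c (q z)"
    "\<And>x. x > 0 \<Longrightarrow> \<exists>y>0. q (of_real x) = of_real y"
    "q 0 = 0" "\<And>z. z \<in> basin \<Longrightarrow> q (cnj z) = cnj (q z)"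
    using Riemann_model by blast
  interpret disc_model n f q c
    by unfold_locales (fact model)+
  show ?thesis by (rule expanding_basin)
qed

end

text \<open>Dividing the hypothesis by \<open>w\<close> determines \<open>P' w\<close> for
  \<open>w\<close> other than 0 as minus a geometric sum; continuity of \<open>R\<close> bridges the
  single point 0.\<close>

lemma poly_eq_sum:
  fixes P :: "complex poly"
  assumes "poly P 0 = 0" and deriv: "\<And>w. 1 + w * poly (pderiv P) w = (1 - w) ^ n"
  shows "poly P w = - (\<Sum>k=1..n. (1 - (1 - w) ^ k) / of_nat k)"
proof -
  define R where "R = (\<lambda>w::complex. poly P w + (\<Sum>k=1..n. (1 - (1 - w) ^ k) / of_nat k))"
  have d: "(R has_field_derivative poly (pderiv P) w + (\<Sum>k<n. (1 - w) ^ k)) (at w)" for w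
  proof -
    have "((\<lambda>w. (1 - (1 - w) ^ k) / of_nat k) has_field_derivative (1 - w) ^ (k - 1)) (at w)"
      if "k \<in> {1..n}" for k
    proof -
      have "((\<lambda>w. (1 - (1 - w) ^ k) / of_nat k) has_field_derivative of_nat k * (1 - w) ^ (k - 1) / of_nat k) (at w)"
        by (auto intro!: derivative_eq_intros)
      then show ?thesis using that by simp
    qed
    then have "(R has_field_derivative poly (pderiv P) w + (\<Sum>k=1..n. (1 - w) ^ (k - 1))) (at w)"
      unfolding R_def by (intro DERIV_add DERIV_sum poly_DERIV)
    moreover have "(\<Sum>k=1..n. (1 - w) ^ (k - 1)) = (\<Sum>k<n. (1 - w) ^ k)"
      by (rule sum.reindex_bij_witness[of _ Suc "\<lambda>k. k - 1"]) auto
    ultimately show ?thesis by simp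
  qed
  have zero: "poly (pderiv P) w + (\<Sum>k<n. (1 - w) ^ k) = 0" if "w \<noteq> 0" for w
  proof -
    have "1 - (1 - w) ^ n = w * (\<Sum>k<n. (1 - w) ^ k)"
      using one_diff_power_eq[of "1 - w" n] by simp
    moreover have "w * poly (pderiv P) w = (1 - w) ^ n - 1"
      using deriv[of w] by (simp add: eq_diff_eq add.commute)
    ultimately have "w * poly (pderiv P) w + w * (\<Sum>k<n. (1 - w) ^ k) = 0" by (metis diff_add_cancel diff_self add_diff_eq)
    then have "w * (poly (pderiv P) w + (\<Sum>k<n. (1 - w) ^ k)) = 0"
      by (simp only: distrib_left)
    then show ?thesis using that by simp
  qed
  have "R w = R 0"
  proof (rule DERIV_zero_connected_constant[of UNIV "{0}"])
    show "continuous_on UNIV R"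
      by (rule DERIV_continuous_on) (rule has_field_derivative_at_within[OF d])
    show "\<forall>w\<in>UNIV - {0}. (R has_field_derivative 0) (at w)"
    proof
      fix w :: complex assume "w \<in> UNIV - {0}"
      then have "w \<noteq> 0" by simp
      show "(R has_field_derivative 0) (at w)" using d[of w] unfolding zero[OF \<open>w \<noteq> 0\<close>] .
    qed
  qed auto
  then have "poly P w + (\<Sum>k=1..n. (1 - (1 - w) ^ k) / of_nat k) = 0"
    by (simp add: R_def assms(1))
  then show ?thesis by (simp only: eq_neg_iff_add_eq_0)
qed

theorem proposition5p4:
  fixes n :: nat and P :: "complex poly" and f :: "complex \<Rightarrow> complex"
  assumes "n \<ge> 1"
    and "poly P 0 = 0"
    and "\<And>w. 1 + w * poly (pderiv P) w = (1 - w) ^ n"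
    and "\<And>z. f z = z - poly P (exp (- z))"
  shows "(\<exists>!U. baker_domain f U \<and> of_real ` {0<..} \<subseteq> U) \<and>
         (\<forall>U. baker_domain f U \<and> of_real ` {0<..} \<subseteq> U \<longrightarrow> expanding_baker_domain f U)"
proof -
  interpret strip_map n f
  proof
    show "n \<ge> 1" by (rule assms(1))
    show "f z = z + (\<Sum>k=1..n. (1 - (1 - exp (- z)) ^ k) / of_nat k)" for z
      unfolding assms(4) poly_eq_sum[OF assms(2,3)] by simp
  qed
  have "of_real ` {0<..} \<subseteq> basin" using of_real_in_basin by auto
  then show ?thesis
    using baker_domain_basin baker_domain_eq_basin expanding_baker_domain_basin by metis
qed

end
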